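(* Let $q$ be an odd prime power. The limits as $m \rightarrow \infty$ of $\iota_{\mathsf U}(2m, q)$ and $\iota_{\mathsf U}(2m+1, q)$ exist and satisfy $$\lim_{m \rightarrow \infty} \iota_{\mathsf U}(2m, q) = r_{\mathsf U}(\infty, q)\cdot \varphi_{\mathsf U}(q)^3, \qquad \lim_{m \rightarrow \infty} \iota_{\mathsf U}(2m + 1, q) = \frac{r_{\mathsf U}(\infty, q) \cdot \varphi_{\mathsf U}(q)^3}{1 + q^{-1}}.$$
   Context: Let $V = \mathbb{F}_{q^2}^n$, with $q$ odd, equipped with the unitary form having Gram matrix $I_n$, and let $\mathrm{GU}_n(q)$ be its isometry group. $\mathcal{C}_{\mathsf U}(V)$ is the set of involutions $t\in\mathrm{GU}_n(q)$ whose $(+1)$-eigenspace has dimension $\lfloor n/2\rfloor$. A square matrix is *regular semisimple* if its characteristic polynomial is multiplicity-free. $\mathbf{I}_{\mathsf U}(V)=\{(t,t')\in\mathcal{C}_{\mathsf U}(V)^2 \mid tt' \text{ is regular semisimple}\}$ and $\iota_{\mathsf U}(n,q)=|\mathbf{I}_{\mathsf U}(V)|/|\mathcal{C}_{\mathsf U}(V)|^2$. For $n=2m$, $\Delta_{\mathsf U}(2m,q)$ is the set of pairs $(t,y)$ with $t\in\mathcal{C}_{\mathsf U}(V)$, $y\in\mathrm{GU}_{2m}(q)$ regular semisimple, $t^{-1}yt=y^{-1}$, and characteristic polynomial $c_y(X)$ coprime to $X^2-1$; $r_{\mathsf U}(2m,q)=|\Delta_{\mathsf U}(2m,q)|/|\mathrm{GU}_{2m}(q)|$,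 and $r_{\mathsf U}(\infty,q)=\lim_{m\to\infty}r_{\mathsf U}(2m,q)$ (this limit exists). For $z>1$, $\varphi_{\mathsf U}(m,z)=\prod_{i=1}^m(1-(-1)^iz^{-i})$ and $\varphi_{\mathsf U}(z)=\lim_{m\to\infty}\varphi_{\mathsf U}(m,z)$. *)

theory Defs
  imports
    Complex_Main
    "HOL-Library.Cardinality"
    "HOL-Number_Theory.Prime_Powers"
    "HOL-Computational_Algebra.Squarefree"
    "Jordan_Normal_Form.Char_Poly"
    "Jordan_Normal_Form.Matrix_Kernel"
begin

text \<open>
  The field of order \<open>q\<^sup>2\<close> is represented by a finite field type \<open>'a\<close> with \<open>CARD('a) = q\<^sup>2\<close>, and
  linear maps of \<open>V\<close> by matrices acting on column vectors.  The \<^typ>\<open>'a itself\<close> arguments below only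
  pass the field to real-valued constants.
\<close>

text \<open>The sesquilinear form with Gram matrix the identity; \<open>x \<mapsto> x\<^sup>q\<close> is the automorphism
  of order 2 of the field.\<close>

definition unitary_form :: "nat \<Rightarrow> 'a::field vec \<Rightarrow> 'a vec \<Rightarrow> 'a" where
  "unitary_form q u v = u \<bullet> map_vec (\<lambda>x. x ^ q) v"

definition GU :: "nat \<Rightarrow> nat \<Rightarrow> 'a::field mat monoid" where
  "GU n q = \<lparr>
     carrier = {A \<in> carrier_mat n n. \<forall>u \<in> carrier_vec n. \<forall>v \<in> carrier_vec n.
                  unitary_form q (A *\<^sub>v u) (A *\<^sub>v v) = unitary_form q u v},
     mult = (*), one = 1\<^sub>m n \<rparr>"

lemma unitary_form_unit_vec:
  assumes "q > 0" "i < n" "j < n"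
  shows "unitary_form q (unit_vec n i :: 'a::field vec) (unit_vec n j) = (if i = j then 1 else 0)"
proof -
  have "map_vec (\<lambda>x. x ^ q) (unit_vec n j) = (unit_vec n j :: 'a vec)"
    using assms by (intro eq_vecI) auto
  then show ?thesis using assms by (simp add: unitary_form_def)
qed

lemma isometry_left_inverse:
  fixes A :: "'a::field mat"
  assumes q: "q > 0" and A: "A \<in> carrier (GU n q)"
  shows "transpose_mat (map_mat (\<lambda>x. x ^ q) A) * A = 1\<^sub>m n"
proof (rule eq_matI)
  have Ac: "A \<in> carrier_mat n n" using A by (simp add: GU_def)
  show "dim_row (transpose_mat (map_mat (\<lambda>x. x ^ q) A) * A) = dim_row (1\<^sub>m n)"
    "dim_col (transpose_mat (map_mat (\<lambda>x. x ^ q) A) * A) = dim_col (1\<^sub>m n)" using Ac by auto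
  fix i j assume "i < dim_row (1\<^sub>m n :: 'a mat)" "j < dim_col (1\<^sub>m n :: 'a mat)"
  then have ij: "i < n" "j < n" by auto
  have c: "A *\<^sub>v unit_vec n k = col A k" if "k < n" for k
    using that Ac by (intro eq_vecI) auto
  have "unitary_form q (A *\<^sub>v unit_vec n j) (A *\<^sub>v unit_vec n i)
      = unitary_form q (unit_vec n j :: 'a vec) (unit_vec n i)"
    using A unit_vec_carrier by (auto simp: GU_def)
  then have "unitary_form q (col A j) (col A i) = (if i = j then 1 else 0)"
    using ij q by (simp add: c unitary_form_unit_vec)
  then show "(transpose_mat (map_mat (\<lambda>x. x ^ q) A) * A) $$ (i, j) = 1\<^sub>m n $$ (i, j)"
    using ij Ac by (simp add: unitary_form_def scalar_prod_def mult.commute)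
qed

text \<open>Isometries of this form are automatically invertible, so that \<open>inv\<close> and \<open>order\<close> have their
  usual meaning in \<^const>\<open>GU\<close>.\<close>

lemma GU_group:
  assumes q: "q > 0"
  shows "group (GU n q :: 'a::field mat monoid)"
proof (rule groupI)
  fix A B C :: "'a mat"
  assume A: "A \<in> carrier (GU n q)" and B: "B \<in> carrier (GU n q)"
  then have Ac: "A \<in> carrier_mat n n" and Bc: "B \<in> carrier_mat n n" by (auto simp: GU_def)
  show "A \<otimes>\<^bsub>GU n q\<^esub> B \<in> carrier (GU n q)"
    using A B by (auto simp: GU_def assoc_mult_mat_vec[OF Ac Bc])
  assume C: "C \<in> carrier (GU n q)"
  then have Cc: "C \<in> carrier_mat n n" by (auto simp: GU_def)
  show "A \<otimes>\<^bsub>GU n q\<^esub> B \<otimes>\<^bsub>GU n q\<^esub> C = A \<otimes>\<^bsub>GU n q\<^esub> (B \<otimes>\<^bsub>GU n q\<^esub> C)"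
    using assoc_mult_mat[OF Ac Bc Cc] by (simp add: GU_def)
next
  show "\<one>\<^bsub>GU n q\<^esub> \<in> carrier (GU n q :: 'a mat monoid)" by (simp add: GU_def)
next
  fix A :: "'a mat"
  assume A: "A \<in> carrier (GU n q)"
  then have Ac: "A \<in> carrier_mat n n" by (auto simp: GU_def)
  then show "\<one>\<^bsub>GU n q\<^esub> \<otimes>\<^bsub>GU n q\<^esub> A = A" by (simp add: GU_def)
  define B where "B = transpose_mat (map_mat (\<lambda>x. x ^ q) A)"
  have Bc: "B \<in> carrier_mat n n" using Ac by (simp add: B_def)
  have BA: "B * A = 1\<^sub>m n" unfolding B_def by (rule isometry_left_inverse[OF q A])
  have AB: "A * B = 1\<^sub>m n" by (rule mat_mult_left_right_inverse[OF Bc Ac BA])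
  have ABv: "A *\<^sub>v (B *\<^sub>v v) = v" if "v \<in> carrier_vec n" for v
    using that assoc_mult_mat_vec[OF Ac Bc that] AB by simp
  have "unitary_form q (B *\<^sub>v u) (B *\<^sub>v v) = unitary_form q u v"
    if u: "u \<in> carrier_vec n" and v: "v \<in> carrier_vec n" for u v
  proof -
    have "B *\<^sub>v u \<in> carrier_vec n" "B *\<^sub>v v \<in> carrier_vec n" using Bc u v by auto
    then have "unitary_form q (A *\<^sub>v (B *\<^sub>v u)) (A *\<^sub>v (B *\<^sub>v v))
        = unitary_form q (B *\<^sub>v u) (B *\<^sub>v v)"
      using A by (simp add: GU_def)
    then show ?thesis by (simp add: ABv u v)
  qed
  then have "B \<in> carrier (GU n q)" using Bc by (simp add: GU_def)
  then show "\<exists>B\<in>carrier (GU n q). B \<otimes>\<^bsub>GU n q\<^esub> A = \<one>\<^bsub>GU n q\<^esub>"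
    using BA by (auto simp: GU_def)
qed

text \<open>The kernel of \<open>t - 1\<close> is the \<open>(+1)\<close>-eigenspace of \<open>t\<close>.\<close>

definition C_U :: "nat \<Rightarrow> nat \<Rightarrow> 'a::field mat set" where
  "C_U n q = {t \<in> carrier (GU n q).
     t \<noteq> \<one>\<^bsub>GU n q\<^esub> \<and> t \<otimes>\<^bsub>GU n q\<^esub> t = \<one>\<^bsub>GU n q\<^esub> \<and> kernel_dim (t - 1\<^sub>m n) = n div 2}"

definition regular_semisimple :: "'a::field mat \<Rightarrow> bool" where
  "regular_semisimple A \<longleftrightarrow> squarefree (char_poly A)"

definition I_U :: "nat \<Rightarrow> nat \<Rightarrow> ('a::field mat \<times> 'a mat) set" where
  "I_U n q = {(t, t'). t \<in> C_U n q \<and> t' \<in> C_U n q \<and> regular_semisimple (t \<otimes>\<^bsub>GU n q\<^esub> t')}"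

definition iota_U :: "'a::field itself \<Rightarrow> nat \<Rightarrow> nat \<Rightarrow> real" where
  "iota_U _ n q =
     real (card (I_U n q :: ('a mat \<times> 'a mat) set)) / real (card (C_U n q :: 'a mat set)) ^ 2"

definition Delta_U :: "nat \<Rightarrow> nat \<Rightarrow> ('a::field mat \<times> 'a mat) set" where
  "Delta_U n q = {(t, y). t \<in> C_U n q \<and> y \<in> carrier (GU n q) \<and> regular_semisimple y \<and>
     inv\<^bsub>GU n q\<^esub> t \<otimes>\<^bsub>GU n q\<^esub> y \<otimes>\<^bsub>GU n q\<^esub> t = inv\<^bsub>GU n q\<^esub> y \<and>
     coprime (char_poly y) ([:0, 1:] ^ 2 - 1)}"

definition r_U :: "'a::field itself \<Rightarrow> nat \<Rightarrow> nat \<Rightarrow> real" where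
  "r_U _ n q = real (card (Delta_U n q :: ('a mat \<times> 'a mat) set))
     / real (order (GU n q :: 'a mat monoid))"

definition r_U_inf :: "'a::field itself \<Rightarrow> nat \<Rightarrow> real" where
  "r_U_inf F q = lim (\<lambda>m. r_U F (2 * m) q)"

definition phi_U :: "nat \<Rightarrow> real \<Rightarrow> real" where
  "phi_U m z = (\<Prod>i = 1..m. 1 - (-1) ^ i * z powi (- int i))"

definition phi_U_inf :: "real \<Rightarrow> real" where
  "phi_U_inf z = lim (\<lambda>m. phi_U m z)"

end

theory Submission
  imports Defs "HOL-Computational_Algebra.Polynomial_Factorial" "HOL-Number_Theory.Residues"
begin

text \<open>
  A balanced involution is \<open>2 Y Y\<^sup>* - 1\<close> for an orthonormal frame \<open>Y\<close> of its \<open>(+1)\<close>-eigenspace.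
  Fixing the first involution as \<open>diag(1\<^sub>m, -1\<^sub>r)\<close>, a Sylvester determinant identity expresses the
  characteristic polynomial of the product through that of the Hermitian \<open>m \<times> m\<close> matrix
  \<open>Z = Y\<^sub>1\<^sup>* Y\<^sub>1\<close>, where \<open>Y\<^sub>1\<close> is the top block of \<open>Y\<close>: it is
  \<open>(x - 1)\<^bsup>r - m\<^esup> det((x + 1)\<^sup>2 - 4 x Z)\<close>.  For \<open>r \<in> {m, m + 1}\<close> the product is regular semisimple
  iff the characteristic polynomial of \<open>Z\<close> is squarefree and does not vanish at \<open>0\<close> and \<open>1\<close>, and the
  number of \<open>Y\<close> above such a \<open>Z\<close> does not depend on \<open>Z\<close>.

  A Hermitian \<open>Z\<close> with squarefree characteristic polynomial \<open>h\<close> is cyclic and \<open>h\<close> has coefficients in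
  \<open>F\<^sub>q\<close>.  All such \<open>Z\<close> are conjugate to one Hermitian model, and counting the conjugating matrices
  shows that their number divided by \<open>|GU\<^sub>m(q)|\<close> is the ratio of the numbers of units of
  \<open>F\<^sub>q[x]/(h)\<close> and \<open>F\<^bsub>q\<^sup>2\<^esub>[x]/(h)\<close>, a multiplicative weight of \<open>h\<close>.  The sum of these weights over
  monic \<open>h\<close> of degree \<open>m\<close> converges by a sieve over the monic irreducible polynomials.

  The pairs in \<open>\<Delta>(2m, q)\<close> correspond to those in \<open>I(2m, q)\<close> by \<open>(t, y) \<mapsto> (t, t y)\<close>, so this sum is
  \<open>r(2m, q)\<close>; the remaining factors are orders of unitary groups.
\<close>

text \<open>The counting of frames rests on one fact: over a finite field the norm to the subfield
  is onto, so every nonsingular Hermitian matrix is congruent to the identity, and the number of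
  \<open>Y\<close> with \<open>adj Y * Y = G\<close> is the same for all nonsingular Hermitian
  \<open>G\<close>. A frame above \<open>Z\<close> is an independent choice of two blocks with Gram
  matrices \<open>Z\<close> and \<open>1 - Z\<close>; the excluded roots 0 and 1 are exactly where
  one of these is singular. The same two values are the branch points of the substitution z = (x +
  1)^2 / (4 x), which is why the condition for squarefreeness and the condition for constant fibres
  agree.

  Convergence of the mean weight is obtained without its value: at a prime of norm Q the normalized
  weight is Q / (Q + 1) or Q / (Q - 1), so the Euler factor, once multiplied by 1 - x, differs from
  1 by O(Q^-2), and there are at most q^d primes of degree d.

  The denominator 1 + 1/q of the odd case is the order q + 1 of the one-dimensional unitary group,
  divided by q. The subfield of order q, absent from the statement, is built at the end as a type
  depending on the large field alone.\<close>

hide_const (open) up_ring.coeff up_ring.monom module.smult Coset.order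

section \<open>Polynomials over a field\<close>

text \<open>A nonzero combination of least degree divides every combination, since a remainder is
  again a combination; coprimality then makes it a unit. The identity is the form of coprimality
  that survives field extension and homogenization later.\<close>

lemma poly_bezout:
  fixes p q :: "'a::field poly"
  assumes "coprime p q"
  obtains u v where "u * p + v * q = 1"
proof -
  define S where "S = {d. d \<noteq> 0 \<and> (\<exists>u v. d = u * p + v * q)}"
  have "p \<noteq> 0 \<or> q \<noteq> 0" using assms by auto
  then have "p \<in> S \<or> q \<in> S"
    unfolding S_def by (auto intro: exI[of _ 1] exI[of _ 0])
  then have "\<exists>d. d \<in> S" by blast
  then obtain d where d: "d \<in> S" and min: "\<And>e. e \<in> S \<Longrightarrow> degree d \<le> degree e"
    using ex_has_least_nat[of "\<lambda>d. d \<in> S" _ degree] by blast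
  then obtain u v where uv: "d = u * p + v * q" and d0: "d \<noteq> 0" by (auto simp: S_def)
  have *: "d dvd u' * p + v' * q" for u' v'
  proof (rule ccontr)
    assume "\<not> d dvd u' * p + v' * q"
    then have "(u' * p + v' * q) mod d \<noteq> 0" by (simp add: dvd_eq_mod_eq_0)
    moreover define k where "k = (u' * p + v' * q) div d"
    have "(u' * p + v' * q) mod d = (u' * p + v' * q) - k * d"
      by (simp add: k_def minus_div_mult_eq_mod)
    then have "(u' * p + v' * q) mod d = (u' - k * u) * p + (v' - k * v) * q"
      by (simp add: uv algebra_simps)
    ultimately have "(u' * p + v' * q) mod d \<in> S" unfolding S_def by blast
    then have "degree d \<le> degree ((u' * p + v' * q) mod d)" by (rule min)
    with \<open>(u' * p + v' * q) mod d \<noteq> 0\<close> show False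
      using degree_mod_less[OF d0, of "u' * p + v' * q"] by auto
  qed
  have "d dvd p" "d dvd q" using *[of 1 0] *[of 0 1] by simp_all
  then have "is_unit d" using assms coprime_common_divisor by blast
  then obtain e where "1 = d * e" by (rule dvdE)
  then have "(e * u) * p + (e * v) * q = 1" by (simp add: uv algebra_simps)
  then show ?thesis by (rule that)
qed

lemma coprimeI_bezout:
  fixes p q :: "'a::algebraic_semidom"
  assumes "u * p + v * q = 1"
  shows "coprime p q"
  by (rule coprimeI) (metis assms dvd_add dvd_mult)

lemma coprime_poly_mult_left_iff:
  fixes a b c :: "'a::field poly"
  shows "coprime (a * b) c \<longleftrightarrow> coprime a c \<and> coprime b c"
proof (intro iffI conjI)
  assume "coprime (a * b) c"
  then show "coprime a c" "coprime b c"
    by (auto elim!: coprime_imp_coprime simp: dvd_mult dvd_mult2)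
next
  assume "coprime a c \<and> coprime b c"
  then obtain u v u' v' where "u * a + v * c = 1" "u' * b + v' * c = 1"
    by (auto elim!: poly_bezout)
  then have "(u * a + v * c) * (u' * b + v' * c) = 1" by simp
  then have "(u * u') * (a * b) + (u * a * v' + v * u' * b + v * v' * c) * c = 1"
    by (simp add: algebra_simps)
  then show "coprime (a * b) c" by (rule coprimeI_bezout)
qed

lemma coprime_poly_mult_right_iff:
  fixes a b c :: "'a::field poly"
  shows "coprime c (a * b) \<longleftrightarrow> coprime c a \<and> coprime c b"
  using coprime_poly_mult_left_iff by (simp add: coprime_commute[of c])

lemma coprime_poly_power_right:
  fixes a c :: "'a::field poly"
  shows "coprime c a \<Longrightarrow> coprime c (a ^ n)"
  by (induction n) (auto simp: coprime_poly_mult_right_iff)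

lemma coprime_poly_dvd_mult:
  fixes a b c :: "'a::field poly"
  assumes "coprime a b" "a dvd c" "b dvd c"
  shows "a * b dvd c"
proof -
  obtain u v where uv: "u * a + v * b = 1" using poly_bezout assms(1) .
  have "a * b dvd c * (u * a)" "a * b dvd c * (v * b)"
    using assms(2,3) by (auto simp: mult.commute intro!: mult_dvd_mono dvd_mult2 elim!: dvdE)
  then have "a * b dvd c * (u * a + v * b)" by (simp only: distrib_left dvd_add)
  then show ?thesis by (simp add: uv)
qed

lemma irreducible_poly_coprime:
  fixes p f :: "'a::field poly"
  assumes "irreducible p" "\<not> p dvd f"
  shows "coprime p f"
proof (rule coprimeI)
  fix d assume d: "d dvd p" "d dvd f"
  then have "\<not> p dvd d" using assms(2) by (blast intro: dvd_trans)
  then show "is_unit d" using irreducibleD'[OF assms(1) d(1)] by blast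
qed

lemma ex_monic_irreducible_factor:
  fixes f :: "'a::field poly"
  assumes "degree f > 0"
  obtains p where "irreducible p" "lead_coeff p = 1" "p dvd f"
proof -
  have "\<exists>p. irreducible p \<and> lead_coeff p = 1 \<and> p dvd f"
    using assms
  proof (induction "degree f" arbitrary: f rule: less_induct)
    case less
    have f0: "f \<noteq> 0" using less by auto
    show ?case
    proof (cases "irreducible f")
      case True
      define p where "p = smult (inverse (lead_coeff f)) f"
      have "p dvd f" "f dvd p" using f0 by (auto simp: p_def smult_dvd_iff dvd_smult)
      then have "irreducible p"
        using True by (meson dvd_unit_imp_unit irreducible_mono irreducible_not_unit)
      moreover have "lead_coeff p = 1" using f0 by (simp add: p_def)
      ultimately show ?thesis using \<open>p dvd f\<close> by blast
    next
      case False
      have "\<not> is_unit f" using less.prems by (simp add: is_unit_iff_degree f0)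
      with False f0 obtain a b where ab: "f = a * b" "\<not> is_unit a" "\<not> is_unit b"
        unfolding irreducible_def by blast
      have nz: "a \<noteq> 0" "b \<noteq> 0" using ab f0 by auto
      then have "degree a > 0" "degree b > 0" using ab by (auto simp: is_unit_iff_degree)
      moreover have "degree f = degree a + degree b" using nz ab by (simp add: degree_mult_eq)
      ultimately obtain p where "irreducible p" "lead_coeff p = 1" "p dvd a"
        using less.hyps[of a] by auto
      then show ?thesis using ab by auto
    qed
  qed
  then show ?thesis using that by blast
qed

lemma monic_dvd_antisym:
  fixes p q :: "'a::field poly"
  assumes "lead_coeff p = 1" "lead_coeff q = 1" "p dvd q" "q dvd p"
  shows "p = q"
proof -
  obtain k where k: "q = p * k" using assms(3) by (elim dvdE)
  have nz: "p \<noteq> 0" "q \<noteq> 0" using assms by auto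
  have "degree p = degree q" using assms(3,4) nz by (intro antisym dvd_imp_degree_le)
  then have "degree k = 0" using k nz by (auto simp: degree_mult_eq)
  then obtain c where c: "k = [:c:]" by (rule degree_eq_zeroE)
  have "lead_coeff q = lead_coeff p * lead_coeff k" by (simp only: k lead_coeff_mult)
  then have "c = 1" using assms c by simp
  then show ?thesis using k c by simp
qed

lemma irreducible_monic_dvd_imp_eq:
  fixes p q :: "'a::field poly"
  assumes "irreducible p" "irreducible q" "lead_coeff p = 1" "lead_coeff q = 1" "p dvd q"
  shows "p = q"
  using assms by (intro monic_dvd_antisym) (auto dest: irreducibleD' simp: irreducible_not_unit)

lemma squarefree_imp_coprime_factors:
  fixes a b :: "'a::field poly"
  assumes "squarefree (a * b)"
  shows "coprime a b"
proof (rule coprimeI)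
  fix d assume "d dvd a" "d dvd b"
  then have "d\<^sup>2 dvd a * b" by (simp add: power2_eq_square mult_dvd_mono)
  then show "is_unit d" using assms squarefreeD by blast
qed

text \<open>The direction valid over every field; the converse is proved below over finite
  fields.\<close>

lemma coprime_pderiv_imp_squarefree:
  fixes f :: "'a::field poly"
  assumes "coprime f (pderiv f)"
  shows "squarefree f"
proof (rule squarefreeI)
  fix d assume "d\<^sup>2 dvd f"
  then obtain k where "f = d\<^sup>2 * k" by (rule dvdE)
  then have k: "f = d * (d * k)" by (simp add: power2_eq_square mult.assoc)
  have "d dvd f" "d dvd pderiv f"
    by (auto simp: k pderiv_mult intro!: dvd_add dvd_mult dvd_mult2)
  then show "is_unit d" using assms coprime_common_divisor by blast
qed

section \<open>Polynomials over a finite field\<close>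

text \<open>Multiplication by a nonzero \<open>x\<close> permutes the nonzero elements, so comparing
  the product of all of them with that of the images gives \<open>x ^ card U = 1\<close>.\<close>

lemma finite_field_power_CARD:
  fixes x :: "'a::{field,finite}"
  shows "x ^ CARD('a) = x"
proof (cases "x = 0")
  case False
  define U where "U = (UNIV - {0} :: 'a set)"
  have bij: "bij_betw ((*) x) U U"
    unfolding U_def using False
    by (intro bij_betwI[where g = "\<lambda>y. y / x"]) auto
  have "(\<Prod>y\<in>U. y) = (\<Prod>y\<in>U. x * y)" using prod.reindex_bij_betw[OF bij, of "\<lambda>y. y"] by simp
  also have "\<dots> = x ^ card U * (\<Prod>y\<in>U. y)" by (simp add: prod.distrib)
  finally have "x ^ card U = 1" by (simp add: U_def)
  moreover have "CARD('a) = Suc (card U)"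
    unfolding U_def by (simp add: card_Diff_singleton card_gt_0_iff)
  ultimately show ?thesis by simp
qed (simp add: card_gt_0_iff zero_power)

text \<open>Representatives of the residues modulo a polynomial of degree \<open>n\<close>. Bounding
  coefficients rather than the degree keeps \<open>0\<close> inside also for
  \<open>n = 0\<close>.\<close>

definition polys_lt :: "nat \<Rightarrow> 'a::zero poly set" where
  "polys_lt n = {f. \<forall>i\<ge>n. coeff f i = 0}"

lemma polys_lt_0 [simp]: "polys_lt 0 = {0}"
  by (auto simp: polys_lt_def poly_eq_iff)

lemma polys_lt_Suc: "polys_lt (Suc n) = (\<lambda>(a, f). pCons a f) ` (UNIV \<times> polys_lt n)"
proof (intro equalityI subsetI)
  fix f :: "'a poly" assume f: "f \<in> polys_lt (Suc n)"
  obtain a g where "f = pCons a g" by (cases f)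
  moreover have "g \<in> polys_lt n" unfolding polys_lt_def
  proof safe
    fix i assume "n \<le> i"
    then show "coeff g i = 0" using f \<open>f = pCons a g\<close> by (auto simp: polys_lt_def dest: spec[of _ "Suc i"])
  qed
  ultimately show "f \<in> (\<lambda>(a, f). pCons a f) ` (UNIV \<times> polys_lt n)" by force
qed (auto simp: polys_lt_def coeff_pCons split: nat.splits)

lemma finite_polys_lt [simp]: "finite (polys_lt n :: 'a::{zero,finite} poly set)"
  by (induction n) (auto simp: polys_lt_Suc)

lemma card_polys_lt: "card (polys_lt n :: 'a::{zero,finite} poly set) = CARD('a) ^ n"
proof (induction n)
  case (Suc n)
  have "inj_on (\<lambda>(a, f). pCons a f) (UNIV \<times> polys_lt n :: ('a \<times> 'a poly) set)"
    by (auto simp: inj_on_def)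
  then show ?case by (simp add: polys_lt_Suc card_image card_cartesian_product Suc)
qed simp

lemma polys_lt_iff: "f \<in> polys_lt n \<longleftrightarrow> f = 0 \<or> degree f < n"
proof
  assume "f \<in> polys_lt n"
  then have "coeff f (degree f) = 0" if "n \<le> degree f" using that by (simp add: polys_lt_def)
  then show "f = 0 \<or> degree f < n" by (cases "f = 0") (auto simp: not_less[symmetric])
qed (auto simp: polys_lt_def coeff_eq_0)

lemma mod_in_polys_lt: "h \<noteq> 0 \<Longrightarrow> f mod h \<in> polys_lt (degree (h::'a::field poly))"
  using degree_mod_less[of h f] by (auto simp: polys_lt_iff)

lemma polys_lt_mod: "f \<in> polys_lt (degree h) \<Longrightarrow> f mod h = (f::'a::field poly)"
  by (auto simp: polys_lt_iff mod_poly_less)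

definition monics :: "nat \<Rightarrow> 'a::zero_neq_one poly set" where
  "monics n = {f. degree f = n \<and> lead_coeff f = 1}"

lemma monics_nonzero: "f \<in> monics n \<Longrightarrow> f \<noteq> 0"
  by (auto simp: monics_def)

lemma bij_betw_monics:
  "bij_betw (\<lambda>f. monom 1 n + f) (polys_lt n) (monics n :: 'a::comm_ring_1 poly set)"
proof (rule bij_betwI[where g = "\<lambda>f. f - monom 1 n"])
  show "(\<lambda>f. monom 1 n + f) \<in> polys_lt n \<rightarrow> (monics n :: 'a poly set)"
  proof safe
    fix f :: "'a poly" assume f: "f \<in> polys_lt n"
    have "coeff (monom 1 n + f) n = 1" using f by (simp add: polys_lt_def)
    moreover have "degree (monom 1 n + f) \<le> n"
      using f by (intro degree_le) (auto simp: polys_lt_def)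
    ultimately have "degree (monom 1 n + f) = n" by (metis le_antisym le_degree zero_neq_one)
    with \<open>coeff _ n = 1\<close> show "monom 1 n + f \<in> monics n" by (simp add: monics_def)
  qed
  show "(\<lambda>f. f - monom 1 n) \<in> monics n \<rightarrow> (polys_lt n :: 'a poly set)"
    by (auto simp: polys_lt_def monics_def coeff_eq_0)
qed auto

lemma finite_monics [simp]: "finite (monics n :: 'a::{comm_ring_1,finite} poly set)"
  using bij_betw_finite[OF bij_betw_monics[where ?'a = 'a and n = n]] by simp

lemma card_monics: "card (monics n :: 'a::{comm_ring_1,finite} poly set) = CARD('a) ^ n"
  using bij_betw_same_card[OF bij_betw_monics[where ?'a = 'a and n = n]] by (simp add: card_polys_lt)

lemma monics_mult:
  fixes f g :: "'a::idom poly"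
  assumes "f \<in> monics m" "g \<in> monics n"
  shows "f * g \<in> monics (m + n)"
proof -
  have f: "degree f = m" "lead_coeff f = 1" and g: "degree g = n" "lead_coeff g = 1"
    using assms unfolding monics_def by blast+
  have "f \<noteq> 0" "g \<noteq> 0" using assms monics_nonzero by blast+
  then have "degree (f * g) = degree f + degree g" by (rule degree_mult_eq)
  moreover have "lead_coeff (f * g) = lead_coeff f * lead_coeff g" by (rule lead_coeff_mult)
  ultimately show ?thesis unfolding monics_def mem_Collect_eq f(2) g(2) by (simp add: f g)
qed

lemma monics_cancel:
  fixes f g :: "'a::idom poly"
  assumes "f * g \<in> monics n" "f \<in> monics m"
  shows "g \<in> monics (n - m)"
proof -
  have "f * g \<noteq> 0" using assms monics_nonzero by blast
  then have "degree (f * g) = degree f + degree g" by (intro degree_mult_eq) auto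
  moreover have "lead_coeff (f * g) = lead_coeff f * lead_coeff g" by (rule lead_coeff_mult)
  ultimately show ?thesis using assms by (auto simp: monics_def)
qed

text \<open>The number of units of the residue ring modulo \<open>h\<close>. For a nonzero constant
  \<open>h\<close> the only residue is \<open>0\<close>, which is coprime to \<open>h\<close>, so
  the value is 1 as multiplicativity requires.\<close>

definition poly_totient :: "'a::field poly \<Rightarrow> nat" where
  "poly_totient h = card {f \<in> polys_lt (degree h). coprime f h}"

lemma poly_totient_mult:
  fixes a b :: "'a::{field,finite} poly"
  assumes "coprime a b" "a \<noteq> 0" "b \<noteq> 0"
  shows "poly_totient (a * b) = poly_totient a * poly_totient b"
proof -
  define R :: "'a poly \<Rightarrow> 'a poly set" where "R = (\<lambda>h. polys_lt (degree h))"
  define \<psi> where "\<psi> = (\<lambda>f. (f mod a, f mod b))"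
  have deg: "degree (a * b) = degree a + degree b" using assms by (simp add: degree_mult_eq)
  have inj: "inj_on \<psi> (R (a * b))"
  proof (rule inj_onI)
    fix f g assume fg: "f \<in> R (a * b)" "g \<in> R (a * b)" "\<psi> f = \<psi> g"
    then have "a dvd f - g" "b dvd f - g" by (auto simp: \<psi>_def mod_eq_dvd_iff)
    then have "a * b dvd f - g" using assms(1) by (intro coprime_poly_dvd_mult)
    then have "f mod (a * b) = g mod (a * b)" by (simp add: mod_eq_dvd_iff)
    then show "f = g" using fg by (simp add: R_def polys_lt_mod)
  qed
  have "\<psi> ` R (a * b) \<subseteq> R a \<times> R b"
    using assms by (auto simp: \<psi>_def R_def mod_in_polys_lt)
  moreover have "card (\<psi> ` R (a * b)) = card (R a \<times> R b)"
    using card_image[OF inj] by (simp add: R_def card_polys_lt card_cartesian_product deg power_add)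
  \<comment> \<open>Surjectivity in the Chinese remainder theorem, read off from equal finite
    cardinalities.\<close>
  ultimately have surj: "\<psi> ` R (a * b) = R a \<times> R b"
    by (intro card_subset_eq) (auto simp: R_def)
  have cop: "coprime f h \<longleftrightarrow> coprime (f mod h) h" if "h \<noteq> 0" for f h :: "'a poly"
    by (metis coprimeI coprime_common_divisor dvd_mod_iff)
  have iff: "coprime f (a * b) \<longleftrightarrow> coprime (fst (\<psi> f)) a \<and> coprime (snd (\<psi> f)) b" for f
    unfolding \<psi>_def fst_conv snd_conv coprime_poly_mult_right_iff
    using cop[OF assms(2), of f] cop[OF assms(3), of f] by blast
  have "\<psi> ` {f \<in> R (a * b). coprime f (a * b)} = {f \<in> R a. coprime f a} \<times> {f \<in> R b. coprime f b}"
  proof (intro equalityI subsetI)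
    fix z assume "z \<in> \<psi> ` {f \<in> R (a * b). coprime f (a * b)}"
    then obtain f where "f \<in> R (a * b)" "coprime f (a * b)" "z = \<psi> f" by auto
    moreover from this have "z \<in> R a \<times> R b" using surj by auto
    ultimately show "z \<in> {f \<in> R a. coprime f a} \<times> {f \<in> R b. coprime f b}"
      using iff[of f] by auto
  next
    fix z assume z: "z \<in> {f \<in> R a. coprime f a} \<times> {f \<in> R b. coprime f b}"
    then have "z \<in> \<psi> ` R (a * b)" using surj by auto
    then obtain f where "f \<in> R (a * b)" "z = \<psi> f" by auto
    with z iff[of f] show "z \<in> \<psi> ` {f \<in> R (a * b). coprime f (a * b)}" by auto
  qed
  moreover have "inj_on \<psi> {f \<in> R (a * b). coprime f (a * b)}" using inj by (rule inj_on_subset) auto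
  ultimately have "card {f \<in> R (a * b). coprime f (a * b)}
      = card ({f \<in> R a. coprime f a} \<times> {f \<in> R b. coprime f b})"
    using card_image by fastforce
  then show ?thesis
    unfolding poly_totient_def R_def by (simp only: card_cartesian_product)
qed

lemma poly_totient_irreducible:
  fixes p :: "'a::{field,finite} poly"
  assumes "irreducible p"
  shows "poly_totient p = CARD('a) ^ degree p - 1"
proof -
  have "coprime f p \<longleftrightarrow> f \<noteq> 0" if "f \<in> polys_lt (degree p)" for f
  proof
    assume "f \<noteq> 0"
    then have "\<not> p dvd f" using that dvd_imp_degree_le[of p f] by (auto simp: polys_lt_iff)
    then show "coprime f p" using irreducible_poly_coprime[OF assms] by (simp add: coprime_commute)
  qed (use assms irreducible_not_unit in auto)
  then have "{f \<in> polys_lt (degree p). coprime f p} = polys_lt (degree p) - {0}" by auto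
  moreover have "0 \<in> (polys_lt (degree p) :: 'a poly set)" by (simp add: polys_lt_def)
  ultimately show ?thesis by (simp add: poly_totient_def card_polys_lt card_Diff_singleton)
qed

lemma prime_CHAR_finite_field: "prime CHAR('a::{field,finite})"
proof -
  have "CHAR('a) \<noteq> 0" by (metis finite_imp_CHAR_pos finite_class.finite_UNIV not_less0)
  then show ?thesis using prime_CHAR_semidom by blast
qed

text \<open>A finite field is perfect: a polynomial with zero derivative is a \<open>CHAR('a)\<close>-th power.\<close>

lemma squarefree_imp_coprime_pderiv:
  fixes f :: "'a::{field,finite} poly"
  assumes "squarefree f"
  shows "coprime f (pderiv f)"
proof (rule ccontr)
  assume ncop: "\<not> coprime f (pderiv f)"
  have f0: "f \<noteq> 0" using assms by auto
  obtain d where d: "d dvd f" "d dvd pderiv f" "\<not> is_unit d"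
    using ncop not_coprimeE by blast
  have "d \<noteq> 0" using d f0 by auto
  then obtain p where p: "irreducible p" "p dvd d"
    using d(3) ex_monic_irreducible_factor[of d] by (metis is_unit_iff_degree gr0I)
  have pp: "prime_elem p" using p(1) by (rule field_poly_irreducible_imp_prime)
  obtain k where k: "f = p * k" using p d by (meson dvd_trans dvdE)
  have "p dvd pderiv f" using p d by (meson dvd_trans)
  then have "p dvd p * pderiv k + k * pderiv p" by (simp add: k pderiv_mult)
  then have "p dvd k * pderiv p" by (simp add: dvd_add_right_iff)
  moreover have "\<not> p dvd k"
  proof
    assume "p dvd k"
    then have "p\<^sup>2 dvd f" by (simp add: k power2_eq_square)
    then show False using squarefreeD[OF assms] prime_elem_not_unit[OF pp] by blast
  qed
  \<comment> \<open>A prime that divides \<open>f\<close> exactly once and also divides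
    \<open>pderiv f\<close> must divide its own derivative; that derivative has smaller degree,
    hence vanishes.\<close>
  ultimately have "p dvd pderiv p" using pp prime_elem_dvd_mult_iff by blast
  moreover have "degree p > 0"
    using p(1) by (metis gr0I irreducible_def is_unit_iff_degree)
  then have "degree (pderiv p) < degree p"
    using degree_pderiv_le[of p] by simp
  ultimately have dp: "pderiv p = 0"
    using dvd_imp_degree_le[of p "pderiv p"] by (cases "pderiv p = 0") auto
  define r where "r = CHAR('a)"
  have r: "prime r" unfolding r_def by (rule prime_CHAR_finite_field)
  then have r1: "r > 1" by (rule prime_gt_1_nat)
  have coeff0: "coeff p i = 0" if "\<not> r dvd i" for i
  proof (cases i)
    case (Suc j)
    have "of_nat (Suc j) * coeff p (Suc j) = coeff (pderiv p) j" by (simp add: coeff_pderiv)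
    then have "of_nat i * coeff p i = 0" by (simp add: dp Suc)
    moreover have "(of_nat i :: 'a) \<noteq> 0" using that by (simp add: r_def of_nat_eq_0_iff_char_dvd)
    ultimately show ?thesis by simp
  qed (use that in simp)
  \<comment> \<open>Raising to the power \<open>e\<close> extracts \<open>r\<close>-th roots of
    coefficients, because \<open>c ^ (r * e) = c\<close>. The roots of the surviving coefficients
    assemble into \<open>g\<close> with \<open>g ^ r = p\<close>.\<close>
  obtain e where e: "CARD('a) = r * e" using CHAR_dvd_CARD[where ?'a = 'a] by (auto simp: r_def)
  define b where "b = (\<lambda>j. coeff p (r * j) ^ e)"
  have b: "b j ^ r = coeff p (r * j)" for j
    unfolding b_def by (metis e finite_field_power_CARD mult.commute power_mult)
  define g where "g = (\<Sum>j\<le>degree p. monom (b j) j)"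
  have "CHAR('a poly) = r" by (simp add: r_def)
  then have "g ^ r = (\<Sum>j\<le>degree p. monom (b j) j ^ r)"
    unfolding g_def using r by (intro freshmans_dream_sum) simp_all
  also have "\<dots> = (\<Sum>j\<le>degree p. monom (coeff p (r * j)) (r * j))"
    by (simp add: monom_power b mult.commute)
  also have "\<dots> = (\<Sum>i\<in>(*) r ` {..degree p}. monom (coeff p i) i)"
    by (subst sum.reindex) (use r1 in \<open>auto simp: inj_on_def\<close>)
  also have "\<dots> = (\<Sum>i\<in>(*) r ` {..degree p} \<union> {..degree p}. monom (coeff p i) i)"
  proof (rule sum.mono_neutral_left)
    show "\<forall>i\<in>(*) r ` {..degree p} \<union> {..degree p} - (*) r ` {..degree p}. monom (coeff p i) i = 0"
    proof
      fix i assume i: "i \<in> (*) r ` {..degree p} \<union> {..degree p} - (*) r ` {..degree p}"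
      have "\<not> r dvd i"
      proof
        assume "r dvd i"
        then obtain j where j: "i = r * j" by auto
        have "j \<le> r * j" using r1 by simp
        moreover have "r * j \<le> degree p" using i unfolding j by blast
        ultimately have "j \<le> degree p" by (rule order_trans)
        then have "i \<in> (*) r ` {..degree p}" using j by auto
        then show False using i by auto
      qed
      then show "monom (coeff p i) i = 0" by (simp add: coeff0)
    qed
  qed auto
  also have "\<dots> = (\<Sum>i\<le>degree p. monom (coeff p i) i)"
    by (rule sum.mono_neutral_right) (auto simp: coeff_eq_0)
  also have "\<dots> = p" by (rule poly_as_sum_of_monoms)
  finally have gp: "p = g * g ^ (r - 1)" using r1 by (simp add: power_eq_if)
  have "g ^ r = p" using gp r1 by (simp add: power_eq_if)
  then have ng: "\<not> is_unit g" using irreducible_not_unit[OF p(1)] is_unit_power_iff by metis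
  then have "\<not> is_unit (g ^ (r - 1))" using r1 unfolding is_unit_power_iff by simp
  then show False using irreducibleD[OF p(1) gp] ng by blast
qed

section \<open>Quadratic extensions of finite fields\<close>

lemma coprime_poly_dvd_mult_iff:
  fixes a b c :: "'a::field poly"
  assumes "coprime a c"
  shows "a dvd c * b \<longleftrightarrow> a dvd b"
proof
  assume a: "a dvd c * b"
  obtain u v where uv: "u * a + v * c = 1" using poly_bezout assms .
  have "a dvd (u * b) * a + v * (c * b)" using a by simp
  also have "(u * b) * a + v * (c * b) = (u * a + v * c) * b" by (simp add: algebra_simps)
  finally show "a dvd b" by (simp add: uv)
qed simp

text \<open>The fields of order q and q^2 are given abstractly with an embedding, so that the
  counting does not depend on how the small field is constructed. Additivity of the q-th power is an
  assumption here; it is derived from q being a prime power when the locale is instantiated.\<close>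

locale quad_ext = field_hom \<iota> for \<iota> :: "'b::{field,finite} \<Rightarrow> 'a::{field,finite}" +
  fixes q :: nat
  assumes CARD_b: "CARD('b) = q" and CARD_a: "CARD('a) = q\<^sup>2"
    and odd_q: "odd q"
    and range_\<iota>: "range \<iota> = {x. x ^ q = x}"
    and frobenius_add: "(x + y :: 'a) ^ q = x ^ q + y ^ q"
begin

sublocale emb: map_poly_inj_idom_hom \<iota> ..

abbreviation emb :: "'b poly \<Rightarrow> 'a poly" where "emb \<equiv> map_poly \<iota>"

definition cj :: "'a \<Rightarrow> 'a" where "cj x = x ^ q"

abbreviation cjp :: "'a poly \<Rightarrow> 'a poly" where "cjp \<equiv> map_poly cj"

lemma q_ge_3: "q \<ge> 3"
proof -
  have "card {0, 1::'b} \<le> CARD('b)" by (intro card_mono) auto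
  then have "q \<ge> 2" by (simp add: CARD_b)
  with odd_q show ?thesis by (cases "q = 2") auto
qed

lemma cj_cj [simp]: "cj (cj x) = x"
  unfolding cj_def by (metis CARD_a finite_field_power_CARD power2_eq_square power_mult)

sublocale cj: field_hom cj
  by unfold_locales (use q_ge_3 in \<open>auto simp: cj_def power_mult_distrib frobenius_add power_0_left\<close>)

sublocale cjp: map_poly_inj_idom_hom cj ..

lemma cj_\<iota> [simp]: "cj (\<iota> x) = \<iota> x"
  using range_\<iota> unfolding cj_def by blast

lemma cj_eq_iff: "cj x = x \<longleftrightarrow> (\<exists>y. x = \<iota> y)"
  using range_\<iota> unfolding cj_def by blast

lemma cjp_cjp [simp]: "cjp (cjp f) = f"
  by (rule poly_eqI) simp

lemma cjp_emb [simp]: "cjp (emb f) = emb f"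
  by (rule poly_eqI) simp

lemma cjp_fixed_imp_emb:
  assumes "cjp f = f"
  obtains g where "f = emb g"
proof
  define r where "r = inv_into UNIV \<iota>"
  have r0: "r 0 = 0" unfolding r_def by (metis hom_zero inv_f_f inj_f)
  have "\<iota> (r (coeff f i)) = coeff f i" for i
  proof -
    have "cj (coeff f i) = coeff f i" using assms by (metis cj.coeff_map_poly_hom)
    then show ?thesis unfolding r_def by (metis cj_eq_iff f_inv_into_f rangeI)
  qed
  then show "f = emb (map_poly r f)"
    by (intro poly_eqI) (simp add: coeff_map_poly r0)
qed

lemma emb_dvd_iff: "emb f dvd emb g \<longleftrightarrow> f dvd g"
  using dvd_map_poly_hom_imp_dvd emb.hom_dvd by blast

lemma cjp_dvd_iff: "cjp f dvd g \<longleftrightarrow> f dvd cjp g"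
  by (metis cjp.hom_dvd cjp_cjp)

lemma cjp_irreducible:
  assumes "irreducible P"
  shows "irreducible (cjp P)"
proof (rule irreducibleI)
  have unit: "is_unit (cjp a) \<longleftrightarrow> is_unit a" for a
    using cjp_dvd_iff[of a 1] by simp
  show "cjp P \<noteq> 0" "\<not> is_unit (cjp P)" using assms unit by (auto simp: irreducible_not_unit)
  fix a b assume "cjp P = a * b"
  then have "P = cjp a * cjp b" by (metis cjp.hom_mult cjp_cjp)
  then show "is_unit a \<or> is_unit b" using irreducibleD[OF assms] unit by blast
qed

lemma coprime_emb:
  assumes "coprime f g"
  shows "coprime (emb f) (emb g)"
proof -
  obtain u v where "u * f + v * g = 1" using poly_bezout assms .
  then have "emb (u * f + v * g) = 1" by simp
  then have "emb u * emb f + emb v * emb g = 1" by (simp add: emb.hom_add emb.hom_mult)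
  then show ?thesis by (rule coprimeI_bezout)
qed

text \<open>Coprimality with the derivative is a Bezout identity and passes to the larger field;
  perfectness of the small field makes it available there. The other direction only uses that a unit
  of the large polynomial ring coming from below is a unit below.\<close>

lemma squarefree_emb_iff: "squarefree (emb f) \<longleftrightarrow> squarefree f"
proof
  assume "squarefree f"
  then have "coprime (emb f) (emb (pderiv f))"
    by (intro coprime_emb squarefree_imp_coprime_pderiv)
  also have "emb (pderiv f) = pderiv (emb f)"
    by (rule poly_eqI) (simp add: coeff_pderiv hom_mult hom_distribs)
  finally show "squarefree (emb f)" by (rule coprime_pderiv_imp_squarefree)
next
  assume sf: "squarefree (emb f)"
  show "squarefree f"
  proof (rule squarefreeI)
    fix d assume "d\<^sup>2 dvd f"
    then have "(emb d)\<^sup>2 dvd emb f" by (metis emb.hom_dvd emb.hom_power)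
    then have "emb d dvd emb 1" using sf squarefreeD by fastforce
    then show "is_unit d" by (simp only: emb_dvd_iff)
  qed
qed

text \<open>Take a monic prime factor \<open>P\<close> upstairs. If conjugation fixes it, it
  descends and must be \<open>p\<close>. Otherwise \<open>P\<close> and \<open>cjp P\<close> are
  coprime, their product is fixed by conjugation, and it descends to a nonunit divisor of
  \<open>p\<close>.\<close>

lemma irreducible_emb_cases:
  assumes p: "irreducible p" "lead_coeff p = 1"
  obtains (inert) "irreducible (emb p)"
  | (split) P where "irreducible P" "irreducible (cjp P)" "coprime P (cjp P)" "emb p = P * cjp P"
proof -
  have eqI: "N = p" if "lead_coeff N = 1" "\<not> is_unit N" "N dvd p" for N
    using irreducibleD'[OF p(1) that(3)] that p by (intro monic_dvd_antisym) auto
  have "degree p > 0" using p(1) by (metis gr0I irreducible_def is_unit_iff_degree)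
  then have "degree (emb p) > 0" by simp
  then obtain P where P: "irreducible P" "lead_coeff P = 1" "P dvd emb p"
    by (rule ex_monic_irreducible_factor)
  show ?thesis
  proof (cases "cjp P = P")
    case True
    then obtain g where g: "P = emb g" by (rule cjp_fixed_imp_emb)
    have "lead_coeff g = 1" using P(2) g by simp
    moreover have "\<not> is_unit g" using P(1) g emb.hom_dvd_1 irreducible_not_unit by blast
    moreover have "g dvd p" using P(3) g by (simp add: emb_dvd_iff)
    ultimately have "g = p" by (rule eqI)
    with g P show ?thesis using inert by simp
  next
    case False
    have cP: "irreducible (cjp P)" "lead_coeff (cjp P) = 1" "cjp P dvd emb p"
      using P by (auto simp: cjp_irreducible cjp_dvd_iff)
    have cop: "coprime P (cjp P)"
      using False irreducible_monic_dvd_imp_eq[OF P(1) cP(1) P(2) cP(2)]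
      by (intro irreducible_poly_coprime P) auto
    then have dvd: "P * cjp P dvd emb p" using P cP by (intro coprime_poly_dvd_mult)
    have "cjp (P * cjp P) = P * cjp P" by (simp add: cjp.hom_mult mult.commute)
    then obtain N where N: "P * cjp P = emb N" by (rule cjp_fixed_imp_emb)
    have "lead_coeff (P * cjp P) = 1" using P(2) cP(2) unfolding lead_coeff_mult by simp
    then have "lead_coeff N = 1" unfolding N by simp
    moreover have "\<not> is_unit N"
    proof
      assume "is_unit N"
      then have "is_unit (P * cjp P)" unfolding N by (rule emb.hom_dvd_1)
      then have "is_unit P" by (rule dvd_mult_left)
      then show False using P(1) irreducible_not_unit by blast
    qed
    moreover have "N dvd p" using dvd N by (simp add: emb_dvd_iff)
    ultimately have "N = p" by (rule eqI)
    then show ?thesis using split P cP cop N by metis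
  qed
qed

definition weight :: "'b poly \<Rightarrow> real" where
  "weight h = real (poly_totient h) / real (poly_totient (emb h))"

lemma weight_mult:
  assumes "coprime a b" "a \<noteq> 0" "b \<noteq> 0"
  shows "weight (a * b) = weight a * weight b"
  using assms coprime_emb[OF assms(1)]
  by (simp add: weight_def poly_totient_mult emb.hom_mult)

lemma weight_1 [simp]: "weight 1 = 1"
proof -
  have "{f. f = 0 \<and> coprime f (1::'c::field poly)} = {0}" by auto
  then show ?thesis by (simp add: weight_def poly_totient_def)
qed

text \<open>Units modulo an inert prime number Q - 1 below and Q^2 - 1 above; a split prime has
  residue fields of order Q above, hence (Q - 1)^2 units. The convergence argument only needs that
  both values are close to 1, so the two kinds of primes need not be told apart later.\<close>

lemma weight_irreducible:
  assumes p: "irreducible p" "lead_coeff p = 1"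
  defines "Q \<equiv> real q ^ degree p"
  shows "Q * weight p = Q / (Q + 1) \<or> Q * weight p = Q / (Q - 1)"
proof -
  have "degree p > 0" using p(1) by (metis gr0I irreducible_def is_unit_iff_degree)
  then have Q: "Q > 1" unfolding Q_def using q_ge_3 by (simp add: one_less_power)
  have tp: "real (poly_totient p) = Q - 1"
    using poly_totient_irreducible[OF p(1)] q_ge_3 by (simp add: CARD_b Q_def of_nat_diff)
  from p show ?thesis
  proof (cases rule: irreducible_emb_cases)
    case inert
    then have "real (poly_totient (emb p)) = Q ^ 2 - 1"
      using poly_totient_irreducible[OF inert] q_ge_3
      by (simp add: CARD_a Q_def of_nat_diff power_mult[symmetric] mult.commute)
    also have "\<dots> = (Q - 1) * (Q + 1)" by (simp add: power2_eq_square algebra_simps)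
    finally show ?thesis using Q by (simp add: weight_def tp)
  next
    case (split P)
    have nz: "P \<noteq> 0" "cjp P \<noteq> 0" using split by auto
    have "degree (emb p) = degree P + degree (cjp P)"
      using nz unfolding split(4) by (rule degree_mult_eq)
    then have deg: "degree p = 2 * degree P" by simp
    have "(q\<^sup>2) ^ degree P = q ^ degree p" by (simp add: deg power_mult)
    then have "real (poly_totient (emb p)) = (Q - 1) * (Q - 1)"
      using poly_totient_mult[OF split(3) nz] split(4) q_ge_3
        poly_totient_irreducible[OF split(1)] poly_totient_irreducible[OF split(2)]
      by (simp add: CARD_a Q_def of_nat_diff)
    then show ?thesis using Q by (simp add: weight_def tp)
  qed
qed

end

section \<open>Mean values of multiplicative functions on monic polynomials\<close>

text \<open>On generating functions this is multiplication by u^d.\<close>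

definition shift :: "nat \<Rightarrow> (nat \<Rightarrow> real) \<Rightarrow> nat \<Rightarrow> real" where
  "shift d f m = (if d \<le> m then f (m - d) else 0)"

lemma shift_shift: "shift d (shift e f) = shift (d + e) f"
  by (auto simp: shift_def fun_eq_iff)

lemma shift_add: "shift d (\<lambda>m. f m + g m) = (\<lambda>m. shift d f m + shift d g m)"
  and shift_diff: "shift d (\<lambda>m. f m - g m) = (\<lambda>m. shift d f m - shift d g m)"
  and shift_cmult: "shift d (\<lambda>m. c * f m) = (\<lambda>m. c * shift d f m)"
  by (auto simp: shift_def fun_eq_iff)

text \<open>Multiplication of the generating function by 1 - u. As \<open>shift 1 f 0 = 0\<close>,
  the first difference is \<open>f 0\<close> itself, and partial sums of \<open>bdiff f\<close>
  telescope to \<open>f\<close> without a boundary term.\<close>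

definition bdiff :: "(nat \<Rightarrow> real) \<Rightarrow> nat \<Rightarrow> real" where
  "bdiff f m = f m - shift 1 f m"

lemma shift_bdiff: "shift d (bdiff f) = bdiff (shift d f)"
  by (simp add: bdiff_def[abs_def] shift_diff shift_shift add.commute)

lemma sum_bdiff: "(\<Sum>m\<le>n. bdiff f m) = f n"
  by (induction n) (auto simp: bdiff_def shift_def)

definition sum_abs :: "nat \<Rightarrow> (nat \<Rightarrow> real) \<Rightarrow> real" where
  "sum_abs N f = (\<Sum>m\<le>N. \<bar>f m\<bar>)"

lemma sum_abs_nonneg: "sum_abs N f \<ge> 0"
  by (simp add: sum_abs_def sum_nonneg)

lemma sum_abs_shift: "sum_abs N (shift d f) \<le> sum_abs N f"
proof -
  have "sum_abs N (shift d f) = (\<Sum>m\<in>{d..N}. \<bar>f (m - d)\<bar>)"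
    unfolding sum_abs_def by (rule sum.mono_neutral_cong_right) (auto simp: shift_def)
  also have "\<dots> = (\<Sum>m\<in>(\<lambda>m. m - d) ` {d..N}. \<bar>f m\<bar>)"
    by (subst sum.reindex) (auto simp: inj_on_def)
  also have "\<dots> \<le> sum_abs N f"
    unfolding sum_abs_def by (rule sum_mono2) auto
  finally show ?thesis .
qed

lemma sum_abs_triangle:
  "sum_abs N (\<lambda>m. f m + a * g m - b * h m) \<le> sum_abs N f + \<bar>a\<bar> * sum_abs N g + \<bar>b\<bar> * sum_abs N h"
proof -
  have "sum_abs N (\<lambda>m. f m + a * g m - b * h m) \<le> (\<Sum>m\<le>N. \<bar>f m\<bar> + \<bar>a\<bar> * \<bar>g m\<bar> + \<bar>b\<bar> * \<bar>h m\<bar>)"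
    unfolding sum_abs_def by (intro sum_mono) (auto simp flip: abs_mult)
  then show ?thesis by (simp add: sum_abs_def sum.distrib sum_distrib_left)
qed

text \<open>The local conditions at the primes of \<open>S\<close> only: squarefreeness and the
  weight \<open>g\<close> are imposed there, and every other prime is ignored. For empty
  \<open>S\<close> the value is 1, so enlarging \<open>S\<close> interpolates between counting all
  polynomials and the wanted weighted sum.\<close>

definition sieve :: "('b::field poly \<Rightarrow> real) \<Rightarrow> 'b poly set \<Rightarrow> 'b poly \<Rightarrow> real" where
  "sieve g S h = (if \<exists>p\<in>S. p\<^sup>2 dvd h then 0 else \<Prod>p\<in>{p \<in> S. p dvd h}. g p)"

definition sieve_mean :: "('b::{field,finite} poly \<Rightarrow> real) \<Rightarrow> 'b poly set \<Rightarrow> nat \<Rightarrow> real" where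
  "sieve_mean g S m = (\<Sum>h\<in>monics m. sieve g S h) / real CARD('b) ^ m"

lemma sieve_mean_empty: "sieve_mean g {} m = 1"
  by (simp add: sieve_mean_def sieve_def card_monics)

text \<open>One step of the sieve multiplies the generating function by \<open>(1 - x) (1 + g p x)\<close>, where
  \<open>x = (u / CARD('b)) ^ degree p\<close>.\<close>

lemma sieve_mean_insert:
  fixes g :: "'b::{field,finite} poly \<Rightarrow> real"
  assumes S: "finite S" "p \<notin> S"
    and irr: "\<And>r. r \<in> insert p S \<Longrightarrow> irreducible r \<and> lead_coeff r = 1"
  defines "d \<equiv> degree p" and "Q \<equiv> real CARD('b) ^ degree p"
  shows "sieve_mean g (insert p S) = (\<lambda>m. sieve_mean g S m
    + (g p - 1) / Q * shift d (sieve_mean g S) m - g p / Q\<^sup>2 * shift (2 * d) (sieve_mean g S) m)"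
proof -
  have p: "irreducible p" "lead_coeff p = 1" using irr by auto
  have pm: "p \<in> monics d" using p by (simp add: monics_def d_def)
  have cop: "coprime r p" if "r \<in> S" for r
  proof (rule irreducible_poly_coprime)
    show "irreducible r" using irr that by auto
    show "\<not> r dvd p"
      using irreducible_monic_dvd_imp_eq[of r p] irr[of r] p that S(2) by auto
  qed
  have dvd_p: "r dvd p * k \<longleftrightarrow> r dvd k" "r\<^sup>2 dvd p * k \<longleftrightarrow> r\<^sup>2 dvd k" if "r \<in> S" for r k
  proof -
    have "coprime (r\<^sup>2) p"
      using cop[OF that] coprime_poly_power_right[of p r 2] by (simp add: coprime_commute)
    then show "r dvd p * k \<longleftrightarrow> r dvd k" "r\<^sup>2 dvd p * k \<longleftrightarrow> r\<^sup>2 dvd k"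
      using cop[OF that] by (simp_all add: coprime_poly_dvd_mult_iff)
  qed
  \<comment> \<open>The conditions at the primes of \<open>S\<close> do not see a factor
    \<open>p\<close> outside \<open>S\<close>.\<close>
  have sieve_p: "sieve g S (p * k) = sieve g S k" for k
    unfolding sieve_def using dvd_p by (simp cong: conj_cong bex_cong)
  have p0: "p \<noteq> 0" using p by auto
  define G' where "G' = sieve g (insert p S)"
  have G'1: "G' h = sieve g S h" if "\<not> p dvd h" for h
  proof -
    have "\<not> p\<^sup>2 dvd h" using that by (metis dvd_power dvd_trans zero_less_numeral)
    moreover have "{r \<in> insert p S. r dvd h} = {r \<in> S. r dvd h}" using that by auto
    ultimately show ?thesis by (simp add: G'_def sieve_def)
  qed
  have G'2: "G' (p * k) = (if p dvd k then 0 else g p * sieve g S k)" for k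
  proof (cases "p dvd k")
    case True
    then have "p\<^sup>2 dvd p * k" by (simp add: power2_eq_square)
    then show ?thesis using True by (auto simp: G'_def sieve_def)
  next
    case False
    then have "\<not> p\<^sup>2 dvd p * k" using p0 by (simp add: power2_eq_square)
    moreover have "{r \<in> insert p S. r dvd p * k} = insert p {r \<in> S. r dvd k}" using dvd_p by auto
    moreover have "(\<exists>r\<in>S. r\<^sup>2 dvd p * k) \<longleftrightarrow> (\<exists>r\<in>S. r\<^sup>2 dvd k)" using dvd_p by auto
    ultimately show ?thesis using False S by (simp add: G'_def sieve_def)
  qed
  define T where "T = (\<lambda>m. \<Sum>h\<in>{h \<in> monics m. \<not> p dvd h}. sieve g S h)"
  have mult: "(\<Sum>h\<in>{h \<in> monics m. p dvd h}. F h) = (if d \<le> m then \<Sum>k\<in>monics (m - d). F (p * k) else 0)"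
    for F :: "'b poly \<Rightarrow> real" and m
  proof (cases "d \<le> m")
    case True
    have "{h \<in> monics m. p dvd h} = (*) p ` monics (m - d)"
    proof (intro equalityI subsetI)
      fix h assume h: "h \<in> {h \<in> monics m. p dvd h}"
      then obtain k where "h = p * k" unfolding mem_Collect_eq by (blast elim: dvdE)
      then show "h \<in> (*) p ` monics (m - d)" using h monics_cancel[OF _ pm] by auto
    next
      fix h assume "h \<in> (*) p ` monics (m - d)"
      then show "h \<in> {h \<in> monics m. p dvd h}" using monics_mult[OF pm, of _ "m - d"] True by auto
    qed
    moreover have "inj_on ((*) p) (monics (m - d))" using p0 by (auto simp: inj_on_def)
    ultimately show ?thesis using True by (simp add: sum.reindex)
  next
    case False
    have "\<not> p dvd h" if "h \<in> monics m" for h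
    proof
      assume "p dvd h"
      then have "degree p \<le> degree h" using monics_nonzero[OF that] by (intro dvd_imp_degree_le)
      then show False using that False by (simp add: d_def monics_def)
    qed
    then have "{h \<in> monics m. p dvd h} = {}" by blast
    then show ?thesis using False by (simp only: sum.empty if_False)
  qed
  have split: "(\<Sum>h\<in>monics m. F h) = (\<Sum>h\<in>{h \<in> monics m. \<not> p dvd h}. F h) + (\<Sum>h\<in>{h \<in> monics m. p dvd h}. F h)"
    for F :: "'b poly \<Rightarrow> real" and m
    by (subst sum.union_disjoint[symmetric]) (auto intro!: sum.cong)
  define M where "M = (\<lambda>m. \<Sum>h\<in>monics m. sieve g S h)"
  \<comment> \<open>Discarding the multiples of \<open>p\<close> gives the first factor, 1 -
    x.\<close>
  have T: "T m = M m - (if d \<le> m then M (m - d) else 0)" for m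
    using split[of "sieve g S" m] unfolding M_def T_def mult sieve_p by simp
  \<comment> \<open>Multiples of the square of \<open>p\<close> are killed, and those with exactly
    one factor \<open>p\<close> contribute \<open>g p\<close> times a shifted copy of
    \<open>T\<close>; this is the second factor.\<close>
  have M': "(\<Sum>h\<in>monics m. G' h) = T m + (if d \<le> m then g p * T (m - d) else 0)" for m
  proof -
    have "(\<Sum>k\<in>monics (m - d). G' (p * k)) = (\<Sum>k\<in>{h \<in> monics (m - d). \<not> p dvd h}. g p * sieve g S k)"
      unfolding G'2 by (rule sum.mono_neutral_cong_right) auto
    then show ?thesis
      unfolding split[of G' m] mult T_def by (simp add: G'1 sum_distrib_left)
  qed
  show ?thesis
  proof
    fix m
    have C: "real CARD('b) ^ m > 0" for m by (simp add: card_gt_0_iff)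
    have A: "sieve_mean g S m = M m / real CARD('b) ^ m" for m by (simp add: sieve_mean_def M_def)
    have Cd: "real CARD('b) ^ m = Q * real CARD('b) ^ (m - d)" if "d \<le> m" for m
      unfolding Q_def d_def[symmetric] using that by (simp flip: power_add)
    have Q0: "Q > 0" unfolding Q_def by (rule C)
    have "sieve_mean g (insert p S) m
      = (T m + (if d \<le> m then g p * T (m - d) else 0)) / real CARD('b) ^ m"
      by (simp add: sieve_mean_def M' G'_def[symmetric])
    also have "\<dots> = sieve_mean g S m + (g p - 1) / Q * shift d (sieve_mean g S) m
      - g p / Q\<^sup>2 * shift (2 * d) (sieve_mean g S) m"
    proof -
      consider "m < d" | "d \<le> m" "m < 2 * d" | "2 * d \<le> m" by linarith
      then show ?thesis
      proof cases
        case 1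
        then show ?thesis by (simp add: T A shift_def)
      next
        case 2
        then have *: "\<not> d \<le> m - d" by simp
        show ?thesis using 2 * Q0 C[of "m - d"]
          by (simp add: T A shift_def Cd[of m] field_simps)
      next
        case 3
        then have *: "d \<le> m" "d \<le> m - d" "m - d - d = m - 2 * d" by auto
        show ?thesis using 3 * Q0 C[of "m - 2 * d"]
          by (simp add: T A shift_def Cd[of m] Cd[of "m - d"] field_simps power2_eq_square)
      qed
    qed
    finally show "sieve_mean g (insert p S) m = sieve_mean g S m + (g p - 1) / Q * shift d (sieve_mean g S) m
      - g p / Q\<^sup>2 * shift (2 * d) (sieve_mean g S) m" .
  qed
qed

lemma sum_abs_sieve_insert:
  fixes g :: "'b::{field,finite} poly \<Rightarrow> real"
  assumes "finite S" "p \<notin> S"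
    and "\<And>r. r \<in> insert p S \<Longrightarrow> irreducible r \<and> lead_coeff r = 1"
  defines "Q \<equiv> real CARD('b) ^ degree p"
  shows "sum_abs N (bdiff (sieve_mean g (insert p S)))
    \<le> (1 + (\<bar>g p - 1\<bar> / Q + \<bar>g p\<bar> / Q\<^sup>2)) * sum_abs N (bdiff (sieve_mean g S))"
proof -
  define A where "A = sieve_mean g S"
  define d where "d = degree p"
  have Q: "Q > 0" by (simp add: Q_def card_gt_0_iff)
  have "sieve_mean g (insert p S) = (\<lambda>m. A m + (g p - 1) / Q * shift d A m - g p / Q\<^sup>2 * shift (2 * d) A m)"
    unfolding Q_def d_def A_def by (rule sieve_mean_insert[OF assms(1-3)])
  then have "bdiff (sieve_mean g (insert p S)) = (\<lambda>m. bdiff A m + (g p - 1) / Q * bdiff (shift d A) m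
      - g p / Q\<^sup>2 * bdiff (shift (2 * d) A) m)"
    by (simp only: bdiff_def[abs_def] shift_add shift_diff shift_cmult) (simp add: algebra_simps)
  then have "sum_abs N (bdiff (sieve_mean g (insert p S))) \<le> sum_abs N (bdiff A)
      + \<bar>(g p - 1) / Q\<bar> * sum_abs N (shift d (bdiff A)) + \<bar>g p / Q\<^sup>2\<bar> * sum_abs N (shift (2 * d) (bdiff A))"
    by (simp only: sum_abs_triangle shift_bdiff)
  also have "\<dots> \<le> sum_abs N (bdiff A) + \<bar>(g p - 1) / Q\<bar> * sum_abs N (bdiff A)
      + \<bar>g p / Q\<^sup>2\<bar> * sum_abs N (bdiff A)"
    by (intro add_mono mult_left_mono sum_abs_shift order_refl) auto
  finally show ?thesis using Q by (simp add: A_def algebra_simps)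
qed

text \<open>Each new prime multiplies the truncated variation by at most \<open>1 + e p\<close>,
  since shifts do not increase it. The bound depends neither on \<open>N\<close> nor on the number
  of primes as long as the sum of \<open>e\<close> stays bounded.\<close>

lemma sum_abs_sieve_le:
  fixes g :: "'b::{field,finite} poly \<Rightarrow> real"
  assumes "finite S" and "\<And>r. r \<in> S \<Longrightarrow> irreducible r \<and> lead_coeff r = 1"
    and "\<And>r. r \<in> S \<Longrightarrow> \<bar>g r - 1\<bar> / real CARD('b) ^ degree r + \<bar>g r\<bar> / (real CARD('b) ^ degree r)\<^sup>2 \<le> e r"
  shows "sum_abs N (bdiff (sieve_mean g S)) \<le> exp (\<Sum>r\<in>S. e r)"
  using assms
proof (induction S)
  case empty
  \<comment> \<open>The unsieved mean is constantly 1, so its only nonzero difference sits at index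
    0.\<close>
  have "bdiff (sieve_mean g {}) = (\<lambda>m. if m = 0 then 1 else 0)"
    by (auto simp: bdiff_def shift_def sieve_mean_empty fun_eq_iff)
  then show ?case by (simp add: sum_abs_def if_distrib[of abs] cong: if_cong)
next
  case (insert p S)
  let ?Q = "real CARD('b) ^ degree p"
  have "sum_abs N (bdiff (sieve_mean g (insert p S)))
      \<le> (1 + (\<bar>g p - 1\<bar> / ?Q + \<bar>g p\<bar> / ?Q\<^sup>2)) * sum_abs N (bdiff (sieve_mean g S))"
    using insert by (intro sum_abs_sieve_insert) auto
  also have "\<dots> \<le> exp (e p) * exp (\<Sum>r\<in>S. e r)"
  proof (rule mult_mono)
    have "1 + (\<bar>g p - 1\<bar> / ?Q + \<bar>g p\<bar> / ?Q\<^sup>2) \<le> 1 + e p" using insert.prems(2)[of p] by simp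
    also have "\<dots> \<le> exp (e p)" by (rule exp_ge_add_one_self)
    finally show "1 + (\<bar>g p - 1\<bar> / ?Q + \<bar>g p\<bar> / ?Q\<^sup>2) \<le> exp (e p)" .
    show "sum_abs N (bdiff (sieve_mean g S)) \<le> exp (\<Sum>r\<in>S. e r)"
      using insert by (intro insert.IH) auto
  qed (auto simp: sum_abs_nonneg)
  also have "\<dots> = exp (\<Sum>r\<in>insert p S. e r)" using insert by (simp add: exp_add)
  finally show ?case .
qed

text \<open>A sequence of bounded variation is the sequence of partial sums of an absolutely
  convergent series.\<close>

lemma convergent_if_sum_abs_bdiff_bounded:
  assumes "\<And>N. sum_abs N (bdiff f) \<le> C"
  shows "convergent f"
proof -
  have "summable (\<lambda>m. \<bar>bdiff f m\<bar>)"
  proof (rule summableI_nonneg_bounded)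
    fix n
    have "(\<Sum>i<n. \<bar>bdiff f i\<bar>) \<le> sum_abs n (bdiff f)"
      unfolding sum_abs_def by (rule sum_mono2) auto
    then show "(\<Sum>i<n. \<bar>bdiff f i\<bar>) \<le> C" using assms[of n] by linarith
  qed auto
  then have "summable (bdiff f)" by (rule summable_rabs_cancel)
  then have "(\<lambda>n. \<Sum>i\<le>n. bdiff f i) \<longlonglongrightarrow> suminf (bdiff f)" by (rule summable_LIMSEQ')
  then show ?thesis by (simp add: sum_bdiff convergentI)
qed

section \<open>Convergence of the sum of weights over admissible monic polynomials\<close>

context quad_ext
begin

definition good :: "nat \<Rightarrow> 'b poly set" where
  "good m = {h \<in> monics m. squarefree h \<and> poly h 0 \<noteq> 0 \<and> poly h 1 \<noteq> 0}"

text \<open>The factor \<open>real q ^ degree p\<close> normalizes the weight to be near 1. The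
  value 0 at the primes x and x - 1 makes the sieve reject polynomials vanishing at 0 or at
  1.\<close>

definition gfun :: "'b poly \<Rightarrow> real" where
  "gfun p = (if p = [:0, 1:] \<or> p = [:-1, 1:] then 0 else real q ^ degree p * weight p)"

definition irreducibles :: "nat \<Rightarrow> 'b poly set" where
  "irreducibles N = {p. irreducible p \<and> lead_coeff p = 1 \<and> degree p \<le> N}"

lemma finite_irreducibles [simp]: "finite (irreducibles N)"
proof (rule finite_subset)
  show "irreducibles N \<subseteq> (\<Union>d\<le>N. monics d)" by (auto simp: irreducibles_def monics_def)
qed auto

text \<open>Induction on the degree: squarefreeness makes a split-off prime coprime to its cofactor,
  where \<open>weight\<close> is multiplicative; the powers of q multiply up to
  \<open>real q ^ m\<close>.\<close>

lemma prod_gfun: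
  assumes "h \<in> monics m" "m \<le> N" "squarefree h" "poly h 0 \<noteq> 0" "poly h 1 \<noteq> 0"
  shows "(\<Prod>p\<in>{p \<in> irreducibles N. p dvd h}. gfun p) = real q ^ m * weight h"
  using assms
proof (induction m arbitrary: h rule: less_induct)
  case (less m)
  show ?case
  proof (cases "m = 0")
    case True
    then have h: "h = 1" using less.prems by (auto simp: monics_def elim!: degree_eq_zeroE)
    have "{p \<in> irreducibles N. p dvd h} = {}" unfolding h irreducibles_def using irreducible_not_unit by blast
    then have "(\<Prod>p\<in>{p \<in> irreducibles N. p dvd h}. gfun p) = 1" by (simp only: prod.empty)
    then show ?thesis using True h by (simp only: weight_1) simp
  next
    case False
    then have "degree h > 0" using less.prems by (simp add: monics_def)
    then obtain p where p: "irreducible p" "lead_coeff p = 1" "p dvd h" by (rule ex_monic_irreducible_factor)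
    obtain k where k: "h = p * k" using p(3) by (rule dvdE)
    define d where "d = degree p"
    have pm: "p \<in> monics d" using p by (simp add: monics_def d_def)
    have km: "k \<in> monics (m - d)" using less.prems(1) pm unfolding k by (rule monics_cancel)
    have h0: "h \<noteq> 0" using less.prems by (auto dest: monics_nonzero)
    have dpos: "d > 0" using p(1) unfolding d_def by (metis gr0I irreducible_def is_unit_iff_degree)
    have dle: "d \<le> m" using dvd_imp_degree_le[OF p(3) h0] less.prems(1) by (simp add: d_def monics_def)
    have cop: "coprime p k" using less.prems(3) unfolding k by (rule squarefree_imp_coprime_factors)
    have npk: "\<not> p dvd k" using coprime_common_divisor[OF cop dvd_refl] irreducible_not_unit[OF p(1)] by blast
    have "p \<noteq> [:0, 1:]" "p \<noteq> [:-1, 1:]" using less.prems(4,5) unfolding k by auto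
    then have gp: "gfun p = real q ^ d * weight p" by (simp add: gfun_def d_def)
    have "{r \<in> irreducibles N. r dvd h} = insert p {r \<in> irreducibles N. r dvd k}"
    proof (intro equalityI subsetI)
      fix r assume r: "r \<in> {r \<in> irreducibles N. r dvd h}"
      then have irr: "irreducible r" "lead_coeff r = 1" by (auto simp: irreducibles_def)
      have "r dvd p \<or> r dvd k"
        using r field_poly_irreducible_imp_prime[OF irr(1)] unfolding k by (simp add: prime_elem_dvd_mult_iff)
      then show "r \<in> insert p {r \<in> irreducibles N. r dvd k}"
        using r irreducible_monic_dvd_imp_eq[OF irr(1) p(1) irr(2) p(2)] by auto
    next
      fix r assume "r \<in> insert p {r \<in> irreducibles N. r dvd k}"
      moreover have "p \<in> irreducibles N" using p dle less.prems(2) by (auto simp: irreducibles_def d_def)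
      ultimately show "r \<in> {r \<in> irreducibles N. r dvd h}" unfolding k by auto
    qed
    then have "(\<Prod>r\<in>{r \<in> irreducibles N. r dvd h}. gfun r) = gfun p * (\<Prod>r\<in>{r \<in> irreducibles N. r dvd k}. gfun r)"
      using npk by simp
    also have "(\<Prod>r\<in>{r \<in> irreducibles N. r dvd k}. gfun r) = real q ^ (m - d) * weight k"
    proof (rule less.IH)
      show "squarefree k" using less.prems(3) unfolding k by (metis squarefree_multD(2))
    qed (use less.prems km dpos dle in \<open>auto simp: k\<close>)
    also have "gfun p * (real q ^ (m - d) * weight k) = real q ^ m * weight h"
      using weight_mult[OF cop] p km dle unfolding gp k
      by (auto simp: mult_ac dest!: monics_nonzero simp flip: power_add)
    finally show ?thesis .
  qed
qed

lemma sieve_gfun: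
  assumes h: "h \<in> monics m" and "m \<le> N"
  shows "sieve gfun (irreducibles N) h = (if h \<in> good m then real q ^ m * weight h else 0)"
proof (cases "h \<in> good m")
  case True
  then have sf: "squarefree h" by (simp add: good_def)
  have "\<not> (\<exists>p\<in>irreducibles N. p\<^sup>2 dvd h)"
  proof
    assume "\<exists>p\<in>irreducibles N. p\<^sup>2 dvd h"
    then obtain p where "irreducible p" "p\<^sup>2 dvd h" by (auto simp: irreducibles_def)
    then show False using squarefreeD[OF sf] irreducible_not_unit by blast
  qed
  then show ?thesis using True prod_gfun[OF h assms(2)] by (simp add: sieve_def good_def)
next
  case False
  have h0: "h \<noteq> 0" using h by (rule monics_nonzero)
  have irrI: "p \<in> irreducibles N" if "irreducible p" "lead_coeff p = 1" "p dvd h" for p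
    using that dvd_imp_degree_le[OF that(3) h0] assms by (simp add: irreducibles_def monics_def)
  consider "\<not> squarefree h" | "poly h 0 = 0" | "poly h 1 = 0" using False h by (auto simp: good_def)
  then have "sieve gfun (irreducibles N) h = 0"
  proof cases
    case 1
    then obtain d where d: "d\<^sup>2 dvd h" "\<not> is_unit d" by (auto simp: squarefree_def)
    have "d \<noteq> 0" using d h0 by auto
    then have "degree d > 0" using d(2) by (simp add: is_unit_iff_degree)
    then obtain p where p: "irreducible p" "lead_coeff p = 1" "p dvd d" by (rule ex_monic_irreducible_factor)
    have "p\<^sup>2 dvd h" using p(3) d(1) by (meson dvd_power_same dvd_trans)
    moreover have "p dvd h" using calculation by (metis dvd_mult_left power2_eq_square)
    ultimately show ?thesis using irrI p by (auto simp: sieve_def)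
  next
    case 2
    then have "[:0, 1:] dvd h" using poly_eq_0_iff_dvd[of h 0] by simp
    then have "[:0, 1:] \<in> {p \<in> irreducibles N. p dvd h}" "gfun [:0, 1:] = 0"
      using irrI[of "[:0, 1:]"] irreducible_linear_field_poly[of 1 0] by (auto simp: gfun_def)
    then show ?thesis by (auto simp: sieve_def intro!: prod_zero)
  next
    case 3
    then have "[:-1, 1:] dvd h" using poly_eq_0_iff_dvd[of h 1] by simp
    then have "[:-1, 1:] \<in> {p \<in> irreducibles N. p dvd h}" "gfun [:-1, 1:] = 0"
      using irrI[of "[:-1, 1:]"] irreducible_linear_field_poly[of 1 "-1"] by (auto simp: gfun_def)
    then show ?thesis by (auto simp: sieve_def intro!: prod_zero)
  qed
  then show ?thesis using False by simp
qed

text \<open>A polynomial of degree \<open>m\<close> has no prime factor of degree above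
  \<open>m\<close>, so the finite sieve up to \<open>N\<close> is already exact and no limit over
  the set of primes is involved.\<close>

lemma sieve_mean_gfun:
  assumes "m \<le> N"
  shows "sieve_mean gfun (irreducibles N) m = (\<Sum>h\<in>good m. weight h)"
proof -
  have "(\<Sum>h\<in>monics m. sieve gfun (irreducibles N) h) = (\<Sum>h\<in>monics m. if h \<in> good m then real q ^ m * weight h else 0)"
    using assms by (intro sum.cong) (auto simp: sieve_gfun)
  also have "\<dots> = (\<Sum>h\<in>good m. real q ^ m * weight h)"
    by (rule sum.mono_neutral_cong_right) (simp_all, auto simp: good_def)
  finally have "(\<Sum>h\<in>monics m. sieve gfun (irreducibles N) h) = (\<Sum>h\<in>good m. real q ^ m * weight h)" .
  then show ?thesis using q_ge_3 by (simp add: sieve_mean_def CARD_b flip: sum_distrib_left)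
qed

text \<open>In both cases of \<open>weight_irreducible\<close> one has |g - 1| <= 1/(Q - 1) and |g|
  <= Q/(Q - 1), so the left side is at most 2/(Q (Q - 1)), and 1/(Q - 1) <= 2/Q gives 4/Q^2. At the
  two exceptional primes g = 0 leaves 1/Q <= 1.\<close>

lemma gfun_bound:
  assumes p: "irreducible p" "lead_coeff p = 1"
  defines "Q \<equiv> real q ^ degree p"
  shows "\<bar>gfun p - 1\<bar> / Q + \<bar>gfun p\<bar> / Q\<^sup>2 \<le> 4 / Q\<^sup>2 + (if p \<in> {[:0, 1:], [:-1, 1:]} then 1 else 0)"
proof -
  have "degree p > 0" using p(1) by (metis gr0I irreducible_def is_unit_iff_degree)
  then have "real q ^ 1 \<le> Q" unfolding Q_def using q_ge_3 by (intro power_increasing) auto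
  then have Q: "Q \<ge> 3" using q_ge_3 by simp
  show ?thesis
  proof (cases "p \<in> {[:0, 1:], [:-1, 1:]}")
    case True
    then have "gfun p = 0" by (auto simp: gfun_def)
    moreover have "1 / Q \<le> 1" using Q by simp
    ultimately show ?thesis using True by (simp add: add_increasing)
  next
    case False
    then have "gfun p = Q * weight p" by (auto simp: gfun_def Q_def)
    then consider "gfun p = Q / (Q + 1)" | "gfun p = Q / (Q - 1)"
      using weight_irreducible[OF p] by (auto simp: Q_def)
    then have "\<bar>gfun p - 1\<bar> \<le> 1 / (Q - 1) \<and> \<bar>gfun p\<bar> \<le> Q / (Q - 1)"
    proof cases
      case 1
      have "gfun p - 1 = - (1 / (Q + 1))" using Q unfolding 1 by (simp add: field_simps)
      then have "\<bar>gfun p - 1\<bar> = 1 / (Q + 1)" using Q by (simp only: abs_minus_cancel) simp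
      also have "\<dots> \<le> 1 / (Q - 1)" using Q by (intro divide_left_mono mult_pos_pos) auto
      finally show ?thesis using Q unfolding 1 by (simp add: field_simps)
    next
      case 2
      have "gfun p - 1 = 1 / (Q - 1)" using Q unfolding 2 by (simp add: field_simps)
      then show ?thesis using Q unfolding 2 by simp
    qed
    then have "\<bar>gfun p - 1\<bar> / Q + \<bar>gfun p\<bar> / Q\<^sup>2 \<le> 1 / (Q - 1) / Q + Q / (Q - 1) / Q\<^sup>2"
      using Q by (intro add_mono divide_right_mono) simp_all
    also have "Q / (Q - 1) / Q\<^sup>2 = 1 / (Q - 1) / Q" using Q by (simp add: power2_eq_square)
    also have "1 / (Q - 1) / Q + 1 / (Q - 1) / Q = 1 / (Q - 1) * (2 / Q)" by simp
    also have "\<dots> \<le> 2 / Q * (2 / Q)" using Q by (intro mult_right_mono) (auto simp: field_simps)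
    also have "\<dots> = 4 / Q\<^sup>2" by (simp add: power2_eq_square)
    finally show ?thesis using False by simp
  qed
qed

text \<open>The 6 is 2 + 4: at most 1 from each exceptional prime, and 4 times the sum of q^-d over
  d >= 1, because the q^d monic polynomials of degree d bound the number of primes of that
  degree.\<close>

lemma sum_gfun_bound:
  "(\<Sum>p\<in>irreducibles N. 4 / (real q ^ degree p)\<^sup>2 + (if p \<in> {[:0, 1:], [:-1, 1:]} then 1 else 0)) \<le> 6"
proof -
  have "(\<Sum>p\<in>irreducibles N. if p \<in> {[:0, 1:], [:-1, 1:]} then 1 else 0 :: real)
      = (\<Sum>p\<in>irreducibles N \<inter> {[:0, 1:], [:-1, 1:]}. 1)"
    by (subst sum.inter_restrict) auto
  also have "\<dots> \<le> (\<Sum>p\<in>{[:0, 1:], [:-1, 1::'b:]}. 1)" by (rule sum_mono2) auto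
  also have "\<dots> \<le> 2" by simp
  finally have 1: "(\<Sum>p\<in>irreducibles N. if p \<in> {[:0, 1:], [:-1, 1:]} then 1 else 0 :: real) \<le> 2" .
  have sub: "irreducibles N \<subseteq> (\<Union>d\<in>{1..N}. monics d)"
  proof
    fix p assume p: "p \<in> irreducibles N"
    then have "degree p > 0" by (auto simp: irreducibles_def irreducible_def is_unit_iff_degree intro: gr0I)
    then show "p \<in> (\<Union>d\<in>{1..N}. monics d)" using p by (auto simp: irreducibles_def monics_def)
  qed
  have "(\<Sum>p\<in>irreducibles N. 4 / (real q ^ degree p)\<^sup>2) \<le> (\<Sum>p\<in>(\<Union>d\<in>{1..N}. monics d). 4 / (real q ^ degree (p::'b poly))\<^sup>2)"
    using sub by (intro sum_mono2) auto
  also have "\<dots> = (\<Sum>d\<in>{1..N}. \<Sum>p\<in>monics d. 4 / (real q ^ degree (p::'b poly))\<^sup>2)"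
    by (rule sum.UNION_disjoint) (simp_all, auto simp: monics_def)
  also have "\<dots> = (\<Sum>d\<in>{1..N}. 4 * (1 / real q) ^ d)"
  proof (rule sum.cong[OF refl])
    fix d
    have "(\<Sum>p\<in>monics d. 4 / (real q ^ degree (p::'b poly))\<^sup>2) = (\<Sum>p\<in>(monics d :: 'b poly set). 4 / (real q ^ d)\<^sup>2)"
      by (rule sum.cong) (auto simp: monics_def)
    also have "\<dots> = 4 * (1 / real q) ^ d"
      using q_ge_3 by (simp add: card_monics CARD_b power2_eq_square power_divide)
    finally show "(\<Sum>p\<in>monics d. 4 / (real q ^ degree (p::'b poly))\<^sup>2) = 4 * (1 / real q) ^ d" .
  qed
  also have "\<dots> \<le> 4"
  proof -
    \<comment> \<open>The right side is the exact partial sum for ratio 1/2; keeping it instead of 1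
      lets the induction close.\<close>
    have "(\<Sum>d\<in>{1..n}. (1 / real q) ^ d) \<le> 1 - (1 / 2) ^ n" for n
    proof (induction n)
      case (Suc n)
      have "(1 / real q) ^ Suc n \<le> (1 / 2) ^ Suc n"
        using q_ge_3 by (intro power_mono) (auto simp: field_simps)
      moreover have "(\<Sum>d\<in>{1..Suc n}. (1 / real q) ^ d) = (\<Sum>d\<in>{1..n}. (1 / real q) ^ d) + (1 / real q) ^ Suc n"
        by simp
      moreover have "(1 / 2 :: real) ^ Suc n = (1 / 2) ^ n / 2" by simp
      ultimately show ?case using Suc by linarith
    qed simp
    from this[of N] have "(\<Sum>d\<in>{1..N}. (1 / real q) ^ d) \<le> 1"
      by (rule order_trans) simp
    then show ?thesis by (simp flip: sum_distrib_left)
  qed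
  finally show ?thesis using 1 unfolding sum.distrib by linarith
qed

text \<open>The set of primes varies with the truncation \<open>N\<close>, but the bound exp 6 does
  not.\<close>

theorem convergent_sum_weight: "convergent (\<lambda>m. \<Sum>h\<in>good m. weight h)"
proof (rule convergent_if_sum_abs_bdiff_bounded)
  fix N
  have "bdiff (\<lambda>m. \<Sum>h\<in>good m. weight h) m = bdiff (sieve_mean gfun (irreducibles N)) m" if "m \<le> N" for m
    using that by (auto simp: bdiff_def shift_def sieve_mean_gfun)
  then have "sum_abs N (bdiff (\<lambda>m. \<Sum>h\<in>good m. weight h)) = sum_abs N (bdiff (sieve_mean gfun (irreducibles N)))"
    by (simp add: sum_abs_def)
  also have "\<dots> \<le> exp (\<Sum>p\<in>irreducibles N. 4 / (real q ^ degree p)\<^sup>2 + (if p \<in> {[:0, 1:], [:-1, 1:]} then 1 else 0))"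
  proof (rule sum_abs_sieve_le)
    fix r assume "r \<in> irreducibles N"
    then show r: "irreducible r \<and> lead_coeff r = 1" by (simp add: irreducibles_def)
    then show "\<bar>gfun r - 1\<bar> / real CARD('b) ^ degree r + \<bar>gfun r\<bar> / (real CARD('b) ^ degree r)\<^sup>2
        \<le> 4 / (real q ^ degree r)\<^sup>2 + (if r \<in> {[:0, 1:], [:-1, 1:]} then 1 else 0)"
      unfolding CARD_b by (intro gfun_bound) auto
  qed simp
  also have "\<dots> \<le> exp 6" unfolding exp_le_cancel_iff by (rule sum_gfun_bound)
  finally show "sum_abs N (bdiff (\<lambda>m. \<Sum>h\<in>good m. weight h)) \<le> exp 6" .
qed

end

section \<open>Polynomials in a matrix\<close>

text \<open>Horner evaluation, folded so that \<open>pCons\<close> gives the recursion used in the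
  inductions below; the final zero matrix takes its size from \<open>A\<close>.\<close>

definition mat_poly :: "'a::comm_ring_1 mat \<Rightarrow> 'a poly \<Rightarrow> 'a mat" where
  "mat_poly A p = fold_coeffs (\<lambda>a M. a \<cdot>\<^sub>m 1\<^sub>m (dim_row A) + A * M) p (0\<^sub>m (dim_row A) (dim_row A))"

context
  fixes A :: "'a::comm_ring_1 mat" and n :: nat
  assumes A: "A \<in> carrier_mat n n"
begin

lemma mat_poly_0 [simp]: "mat_poly A 0 = 0\<^sub>m n n"
  using A by (simp add: mat_poly_def)

lemma mat_poly_pCons: "mat_poly A (pCons a p) = a \<cdot>\<^sub>m 1\<^sub>m n + A * mat_poly A p"
proof (cases "p = 0 \<and> a = 0")
  case True
  then show ?thesis using A by (auto intro!: eq_matI)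
next
  case False
  then have "\<not> (p = 0 \<and> a = 0)" .
  then show ?thesis using A by (auto simp: mat_poly_def)
qed

lemma mat_poly_carrier [simp]: "mat_poly A p \<in> carrier_mat n n"
  using A by (induction p) (auto simp: mat_poly_pCons)

lemma dim_mat_poly [simp]: "dim_row (mat_poly A p) = n" "dim_col (mat_poly A p) = n"
  using carrier_matD[OF mat_poly_carrier] by auto

lemma mat_poly_add: "mat_poly A (p + q) = mat_poly A p + mat_poly A q"
proof (induction p q rule: poly_induct2)
  case (pCons a p b q)
  have "A * (mat_poly A p + mat_poly A q) = A * mat_poly A p + A * mat_poly A q"
    using A by (intro mult_add_distrib_mat[of _ n n]) auto
  then show ?case using A
    by (auto simp: mat_poly_pCons pCons intro!: eq_matI simp: algebra_simps)
qed (auto intro!: eq_matI)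

lemma mat_poly_smult: "mat_poly A (smult c p) = c \<cdot>\<^sub>m mat_poly A p"
proof (induction p)
  case (pCons a p)
  have "A * (c \<cdot>\<^sub>m mat_poly A p) = c \<cdot>\<^sub>m (A * mat_poly A p)"
    using A by (intro mult_smult_distrib[of _ n n]) auto
  then show ?case using A
    by (auto simp: mat_poly_pCons pCons intro!: eq_matI simp: algebra_simps)
qed (auto intro!: eq_matI)

lemma mat_poly_mult: "mat_poly A (p * q) = mat_poly A p * mat_poly A q"
proof (induction p)
  case (pCons a p)
  have "mat_poly A (pCons a p * q) = a \<cdot>\<^sub>m mat_poly A q + A * (mat_poly A p * mat_poly A q)"
    using A by (auto simp: mat_poly_add mat_poly_smult mat_poly_pCons pCons intro!: eq_matI)
  also have "A * (mat_poly A p * mat_poly A q) = A * mat_poly A p * mat_poly A q"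
    using A by (intro assoc_mult_mat[symmetric, of _ n n _ n _ n]) auto
  also have "a \<cdot>\<^sub>m mat_poly A q = a \<cdot>\<^sub>m 1\<^sub>m n * mat_poly A q"
    by (subst mult_smult_assoc_mat[of _ n n _ n]) (auto simp: left_mult_one_mat[OF mat_poly_carrier])
  also have "\<dots> + A * mat_poly A p * mat_poly A q = (a \<cdot>\<^sub>m 1\<^sub>m n + A * mat_poly A p) * mat_poly A q"
    using A by (intro add_mult_distrib_mat[symmetric, of _ n n _ _ n]) auto
  finally show ?case by (simp add: mat_poly_pCons)
qed (auto intro!: eq_matI)

lemma mat_poly_1 [simp]: "mat_poly A 1 = 1\<^sub>m n"
  using A unfolding one_pCons by (auto simp: mat_poly_pCons intro!: eq_matI)

lemma mat_poly_X: "mat_poly A [:0, 1:] = A"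
  using A by (auto simp: mat_poly_pCons intro!: eq_matI)

lemma mat_poly_uminus: "mat_poly A (- p) = - mat_poly A p"
  using mat_poly_smult[of "-1" p] by (auto intro!: eq_matI)

lemma mat_poly_diff: "mat_poly A (p - q) = mat_poly A p - mat_poly A q"
  using mat_poly_add[of p "- q"] unfolding mat_poly_uminus by (auto intro!: eq_matI)

lemma mat_poly_sum_index:
  "i < n \<Longrightarrow> j < n \<Longrightarrow> mat_poly A (\<Sum>k\<in>S. f k) $$ (i, j) = (\<Sum>k\<in>S. mat_poly A (f k) $$ (i, j))"
  by (induction S rule: infinite_finite_induct) (auto simp: mat_poly_add)

lemma mat_poly_commute:
  assumes X: "X \<in> carrier_mat n n" "X * A = A * X"
  shows "X * mat_poly A p = mat_poly A p * X"
proof (induction p)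
  case (pCons a p)
  have "X * (A * mat_poly A p) = X * A * mat_poly A p"
    using A X by (intro assoc_mult_mat[symmetric, of _ n n _ n _ n]) auto
  also have "\<dots> = A * (X * mat_poly A p)"
    unfolding X(2) using A X by (intro assoc_mult_mat[of _ n n _ n _ n]) auto
  also have "\<dots> = A * mat_poly A p * X"
    unfolding pCons using A X by (intro assoc_mult_mat[symmetric, of _ n n _ n _ n]) auto
  finally have 1: "X * (A * mat_poly A p) = A * mat_poly A p * X" .
  have 2: "X * (a \<cdot>\<^sub>m 1\<^sub>m n) = a \<cdot>\<^sub>m 1\<^sub>m n * X"
    using X by (simp add: mult_smult_distrib[OF X(1) one_carrier_mat] mult_smult_assoc_mat[OF one_carrier_mat X(1)])
  have "X * mat_poly A (pCons a p) = X * (a \<cdot>\<^sub>m 1\<^sub>m n) + X * (A * mat_poly A p)"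
    unfolding mat_poly_pCons using A X by (intro mult_add_distrib_mat[of _ n n]) auto
  also have "\<dots> = (a \<cdot>\<^sub>m 1\<^sub>m n + A * mat_poly A p) * X"
    unfolding 1 2 using A X by (intro add_mult_distrib_mat[symmetric, of _ n n _ _ n]) auto
  finally show ?case by (simp add: mat_poly_pCons)
qed (use X in auto)

lemma mat_poly_commute_self: "A * mat_poly A p = mat_poly A p * A"
  using A by (rule mat_poly_commute) simp

lemma mat_poly_mult_vec:
  "v \<in> carrier_vec n \<Longrightarrow> mat_poly A (p * q) *\<^sub>v v = mat_poly A p *\<^sub>v (mat_poly A q *\<^sub>v v)"
  by (simp add: mat_poly_mult assoc_mult_mat_vec[of _ n n _ n])

lemma mat_poly_add_vec:
  "v \<in> carrier_vec n \<Longrightarrow> mat_poly A (p + q) *\<^sub>v v = mat_poly A p *\<^sub>v v + mat_poly A q *\<^sub>v v"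
  unfolding mat_poly_add by (rule add_mult_distrib_mat_vec) auto

lemma mat_poly_diff_vec:
  "v \<in> carrier_vec n \<Longrightarrow> mat_poly A (p - q) *\<^sub>v v = mat_poly A p *\<^sub>v v - mat_poly A q *\<^sub>v v"
  unfolding mat_poly_diff by (rule minus_mult_distrib_mat_vec) auto

text \<open>The map \<open>w \<mapsto> \<Sum>\<^sub>j w\<^sub>j(A) e\<^sub>j\<close> of modules over the polynomial ring kills the image of \<open>x - A\<close>,
  which by the adjugate contains the multiples of the characteristic polynomial.\<close>

theorem cayley_hamilton: "mat_poly A (char_poly A) = 0\<^sub>m n n"
proof (rule eq_matI)
  fix i k assume "i < dim_row (0\<^sub>m n n :: 'a mat)" "k < dim_col (0\<^sub>m n n :: 'a mat)"
  then have ik: "i < n" "k < n" by auto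
  define M where "M = char_poly_matrix A"
  \<comment> \<open>Column \<open>k\<close> of the adjugate of x - A: a vector of polynomials that
    \<open>M\<close> maps to \<open>char_poly A\<close> times the \<open>k\<close>-th unit
    vector.\<close>
  define w where "w = (\<lambda>j. adj_mat M $$ (j, k))"
  have M: "M \<in> carrier_mat n n" using A by (simp add: M_def)
  have adjM: "adj_mat M \<in> carrier_mat n n" "M * adj_mat M = det M \<cdot>\<^sub>m 1\<^sub>m n" using adj_mat[OF M] by auto
  have eq: "(\<Sum>l<n. M $$ (j, l) * w l) = (if j = k then char_poly A else 0)" if "j < n" for j
  proof -
    have "(M * adj_mat M) $$ (j, k) = (\<Sum>l<n. M $$ (j, l) * w l)"
      using that ik M adjM(1) by (simp add: scalar_prod_def w_def atLeast0LessThan)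
    then show ?thesis using that ik unfolding adjM(2) by (auto simp: char_poly_def M_def)
  qed
  have M_index: "M $$ (j, l) = (if j = l then [:0, 1:] else 0) - [:A $$ (j, l):]" if "j < n" "l < n" for j l
    using that A by (auto simp: M_def char_poly_matrix_def)
  have row: "(\<Sum>l<n. M $$ (j, l) * w l) = [:0, 1:] * w j - (\<Sum>l<n. smult (A $$ (j, l)) (w l))" if "j < n" for j
  proof -
    have "(\<Sum>l<n. M $$ (j, l) * w l) = (\<Sum>l<n. (if j = l then [:0, 1:] * w l else 0) - smult (A $$ (j, l)) (w l))"
      using that by (intro sum.cong) (auto simp: M_index algebra_simps)
    then show ?thesis using that by (simp add: sum_subtractf)
  qed
  let ?E = "\<lambda>p j. mat_poly A p $$ (i, j)"
  have mult_index: "(X * Y) $$ (i, j) = (\<Sum>l<n. X $$ (i, l) * Y $$ (l, j))"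
    if "X \<in> carrier_mat n n" "Y \<in> carrier_mat n n" "j < n" for X Y :: "'a mat" and j
    using that ik by (simp add: scalar_prod_def atLeast0LessThan)
  have "(\<Sum>j<n. ?E (\<Sum>l<n. M $$ (j, l) * w l) j)
      = (\<Sum>j<n. ?E ([:0, 1:] * w j) j) - (\<Sum>j<n. \<Sum>l<n. A $$ (j, l) * ?E (w l) j)"
    unfolding sum_subtractf[symmetric]
  proof (rule sum.cong[OF refl])
    fix j assume "j \<in> {..<n}"
    then show "?E (\<Sum>l<n. M $$ (j, l) * w l) j = ?E ([:0, 1:] * w j) j - (\<Sum>l<n. A $$ (j, l) * ?E (w l) j)"
      using ik by (simp add: row mat_poly_diff mat_poly_sum_index mat_poly_smult del: mult_pCons_left)
  qed
  \<comment> \<open>Summed over all rows this term reproduces the first one, because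
    \<open>A\<close> commutes with polynomials in \<open>A\<close>; the two cancel and leave
    0.\<close>
  also have "(\<Sum>j<n. \<Sum>l<n. A $$ (j, l) * ?E (w l) j) = (\<Sum>l<n. (mat_poly A (w l) * A) $$ (i, l))"
    using A by (subst sum.swap) (auto simp: mult_index mult.commute intro!: sum.cong)
  also have "(\<Sum>l<n. (mat_poly A (w l) * A) $$ (i, l)) = (\<Sum>l<n. ?E ([:0, 1:] * w l) l)"
    by (simp only: mat_poly_mult mat_poly_X mat_poly_commute_self)
  finally have "(\<Sum>j<n. ?E (\<Sum>l<n. M $$ (j, l) * w l) j) = 0" by simp
  moreover have "(\<Sum>j<n. ?E (\<Sum>l<n. M $$ (j, l) * w l) j) = (\<Sum>j<n. if j = k then ?E (char_poly A) j else 0)"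
    using ik by (intro sum.cong) (auto simp: eq)
  ultimately show "mat_poly A (char_poly A) $$ (i, k) = 0\<^sub>m n n $$ (i, k)" using ik by simp
qed auto

lemma cayley_hamilton_vec: "v \<in> carrier_vec n \<Longrightarrow> char_poly A dvd p \<Longrightarrow> mat_poly A p *\<^sub>v v = 0\<^sub>v n"
proof -
  assume v: "v \<in> carrier_vec n" and "char_poly A dvd p"
  then obtain k where "p = k * char_poly A" by (metis dvdE mult.commute)
  then have "mat_poly A p = 0\<^sub>m n n" by (simp add: mat_poly_mult cayley_hamilton right_mult_zero_mat[of _ n n])
  then show "mat_poly A p *\<^sub>v v = 0\<^sub>v n" using v by (auto intro!: eq_vecI)
qed

text \<open>The matrix x - A divides g(x) - g(A), by Horner induction. If g(A) = 0, determinants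
  turn this into divisibility of g^n. Consequently every prime factor of the characteristic
  polynomial divides each annihilating polynomial.\<close>

lemma char_poly_dvd_annihilator_power:
  assumes "mat_poly A g = 0\<^sub>m n n"
  shows "char_poly A dvd g ^ n"
proof -
  define C :: "'a mat \<Rightarrow> 'a poly mat" where "C = map_mat (\<lambda>a. [:a:])"
  define M where "M = char_poly_matrix A"
  interpret const: comm_ring_hom "\<lambda>a::'a. [:a:]" by unfold_locales (auto simp: one_pCons)
  have C: "C X \<in> carrier_mat n n" if "X \<in> carrier_mat n n" for X using that by (simp add: C_def)
  have M: "M \<in> carrier_mat n n" using A by (simp add: M_def)
  have M_eq: "M = [:0, 1:] \<cdot>\<^sub>m 1\<^sub>m n - C A"
    using A by (auto simp: M_def C_def char_poly_matrix_def intro!: eq_matI)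
  have "\<exists>Q\<in>carrier_mat n n. g \<cdot>\<^sub>m 1\<^sub>m n - C (mat_poly A g) = M * Q" for g
  proof (induction g)
    case 0
    show ?case using M by (intro bexI[of _ "0\<^sub>m n n"]) (auto simp: C_def intro!: eq_matI)
  next
    case (pCons a g)
    then obtain Q where Q: "Q \<in> carrier_mat n n" "g \<cdot>\<^sub>m 1\<^sub>m n - C (mat_poly A g) = M * Q" by blast
    define B where "B = C (mat_poly A g)"
    have B: "B \<in> carrier_mat n n" by (simp add: B_def C)
    have CA: "C A * B = C (A * mat_poly A g)"
      unfolding C_def B_def using A by (intro const.mat_hom_mult[symmetric]) auto
    have "M * ([:0, 1:] \<cdot>\<^sub>m Q + B) = [:0, 1:] \<cdot>\<^sub>m (M * Q) + M * B"
      using mult_add_distrib_mat[OF M smult_carrier_mat[OF Q(1)] B] mult_smult_distrib[OF M Q(1)] by simp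
    also have "M * B = [:0, 1:] \<cdot>\<^sub>m B - C A * B"
      unfolding M_eq using B A C[OF A]
      by (simp add: minus_mult_distrib_mat[of _ n n] mult_smult_assoc_mat[of _ n n])
    also have "[:0, 1:] \<cdot>\<^sub>m (M * Q) + ([:0, 1:] \<cdot>\<^sub>m B - C A * B) = pCons a g \<cdot>\<^sub>m 1\<^sub>m n - C (mat_poly A (pCons a g))"
      unfolding Q(2)[symmetric] CA using A
      by (auto simp: B_def C_def mat_poly_pCons intro!: eq_matI)
    finally show ?case using M Q B by (intro bexI[of _ "[:0, 1:] \<cdot>\<^sub>m Q + B"]) auto
  qed
  then obtain Q where Q: "Q \<in> carrier_mat n n" "g \<cdot>\<^sub>m 1\<^sub>m n - C (mat_poly A g) = M * Q" by blast
  have "g \<cdot>\<^sub>m 1\<^sub>m n - C (mat_poly A g) = g \<cdot>\<^sub>m 1\<^sub>m n"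
    using assms by (auto simp: C_def intro!: eq_matI)
  then have "M * Q = g \<cdot>\<^sub>m 1\<^sub>m n" using Q(2) by simp
  then have "det (g \<cdot>\<^sub>m 1\<^sub>m n) = det M * det Q" using det_mult[OF M Q(1)] by simp
  then show ?thesis by (simp add: M_def char_poly_def)
qed

end

section \<open>Cyclic vectors\<close>

text \<open>Linear independence of v, A v, ..., A^(n-1) v, phrased through polynomials of degree
  below n.\<close>

definition cyclic_vec :: "'a::field mat \<Rightarrow> 'a vec \<Rightarrow> bool" where
  "cyclic_vec A v \<longleftrightarrow> v \<in> carrier_vec (dim_row A) \<and>
    (\<forall>p\<in>polys_lt (dim_row A). mat_poly A p *\<^sub>v v = 0\<^sub>v (dim_row A) \<longrightarrow> p = 0)"

text \<open>Vectors with coprime annihilators add up to a vector whose annihilator is the product.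
  Proving it for all divisors \<open>f\<close> allows induction by one prime at a time;
  \<open>f = char_poly A\<close> then gives a cyclic vector.\<close>

lemma squarefree_imp_annihilator:
  fixes A :: "'a::field mat"
  assumes A: "A \<in> carrier_mat n n" and sf: "squarefree (char_poly A)" and f: "f dvd char_poly A"
  shows "\<exists>v\<in>carrier_vec n. \<forall>r. mat_poly A r *\<^sub>v v = 0\<^sub>v n \<longleftrightarrow> f dvd r"
  using f
proof (induction "degree f" arbitrary: f rule: less_induct)
  case less
  define h where "h = char_poly A"
  have h0: "h \<noteq> 0" using sf by (auto simp: h_def)
  have f0: "f \<noteq> 0" using less.prems h0 by (auto simp: h_def)
  show ?case
  proof (cases "degree f = 0")
    case True
    then have "f dvd r" for r using f0 is_unit_iff_degree[OF f0] unit_imp_dvd by blast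
    then show ?thesis using A by (intro bexI[of _ "0\<^sub>v n"]) auto
  next
    case False
    then obtain p where p: "irreducible p" "lead_coeff p = 1" "p dvd f"
      using ex_monic_irreducible_factor[of f] by auto
    obtain k where k: "f = p * k" using p(3) by (rule dvdE)
    have k0: "k \<noteq> 0" using f0 k by auto
    have dp: "degree p > 0" using p(1) by (metis gr0I irreducible_def is_unit_iff_degree)
    then have "degree k < degree f" using f0 unfolding k by (simp add: degree_mult_eq)
    moreover have "k dvd char_poly A" using less.prems unfolding k by (rule dvd_mult_right)
    ultimately obtain v where v: "v \<in> carrier_vec n" "\<And>r. mat_poly A r *\<^sub>v v = 0\<^sub>v n \<longleftrightarrow> k dvd r"
      using less.hyps by blast
    have "squarefree (p * k)" using squarefree_mono[OF less.prems sf] unfolding k .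
    then have cop: "coprime p k" by (rule squarefree_imp_coprime_factors)
    have "p dvd h" using p(3) less.prems unfolding h_def by (rule dvd_trans)
    then obtain g where g: "h = p * g" by (rule dvdE)
    have "coprime p g" using sf unfolding h_def[symmetric] g by (rule squarefree_imp_coprime_factors)
    \<comment> \<open>With \<open>g\<close> the cofactor of \<open>p\<close>, a vanishing g(A) would
      force \<open>p\<close> to divide a power of \<open>g\<close>, against squarefreeness. Any
      nonzero column of g(A) then has annihilator exactly \<open>p\<close>.\<close>
    have "mat_poly A g \<noteq> 0\<^sub>m n n"
    proof
      assume "mat_poly A g = 0\<^sub>m n n"
      then have "h dvd g ^ n" unfolding h_def by (rule char_poly_dvd_annihilator_power[OF A])
      then have "p dvd g ^ n" unfolding g by (rule dvd_mult_left)
      moreover have "coprime p (g ^ n)" using \<open>coprime p g\<close> by (rule coprime_poly_power_right)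
      ultimately have "is_unit p" using coprime_common_divisor[OF _ dvd_refl] by blast
      then show False using p(1) irreducible_not_unit by blast
    qed
    then obtain i j where ij: "i < n" "j < n" "mat_poly A g $$ (i, j) \<noteq> 0"
      using dim_mat_poly[OF A] by (auto simp: mat_eq_iff)
    define w where "w = mat_poly A g *\<^sub>v unit_vec n j"
    have w: "w \<in> carrier_vec n"
      unfolding w_def using mat_poly_carrier[OF A] by (rule mult_mat_vec_carrier) simp
    have "w $ i \<noteq> 0" using ij A by (simp add: w_def)
    then have w0: "w \<noteq> 0\<^sub>v n" using ij by auto
    have pw: "mat_poly A p *\<^sub>v w = 0\<^sub>v n"
      unfolding w_def using A
      by (simp add: mat_poly_mult_vec[OF A, symmetric] g[symmetric] h_def cayley_hamilton_vec[OF A])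
    have zero: "mat_poly A r *\<^sub>v 0\<^sub>v n = 0\<^sub>v n" for r using A by auto
    have w_ann: "p dvd r" if "mat_poly A r *\<^sub>v w = 0\<^sub>v n" for r
    proof (rule ccontr)
      assume "\<not> p dvd r"
      then have "coprime p r" by (rule irreducible_poly_coprime[OF p(1)])
      then obtain a b where ab: "a * p + b * r = 1" using poly_bezout by blast
      have "mat_poly A (a * p + b * r) *\<^sub>v w = 0\<^sub>v n"
        using w that pw zero by (simp add: mat_poly_add_vec[OF A] mat_poly_mult_vec[OF A])
      then show False using w w0 ab by (simp add: mat_poly_1[OF A])
    qed
    have "mat_poly A r *\<^sub>v (v + w) = 0\<^sub>v n \<longleftrightarrow> f dvd r" for r
    proof
      assume "f dvd r"
      then have "k dvd r" "p dvd r" unfolding k by (auto dest: dvd_mult_left dvd_mult_right)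
      then obtain s where s: "r = s * p" by (metis dvdE mult.commute)
      have "mat_poly A r *\<^sub>v w = 0\<^sub>v n" using w pw zero by (simp add: s mat_poly_mult_vec[OF A])
      moreover have "mat_poly A r *\<^sub>v v = 0\<^sub>v n" using v \<open>k dvd r\<close> by simp
      ultimately show "mat_poly A r *\<^sub>v (v + w) = 0\<^sub>v n"
        using mult_add_distrib_mat_vec[OF mat_poly_carrier[OF A] v(1) w, of r] by simp
    next
      assume r: "mat_poly A r *\<^sub>v (v + w) = 0\<^sub>v n"
      have *: "mat_poly A (s * r) *\<^sub>v v + mat_poly A (s * r) *\<^sub>v w = 0\<^sub>v n" for s
      proof -
        have "mat_poly A (s * r) *\<^sub>v v + mat_poly A (s * r) *\<^sub>v w = mat_poly A (s * r) *\<^sub>v (v + w)"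
          using v w A by (subst mult_add_distrib_mat_vec[of _ n n]) auto
        also have "\<dots> = 0\<^sub>v n" using v w r zero by (simp add: mat_poly_mult_vec[OF A])
        finally show ?thesis .
      qed
      have c: "mat_poly A (s * r) *\<^sub>v u \<in> carrier_vec n" if "u \<in> carrier_vec n" for s u
        using mat_poly_carrier[OF A] that by (rule mult_mat_vec_carrier)
      \<comment> \<open>Applying \<open>k\<close> removes the contribution of \<open>v\<close> and
        leaves a relation for \<open>w\<close> alone; applying \<open>p\<close> below isolates
        \<open>v\<close> in the same way.\<close>
      have "mat_poly A (k * r) *\<^sub>v v = 0\<^sub>v n" using v by simp
      then have "mat_poly A (k * r) *\<^sub>v w = 0\<^sub>v n" using *[of k] c[OF w, of k] by simp
      then have "p dvd k * r" by (rule w_ann)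
      then have pr: "p dvd r" using cop by (simp add: coprime_poly_dvd_mult_iff)
      have "mat_poly A (p * r) *\<^sub>v w = 0\<^sub>v n"
        using w pw zero by (simp add: mult.commute[of p] mat_poly_mult_vec[OF A])
      then have "mat_poly A (p * r) *\<^sub>v v = 0\<^sub>v n" using *[of p] c[OF v(1), of p] by simp
      then have "k dvd p * r" using v by simp
      then have "k dvd r" using cop by (simp add: coprime_poly_dvd_mult_iff coprime_commute)
      then show "f dvd r" unfolding k using pr cop by (intro coprime_poly_dvd_mult)
    qed
    then show ?thesis using v w by (intro bexI[of _ "v + w"]) auto
  qed
qed

lemma degree_char_poly: "A \<in> carrier_mat n n \<Longrightarrow> degree (char_poly (A::'a::comm_ring_1 mat)) = n"
  and lead_coeff_char_poly: "A \<in> carrier_mat n n \<Longrightarrow> lead_coeff (char_poly (A::'a::comm_ring_1 mat)) = 1"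
  using degree_monic_char_poly by auto

lemma squarefree_imp_cyclic:
  fixes A :: "'a::field mat"
  assumes A: "A \<in> carrier_mat n n" and sf: "squarefree (char_poly A)"
  obtains v where "cyclic_vec A v"
proof -
  obtain v where v: "v \<in> carrier_vec n" "\<And>r. mat_poly A r *\<^sub>v v = 0\<^sub>v n \<longleftrightarrow> char_poly A dvd r"
    using squarefree_imp_annihilator[OF A sf dvd_refl] by blast
  have "p = 0" if "p \<in> polys_lt n" "char_poly A dvd p" for p
    using that dvd_imp_degree_le[of "char_poly A" p] degree_char_poly[OF A] unfolding polys_lt_iff by linarith
  then have "cyclic_vec A v" using v A by (auto simp: cyclic_vec_def)
  then show ?thesis by (rule that)
qed

lemma zero_mat_mult_vec [simp]: "v \<in> carrier_vec n \<Longrightarrow> 0\<^sub>m m n *\<^sub>v v = 0\<^sub>v m"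
  by (auto intro!: eq_vecI)

lemma eq_mat_by_vec:
  fixes X Y :: "'a::comm_ring_1 mat"
  assumes "X \<in> carrier_mat m n" "Y \<in> carrier_mat m n" "\<And>v. v \<in> carrier_vec n \<Longrightarrow> X *\<^sub>v v = Y *\<^sub>v v"
  shows "X = Y"
proof (rule eq_matI)
  fix i j assume "i < dim_row Y" "j < dim_col Y"
  then have ij: "i < m" "j < n" using assms by auto
  have "(X *\<^sub>v unit_vec n j) $ i = (Y *\<^sub>v unit_vec n j) $ i" using assms(3) by simp
  then show "X $$ (i, j) = Y $$ (i, j)" using ij assms(1,2) by simp
qed (use assms in auto)

lemma invertible_if_inj:
  fixes W :: "'a::field mat"
  assumes W: "W \<in> carrier_mat n n" and inj: "\<And>v. v \<in> carrier_vec n \<Longrightarrow> W *\<^sub>v v = 0\<^sub>v n \<Longrightarrow> v = 0\<^sub>v n"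
  obtains W' where "W' \<in> carrier_mat n n" "W * W' = 1\<^sub>m n" "W' * W = 1\<^sub>m n"
proof -
  have "det W \<noteq> 0" using det_0_iff_vec_prod_zero_field[OF W] inj by blast
  from det_non_zero_imp_unit[OF W this, unfolded Units_def, of "()"]
  show ?thesis using that by (auto simp: ring_mat_def)
qed

text \<open>Evaluation of polynomials of degree below \<open>n\<close> at a vector, as a matrix acting on coefficients.\<close>

definition krylov_mat :: "'a::field mat \<Rightarrow> 'a vec \<Rightarrow> 'a mat" where
  "krylov_mat A v = mat (dim_row A) (dim_row A) (\<lambda>(i, j). (mat_poly A (monom 1 j) *\<^sub>v v) $ i)"

lemma poly_eq_sum_monom_lt: "p \<in> polys_lt n \<Longrightarrow> p = (\<Sum>j<n. monom (coeff p j) j)"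
  by (rule poly_eqI) (auto simp: coeff_sum polys_lt_def)

lemma krylov_mult_vec:
  fixes A :: "'a::field mat"
  assumes A: "A \<in> carrier_mat n n" and v: "v \<in> carrier_vec n" and p: "p \<in> polys_lt n"
  shows "krylov_mat A v *\<^sub>v vec n (coeff p) = mat_poly A p *\<^sub>v v"
proof (rule eq_vecI)
  fix i assume "i < dim_vec (mat_poly A p *\<^sub>v v)"
  then have i: "i < n" using A by simp
  have "(mat_poly A p *\<^sub>v v) $ i = (\<Sum>l<n. mat_poly A p $$ (i, l) * v $ l)"
    using A v i by (simp add: scalar_prod_def atLeast0LessThan)
  also have "\<dots> = (\<Sum>l<n. (\<Sum>j<n. coeff p j * mat_poly A (monom 1 j) $$ (i, l)) * v $ l)"
  proof (rule sum.cong[OF refl])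
    fix l assume "l \<in> {..<n}"
    then have "mat_poly A (\<Sum>j<n. smult (coeff p j) (monom 1 j)) $$ (i, l)
        = (\<Sum>j<n. coeff p j * mat_poly A (monom 1 j) $$ (i, l))"
      using i by (simp add: mat_poly_sum_index[OF A] mat_poly_smult[OF A] dim_mat_poly[OF A])
    then show "mat_poly A p $$ (i, l) * v $ l = (\<Sum>j<n. coeff p j * mat_poly A (monom 1 j) $$ (i, l)) * v $ l"
      using poly_eq_sum_monom_lt[OF p] by (simp add: smult_monom)
  qed
  also have "\<dots> = (\<Sum>j<n. (\<Sum>l<n. mat_poly A (monom 1 j) $$ (i, l) * v $ l) * coeff p j)"
    unfolding sum_distrib_right by (subst sum.swap) (simp add: mult_ac)
  also have "\<dots> = (krylov_mat A v *\<^sub>v vec n (coeff p)) $ i"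
    using A v i by (simp add: krylov_mat_def scalar_prod_def atLeast0LessThan)
  finally show "(krylov_mat A v *\<^sub>v vec n (coeff p)) $ i = (mat_poly A p *\<^sub>v v) $ i" ..
qed (use A in \<open>auto simp: krylov_mat_def\<close>)

lemma ex_poly_of_vec:
  fixes v :: "'a::comm_ring_1 vec"
  assumes "v \<in> carrier_vec n"
  obtains p where "p \<in> polys_lt n" "v = vec n (coeff p)"
proof
  have c: "coeff (\<Sum>j<n. monom (v $ j) j) i = (if i < n then v $ i else 0)" for i
    by (auto simp: coeff_sum)
  show "(\<Sum>j<n. monom (v $ j) j) \<in> polys_lt n" by (simp add: polys_lt_def c)
  show "v = vec n (coeff (\<Sum>j<n. monom (v $ j) j))" using assms by (auto simp: c)
qed

lemma krylov_invertible:
  fixes A :: "'a::field mat"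
  assumes A: "A \<in> carrier_mat n n" and v: "cyclic_vec A v"
  obtains W where "W \<in> carrier_mat n n" "krylov_mat A v * W = 1\<^sub>m n" "W * krylov_mat A v = 1\<^sub>m n"
proof (rule invertible_if_inj[of "krylov_mat A v" n])
  show "krylov_mat A v \<in> carrier_mat n n" using A by (simp add: krylov_mat_def)
  have vc: "v \<in> carrier_vec n" using v A by (simp add: cyclic_vec_def)
  fix u assume u: "u \<in> carrier_vec n" "krylov_mat A v *\<^sub>v u = 0\<^sub>v n"
  obtain p where p: "p \<in> polys_lt n" "u = vec n (coeff p)" using ex_poly_of_vec[OF u(1)] .
  then have "mat_poly A p *\<^sub>v v = 0\<^sub>v n" using u krylov_mult_vec[OF A vc p(1)] by simp
  then have "p = 0" using v p A by (auto simp: cyclic_vec_def)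
  then show "u = 0\<^sub>v n" using p by auto
qed (rule that)

lemma cyclic_ex_poly:
  fixes A :: "'a::field mat"
  assumes A: "A \<in> carrier_mat n n" and v: "cyclic_vec A v" and u: "u \<in> carrier_vec n"
  obtains p where "p \<in> polys_lt n" "u = mat_poly A p *\<^sub>v v"
proof -
  have vc: "v \<in> carrier_vec n" using v A by (simp add: cyclic_vec_def)
  have K: "krylov_mat A v \<in> carrier_mat n n" using A by (simp add: krylov_mat_def)
  obtain W where W: "W \<in> carrier_mat n n" "krylov_mat A v * W = 1\<^sub>m n" "W * krylov_mat A v = 1\<^sub>m n"
    using krylov_invertible[OF A v] .
  have "W *\<^sub>v u \<in> carrier_vec n" using W u by simp
  then obtain p where p: "p \<in> polys_lt n" "W *\<^sub>v u = vec n (coeff p)" by (rule ex_poly_of_vec)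
  have "mat_poly A p *\<^sub>v v = krylov_mat A v *\<^sub>v (W *\<^sub>v u)" using p krylov_mult_vec[OF A vc] by simp
  also have "\<dots> = krylov_mat A v * W *\<^sub>v u" using K W(1) u by (rule assoc_mult_mat_vec[symmetric])
  also have "\<dots> = u" using W u by simp
  finally show ?thesis using that p by metis
qed

text \<open>A matrix commuting with \<open>A\<close> is determined by its value at the cyclic
  vector, and that value is some p(A) v.\<close>

lemma cyclic_commutant:
  fixes A :: "'a::field mat"
  assumes A: "A \<in> carrier_mat n n" and v: "cyclic_vec A v"
    and X: "X \<in> carrier_mat n n" "X * A = A * X"
  obtains p where "p \<in> polys_lt n" "X = mat_poly A p"
proof -
  have vc: "v \<in> carrier_vec n" using v A by (simp add: cyclic_vec_def)
  have "X *\<^sub>v v \<in> carrier_vec n" using X vc by simp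
  then obtain p where p: "p \<in> polys_lt n" "X *\<^sub>v v = mat_poly A p *\<^sub>v v" by (rule cyclic_ex_poly[OF A v])
  have "X = mat_poly A p"
  proof (rule eq_mat_by_vec[of _ n n])
    fix u :: "'a vec" assume u: "u \<in> carrier_vec n"
    obtain r where r: "u = mat_poly A r *\<^sub>v v" using cyclic_ex_poly[OF A v u] by metis
    have "X *\<^sub>v u = X * mat_poly A r *\<^sub>v v"
      unfolding r using X vc by (intro assoc_mult_mat_vec[symmetric, of _ n n _ n]) (auto simp: A)
    also have "X * mat_poly A r = mat_poly A r * X" using A X by (rule mat_poly_commute)
    also have "mat_poly A r * X *\<^sub>v v = mat_poly A r *\<^sub>v (X *\<^sub>v v)"
      using X vc by (intro assoc_mult_mat_vec[of _ n n _ n]) (auto simp: A)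
    also have "\<dots> = mat_poly A (r * p) *\<^sub>v v" unfolding p by (simp add: mat_poly_mult_vec[OF A vc])
    also have "\<dots> = mat_poly A p *\<^sub>v u" unfolding r by (simp add: mat_poly_mult_vec[OF A vc, symmetric] mult.commute)
    finally show "X *\<^sub>v u = mat_poly A p *\<^sub>v u" .
  qed (use X A in auto)
  then show ?thesis using that p by blast
qed

lemma cyclic_mat_poly_inj:
  fixes A :: "'a::field mat"
  assumes A: "A \<in> carrier_mat n n" and v: "cyclic_vec A v"
    and p: "p \<in> polys_lt n" "r \<in> polys_lt n" "mat_poly A p = mat_poly A r"
  shows "p = r"
proof -
  have vc: "v \<in> carrier_vec n" using v A by (simp add: cyclic_vec_def)
  have "mat_poly A (p - r) *\<^sub>v v = 0\<^sub>v n" using p(3) vc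
    by (simp add: mat_poly_diff_vec[OF A] minus_cancel_vec[OF mult_mat_vec_carrier[OF mat_poly_carrier[OF A]]])
  moreover have "p - r \<in> polys_lt n" using p by (simp add: polys_lt_def)
  ultimately show ?thesis using v A by (auto simp: cyclic_vec_def)
qed

lemma cyclic_mat_poly_invertible_iff:
  fixes A :: "'a::field mat"
  assumes A: "A \<in> carrier_mat n n" and v: "cyclic_vec A v"
  shows "det (mat_poly A p) \<noteq> 0 \<longleftrightarrow> coprime p (char_poly A)"
proof
  have vc: "v \<in> carrier_vec n" using v A by (simp add: cyclic_vec_def)
  have P: "mat_poly A p \<in> carrier_mat n n" using A by simp
  assume "coprime p (char_poly A)"
  then obtain a b where ab: "a * p + b * char_poly A = 1" using poly_bezout by blast
  have "mat_poly A (a * p + b * char_poly A) = mat_poly A a * mat_poly A p"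
    using mult_carrier_mat[OF mat_poly_carrier[OF A] mat_poly_carrier[OF A]]
    by (simp add: mat_poly_add[OF A] mat_poly_mult[OF A] cayley_hamilton[OF A]
      right_mult_zero_mat[OF mat_poly_carrier[OF A]] right_add_zero_mat)
  then have "mat_poly A a * mat_poly A p = 1\<^sub>m n" using ab by (simp add: mat_poly_1[OF A])
  then have "det (mat_poly A a) * det (mat_poly A p) = 1" using det_mult[OF mat_poly_carrier[OF A] P] by (metis det_one)
  then show "det (mat_poly A p) \<noteq> 0" by auto
next
  have vc: "v \<in> carrier_vec n" using v A by (simp add: cyclic_vec_def)
  have P: "mat_poly A p \<in> carrier_mat n n" using A by simp
  assume det: "det (mat_poly A p) \<noteq> 0"
  show "coprime p (char_poly A)"
  proof (rule coprimeI, rule ccontr)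
    fix d assume d: "d dvd p" "d dvd char_poly A" "\<not> is_unit d"
    obtain k where k: "char_poly A = k * d" using d(2) by (metis dvdE mult.commute)
    obtain r where r: "p = r * d" using d(1) by (metis dvdE mult.commute)
    have h0: "char_poly A \<noteq> 0" using lead_coeff_char_poly[OF A] by auto
    have nz: "k \<noteq> 0" "d \<noteq> 0" using h0 k by auto
    have "degree d > 0" using d(3) nz by (simp add: is_unit_iff_degree)
    \<comment> \<open>A common factor \<open>d\<close> makes its cofactor \<open>k\<close> of degree
      below \<open>n\<close>, so k(A) v is nonzero by cyclicity, while p(A) kills it by the
      Cayley-Hamilton theorem.\<close>
    then have "k \<in> polys_lt n" using degree_char_poly[OF A] nz unfolding k
      by (auto simp: polys_lt_iff degree_mult_eq)
    then have w: "mat_poly A k *\<^sub>v v \<noteq> 0\<^sub>v n" using v A nz by (auto simp: cyclic_vec_def)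
    have "mat_poly A p *\<^sub>v (mat_poly A k *\<^sub>v v) = mat_poly A (r * (k * d)) *\<^sub>v v"
      unfolding r by (simp add: mat_poly_mult_vec[OF A vc, symmetric] mult_ac)
    also have "\<dots> = 0\<^sub>v n" unfolding k[symmetric] by (rule cayley_hamilton_vec[OF A vc]) simp
    finally have "mat_poly A p *\<^sub>v (mat_poly A k *\<^sub>v v) = 0\<^sub>v n" .
    moreover have "mat_poly A k *\<^sub>v v \<in> carrier_vec n" using A vc by (intro mult_mat_vec_carrier[of _ n n]) auto
    ultimately show False using det w det_0_iff_vec_prod_zero_field[OF P] by blast
  qed
qed

text \<open>Multiplication by x on the residue ring modulo \<open>h\<close>, in the basis of
  monomials. Writing columns as remainders avoids a separate formula for the last one.\<close>

definition companion_mat :: "'a::field poly \<Rightarrow> 'a mat" where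
  "companion_mat h = mat (degree h) (degree h) (\<lambda>(i, j). coeff (monom 1 (Suc j) mod h) i)"

lemma companion_carrier: "companion_mat h \<in> carrier_mat (degree h) (degree h)"
  by (simp add: companion_mat_def)

lemma cyclic_similar_companion:
  fixes A :: "'a::field mat"
  assumes A: "A \<in> carrier_mat n n" and v: "cyclic_vec A v"
  shows "A * krylov_mat A v = krylov_mat A v * companion_mat (char_poly A)"
proof (rule mat_col_eqI)
  have vc: "v \<in> carrier_vec n" using v A by (simp add: cyclic_vec_def)
  have K: "krylov_mat A v \<in> carrier_mat n n" using A by (simp add: krylov_mat_def)
  have h0: "char_poly A \<noteq> 0" using lead_coeff_char_poly[OF A] by auto
  have C: "companion_mat (char_poly A) \<in> carrier_mat n n" using companion_carrier degree_char_poly[OF A] by metis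
  fix j assume "j < dim_col (krylov_mat A v * companion_mat (char_poly A))"
  then have j: "j < n" using C by auto
  have "col (krylov_mat A v) j = mat_poly A (monom 1 j) *\<^sub>v v"
    using A j by (intro eq_vecI) (auto simp: krylov_mat_def)
  then have "col (A * krylov_mat A v) j = A *\<^sub>v (mat_poly A (monom 1 j) *\<^sub>v v)"
    using col_mult2[OF A K j] by simp
  also have "\<dots> = mat_poly A ([:0, 1:] * monom 1 j) *\<^sub>v v"
    unfolding mat_poly_mult_vec[OF A vc] mat_poly_X[OF A] ..
  also have "[:0, 1:] * monom 1 j = (monom 1 (Suc j) :: 'a poly)" by (simp add: monom_Suc)
  also have "\<dots> = monom 1 (Suc j) div char_poly A * char_poly A + monom 1 (Suc j) mod char_poly A" by simp
  also have "mat_poly A \<dots> *\<^sub>v v = mat_poly A (monom 1 (Suc j) mod char_poly A) *\<^sub>v v"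
    unfolding mat_poly_add_vec[OF A vc]
    using cayley_hamilton_vec[OF A vc, of "monom 1 (Suc j) div char_poly A * char_poly A"] A vc
    by (simp add: mult_mat_vec_carrier[of _ n n])
  also have "\<dots> = krylov_mat A v *\<^sub>v vec n (coeff (monom 1 (Suc j) mod char_poly A))"
    using mod_in_polys_lt[OF h0] degree_char_poly[OF A] by (subst krylov_mult_vec[OF A vc]) auto
  also have "vec n (coeff (monom 1 (Suc j) mod char_poly A)) = col (companion_mat (char_poly A)) j"
    using j degree_char_poly[OF A] by (intro eq_vecI) (auto simp: companion_mat_def)
  also have "krylov_mat A v *\<^sub>v \<dots> = col (krylov_mat A v * companion_mat (char_poly A)) j"
    using col_mult2[OF K C j] by simp
  finally show "col (A * krylov_mat A v) j = col (krylov_mat A v * companion_mat (char_poly A)) j" .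
qed (use A degree_char_poly[OF A] in \<open>auto simp: krylov_mat_def companion_mat_def\<close>)

text \<open>Both matrices are carried to the same companion matrix by their Krylov matrices;
  \<open>K\<close> is the quotient of the two.\<close>

lemma cyclic_similar:
  fixes A B :: "'a::field mat"
  assumes A: "A \<in> carrier_mat n n" "cyclic_vec A v" and B: "B \<in> carrier_mat n n" "cyclic_vec B w"
    and eq: "char_poly A = char_poly B"
  obtains K where "K \<in> carrier_mat n n" "det K \<noteq> 0" "A * K = K * B"
proof -
  define V W C where "V = krylov_mat A v" and "W = krylov_mat B w" and "C = companion_mat (char_poly A)"
  have V: "V \<in> carrier_mat n n" "A * V = V * C" and W: "W \<in> carrier_mat n n" "B * W = W * C"
    using A B eq cyclic_similar_companion[OF A] cyclic_similar_companion[OF B]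
    by (auto simp: V_def W_def C_def krylov_mat_def)
  have C: "C \<in> carrier_mat n n" unfolding C_def using companion_carrier degree_char_poly[OF A(1)] by metis
  obtain V' where V': "V' \<in> carrier_mat n n" "V * V' = 1\<^sub>m n" "V' * V = 1\<^sub>m n"
    using krylov_invertible[OF A] by (auto simp: V_def)
  obtain W' where W': "W' \<in> carrier_mat n n" "W * W' = 1\<^sub>m n" "W' * W = 1\<^sub>m n"
    using krylov_invertible[OF B] by (auto simp: W_def)
  note ac = assoc_mult_mat[of _ n n _ n _ n]
  show ?thesis
  proof (rule that[of "V * W'"])
    show c: "V * W' \<in> carrier_mat n n" using V W' by simp
    have "W' * (W * V') = V'" using V'(1) W(1) W' by (simp add: ac[symmetric])
    then have "V * W' * (W * V') = 1\<^sub>m n" using V(1) V' W(1) W'(1) by (simp add: ac)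
    then have "det (V * W') * det (W * V') = 1"
      using det_mult[OF c, of "W * V'"] W V' by (metis det_one mult_carrier_mat)
    then show "det (V * W') \<noteq> 0" by auto
    have "A * (V * W') = V * C * W'" using A(1) V W'(1) by (simp add: ac[symmetric])
    also have "V * C = V * (W' * (W * C))" using V(1) W(1) W' C by (simp add: ac[symmetric])
    also have "\<dots> = V * (W' * (B * W))" by (simp only: W(2))
    also have "\<dots> * W' = V * (W' * (B * (W * W')))" using V(1) W(1) W'(1) B(1) by (simp add: ac)
    also have "\<dots> = V * W' * B" using V(1) W' B(1) by (simp add: ac)
    finally show "A * (V * W') = V * W' * B" .
  qed
qed

lemma poly_sum_mod:
  fixes h :: "'a::field poly"
  shows "(\<Sum>i\<in>I. f i mod h) = (\<Sum>i\<in>I. f i) mod h"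
  by (induction I rule: infinite_finite_induct) (auto simp: poly_mod_add_left)

text \<open>The unit vector 0 stands for the residue 1, so applying p(C) to it yields the residue of
  \<open>p\<close>.\<close>

lemma companion_mat_poly_unit_vec:
  fixes h :: "'a::field poly"
  assumes n: "degree h = n" "n > 0"
  shows "mat_poly (companion_mat h) p *\<^sub>v unit_vec n 0 = vec n (coeff (p mod h))"
proof (induction p)
  case 0
  show ?case using companion_carrier[of h] n by (auto simp: mat_poly_0)
next
  case (pCons a p)
  have C: "companion_mat h \<in> carrier_mat n n" using companion_carrier n by metis
  have h0: "h \<noteq> 0" using n by auto
  define r where "r = p mod h"
  have r: "r \<in> polys_lt n" unfolding r_def using mod_in_polys_lt[OF h0] n by simp
  have u: "unit_vec n 0 \<in> carrier_vec n" by simp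
  have "mat_poly (companion_mat h) (pCons a p) *\<^sub>v unit_vec n 0
      = a \<cdot>\<^sub>v unit_vec n 0 + companion_mat h *\<^sub>v vec n (coeff r)"
    unfolding mat_poly_pCons[OF C] r_def pCons.IH[symmetric]
    using C u by (subst add_mult_distrib_mat_vec[of _ n n])
      (auto simp: assoc_mult_mat_vec[OF C mat_poly_carrier[OF C] u] intro!: eq_vecI)
  also have "companion_mat h *\<^sub>v vec n (coeff r) = vec n (coeff ([:0, 1:] * r mod h))"
  proof (rule eq_vecI)
    fix i assume "i < dim_vec (vec n (coeff ([:0, 1:] * r mod h)))"
    then have i: "i < n" by simp
    have "(companion_mat h *\<^sub>v vec n (coeff r)) $ i = (\<Sum>j<n. coeff (monom 1 (Suc j) mod h) i * coeff r j)"
      using i n by (simp add: companion_mat_def scalar_prod_def atLeast0LessThan)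
    also have "\<dots> = coeff (\<Sum>j<n. smult (coeff r j) (monom 1 (Suc j) mod h)) i"
      by (simp add: coeff_sum mult.commute)
    also have "(\<Sum>j<n. smult (coeff r j) (monom 1 (Suc j) mod h)) = (\<Sum>j<n. [:0, 1:] * monom (coeff r j) j) mod h"
      by (simp add: poly_sum_mod mod_smult_left[symmetric] smult_monom monom_Suc[symmetric])
    also have "(\<Sum>j<n. [:0, 1:] * monom (coeff r j) j) = [:0, 1:] * r"
      unfolding sum_distrib_left[symmetric] using poly_eq_sum_monom_lt[OF r] by simp
    finally show "(companion_mat h *\<^sub>v vec n (coeff r)) $ i = vec n (coeff ([:0, 1:] * r mod h)) $ i"
      using i by simp
  qed (use n in \<open>simp add: companion_mat_def\<close>)
  also have "a \<cdot>\<^sub>v unit_vec n 0 = vec n (coeff ([:a:] mod h))"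
  proof -
    have "[:a:] mod h = [:a:]" using n by (intro mod_poly_less) simp
    then show ?thesis by (intro eq_vecI) (auto simp: coeff_pCons unit_vec_def split: nat.splits)
  qed
  also have "vec n (coeff ([:a:] mod h)) + vec n (coeff ([:0, 1:] * r mod h)) = vec n (coeff (([:a:] + [:0, 1:] * r) mod h))"
    unfolding poly_mod_add_left by auto
  also have "([:a:] + [:0, 1:] * r) mod h = ([:a:] + [:0, 1:] * p) mod h"
    unfolding r_def by (metis mod_add_right_eq mod_mult_right_eq)
  also have "[:a:] + [:0, 1:] * p = pCons a p" by simp
  finally show ?case .
qed

text \<open>Evaluating the Cayley-Hamilton theorem at the residue 1 shows that \<open>h\<close>
  divides the characteristic polynomial; both are monic of the same degree.\<close>

lemma char_poly_companion:
  fixes h :: "'a::field poly"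
  assumes h: "lead_coeff h = 1" "degree h > 0"
  shows "char_poly (companion_mat h) = h"
proof -
  define n where "n = degree h"
  have C: "companion_mat h \<in> carrier_mat n n" using companion_carrier by (simp add: n_def)
  define d where "d = char_poly (companion_mat h) - h"
  have h0: "h \<noteq> 0" using h by auto
  have deg: "degree (char_poly (companion_mat h)) = n" "lead_coeff (char_poly (companion_mat h)) = 1"
    using degree_char_poly[OF C] lead_coeff_char_poly[OF C] by auto
  have dn: "d \<in> polys_lt n" unfolding polys_lt_def d_def
  proof safe
    fix i assume "n \<le> i"
    then show "coeff (char_poly (companion_mat h) - h) i = 0"
      using deg h by (cases "i = n") (auto simp: n_def coeff_eq_0)
  qed
  have "vec n (coeff (char_poly (companion_mat h) mod h)) = 0\<^sub>v n"
    using companion_mat_poly_unit_vec[of h n "char_poly (companion_mat h)"] h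
    by (simp add: n_def[symmetric] cayley_hamilton[OF C])
  moreover have "char_poly (companion_mat h) mod h = d"
  proof -
    have "char_poly (companion_mat h) mod h = d mod h" by (simp add: d_def poly_mod_diff_left)
    also have "d mod h = d" using dn by (intro polys_lt_mod) (simp add: n_def)
    finally show ?thesis .
  qed
  ultimately have v: "vec n (coeff d) = 0\<^sub>v n" by simp
  have "coeff d i = 0" for i
  proof (cases "i < n")
    case True
    then show ?thesis using v by (metis index_vec index_zero_vec(1))
  qed (use dn in \<open>simp add: polys_lt_def\<close>)
  then have "d = 0" by (simp add: poly_eq_iff)
  then show ?thesis by (simp add: d_def)
qed

text \<open>The symmetric Hankel matrix \<open>S\<close> of the coefficients of \<open>h\<close> intertwines the companion matrix
  with its transpose.\<close>

lemma companion_symmetrizer: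
  fixes h :: "'a::field poly"
  assumes h: "lead_coeff h = 1"
  defines "n \<equiv> degree h"
  defines "S \<equiv> mat n n (\<lambda>(i, j). coeff h (i + j + 1))"
  shows "companion_mat h * S = S * transpose_mat (companion_mat h)" and "det S \<noteq> 0"
proof -
  have h0: "h \<noteq> 0" using h by auto
  have S: "S \<in> carrier_mat n n" by (simp add: S_def)
  have C: "companion_mat h \<in> carrier_mat n n" using companion_carrier by (simp add: n_def)
  have hn: "coeff h n = 1" using h by (simp add: n_def)
  have C_index: "companion_mat h $$ (i, k) = (if i = Suc k then 1 else 0) - (if Suc k = n then coeff h i else 0)"
    if "i < n" "k < n" for i k
  proof (cases "Suc k = n")
    case True
    have "monom 1 n - h \<in> polys_lt n"
      using hn by (auto simp: polys_lt_def coeff_eq_0 n_def le_less)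
    then have "(monom 1 n - h) mod h = monom 1 n - h" by (intro polys_lt_mod) (simp add: n_def)
    then have "monom 1 n mod h = monom 1 n - h" by (simp add: poly_mod_diff_left)
    then show ?thesis using that True by (simp add: companion_mat_def n_def[symmetric])
  next
    case False
    then have "monom 1 (Suc k) mod h = monom 1 (Suc k)"
      using that by (intro mod_poly_less) (simp add: degree_monom_eq n_def)
    then show ?thesis using that False by (auto simp: companion_mat_def n_def[symmetric])
  qed
  \<comment> \<open>This form is symmetric in \<open>i\<close> and \<open>j\<close>: in row 0 and in
    column 0 only the corner entry survives, elsewhere the entry depends on \<open>i + j\<close>
    alone.\<close>
  have CS: "(companion_mat h * S) $$ (i, j) = (if i = 0 then 0 else coeff h (i + j)) - (if j = 0 then coeff h i else 0)"
    if ij: "i < n" "j < n" for i j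
  proof -
    have "(companion_mat h * S) $$ (i, j)
        = (\<Sum>k<n. ((if i = Suc k then 1 else 0) - (if Suc k = n then coeff h i else 0)) * coeff h (k + j + 1))"
      using ij C S C_index by (simp add: scalar_prod_def atLeast0LessThan S_def)
    also have "\<dots> = (\<Sum>k<n. if i = Suc k then coeff h (k + j + 1) else 0)
        - (\<Sum>k<n. if Suc k = n then coeff h i * coeff h (k + j + 1) else 0)"
      unfolding sum_subtractf[symmetric] by (rule sum.cong) (auto simp: algebra_simps)
    also have "(\<Sum>k<n. if i = Suc k then coeff h (k + j + 1) else 0) = (if i = 0 then 0 else coeff h (i + j))"
    proof (cases i)
      case (Suc l)
      then show ?thesis using ij by simp
    qed simp
    also have "(\<Sum>k<n. if Suc k = n then coeff h i * coeff h (k + j + 1) else 0) = coeff h i * coeff h (n + j)"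
    proof -
      obtain l where l: "n = Suc l" using ij by (cases n) auto
      then show ?thesis by simp
    qed
    also have "coeff h i * coeff h (n + j) = (if j = 0 then coeff h i else 0)"
      using hn by (auto simp: n_def coeff_eq_0)
    finally show ?thesis .
  qed
  have St: "transpose_mat S = S" by (auto simp: S_def add.commute)
  have "S * transpose_mat (companion_mat h) = transpose_mat (companion_mat h * S)"
    using C S by (simp add: transpose_mult[of _ n n _ n] St)
  also have "\<dots> = companion_mat h * S"
    by (rule eq_matI) (use C S in \<open>auto simp: CS add.commute simp del: index_mult_mat(1)\<close>)
  finally show "companion_mat h * S = S * transpose_mat (companion_mat h)" ..
  show "det S \<noteq> 0"
  proof
    assume "det S = 0"
    then obtain u where u: "u \<in> carrier_vec n" "u \<noteq> 0\<^sub>v n" "S *\<^sub>v u = 0\<^sub>v n"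
      using det_0_iff_vec_prod_zero_field[OF S] by blast
    have "u $ j = 0" if "j < n" for j
      using that
    proof (induction j rule: less_induct)
      case (less j)
      \<comment> \<open>In this row the antidiagonal entry, the leading coefficient 1, meets
        \<open>u $ j\<close>. Entries further right vanish, those further left meet components
        already known to be 0.\<close>
      define i where "i = n - 1 - j"
      have i: "i < n" using less by (simp add: i_def)
      have "0 = (S *\<^sub>v u) $ i" using u i by simp
      also have "\<dots> = (\<Sum>k<n. coeff h (i + k + 1) * u $ k)"
        using i u(1) by (simp add: S_def scalar_prod_def atLeast0LessThan)
      also have "\<dots> = (\<Sum>k\<in>{j}. coeff h (i + k + 1) * u $ k)"
      proof (rule sum.mono_neutral_right)
        show "\<forall>k\<in>{..<n} - {j}. coeff h (i + k + 1) * u $ k = 0"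
        proof
          fix k assume k: "k \<in> {..<n} - {j}"
          show "coeff h (i + k + 1) * u $ k = 0"
          proof (cases "k < j")
            case False
            then have "i + k + 1 > n" using k less.prems by (auto simp: i_def)
            then show ?thesis by (simp add: n_def coeff_eq_0)
          qed (use k less in auto)
        qed
      qed (use less in auto)
      also have "\<dots> = u $ j" using less.prems hn by (simp add: i_def)
      finally show ?case ..
    qed
    then have "u = 0\<^sub>v n" using u by auto
    then show False using u by blast
  qed
qed

section \<open>Hermitian forms over a finite field\<close>

lemma card_eq_fibres:
  assumes "finite A" "finite B" "f ` A \<subseteq> B" "\<And>b. b \<in> B \<Longrightarrow> card {a \<in> A. f a = b} = c"
  shows "card A = card B * c"
proof -
  have "A = (\<Union>b\<in>B. {a \<in> A. f a = b})" using assms(3) by auto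
  then have "card A = card (\<Union>b\<in>B. {a \<in> A. f a = b})" by simp
  also have "\<dots> = (\<Sum>b\<in>B. card {a \<in> A. f a = b})"
    using assms by (intro card_UN_disjoint) auto
  finally show ?thesis using assms(4) by simp
qed

lemma finite_carrier_mat [simp]: "finite (carrier_mat m n :: 'a::finite mat set)"
proof -
  have "carrier_mat m n \<subseteq> (\<lambda>f. mat m n f) ` (({0..<m} \<times> {0..<n}) \<rightarrow>\<^sub>E (UNIV :: 'a set))"
  proof
    fix A :: "'a mat" assume A: "A \<in> carrier_mat m n"
    have "A = mat m n (restrict (\<lambda>ij. A $$ ij) ({0..<m} \<times> {0..<n}))" using A by (intro eq_matI) auto
    then show "A \<in> (\<lambda>f. mat m n f) ` (({0..<m} \<times> {0..<n}) \<rightarrow>\<^sub>E UNIV)"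
      by (intro image_eqI[where x = "restrict (\<lambda>ij. A $$ ij) ({0..<m} \<times> {0..<n})"]) auto
  qed
  then show ?thesis by (rule finite_subset) (auto intro!: finite_PiE)
qed

lemma card_power_eq_le:
  fixes c :: "'a::field"
  assumes "n > 0"
  shows "finite {x. x ^ n = c}" "card {x. x ^ n = c} \<le> n"
proof -
  define f where "f = monom 1 n - [:c:]"
  have "coeff f n = 1" using assms by (simp add: f_def coeff_pCons split: nat.splits)
  then have f0: "f \<noteq> 0" by auto
  have "degree f \<le> n" unfolding f_def by (intro degree_diff_le degree_monom_le) auto
  moreover have "{x. x ^ n = c} = {x. poly f x = 0}" by (auto simp: f_def poly_monom)
  ultimately show "finite {x. x ^ n = c}" "card {x. x ^ n = c} \<le> n"
    using poly_roots_finite[OF f0] card_poly_roots_bound[OF f0] by auto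
qed

lemma ex_invertible_first_col:
  fixes x :: "'a::field mat"
  assumes x: "x \<in> carrier_mat (Suc n) 1" "x \<noteq> 0\<^sub>m (Suc n) 1"
  obtains P where "P \<in> carrier_mat (Suc n) (Suc n)" "det P \<noteq> 0" "col P 0 = col x 0"
proof -
  obtain i where i: "i < Suc n" "x $$ (i, 0) \<noteq> 0" using x by (auto simp: mat_eq_iff)
  \<comment> \<open>Column 0 of \<open>P\<close> is the given vector and the other columns are
    standard basis vectors. The swap of 0 and \<open>i\<close> leaves row \<open>i\<close>, where
    the given vector is nonzero, without a further entry.\<close>
  define \<pi> where "\<pi> = Transposition.transpose 0 i"
  have \<pi>: "\<pi> (\<pi> k) = k" "k < Suc n \<Longrightarrow> \<pi> k < Suc n" for k
    using i by (auto simp: \<pi>_def Transposition.transpose_def)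
  have \<pi>i: "\<pi> i = 0" by (simp add: \<pi>_def)
  define P where "P = mat (Suc n) (Suc n) (\<lambda>(k, l). if l = 0 then x $$ (k, 0) else if l = \<pi> k then 1 else 0)"
  have P: "P \<in> carrier_mat (Suc n) (Suc n)" by (simp add: P_def)
  have "det P \<noteq> 0"
  proof
    assume "det P = 0"
    then obtain u where u: "u \<in> carrier_vec (Suc n)" "u \<noteq> 0\<^sub>v (Suc n)" "P *\<^sub>v u = 0\<^sub>v (Suc n)"
      using det_0_iff_vec_prod_zero_field[OF P] by blast
    have row: "x $$ (k, 0) * u $ 0 + (if \<pi> k = 0 then 0 else u $ \<pi> k) = 0" if k: "k < Suc n" for k
    proof -
      have "0 = (P *\<^sub>v u) $ k" using u(3) k by simp
      also have "\<dots> = (\<Sum>l<Suc n. (if l = 0 then x $$ (k, 0) else if l = \<pi> k then 1 else 0) * u $ l)"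
        using k u(1) by (simp add: P_def scalar_prod_def atLeast0LessThan del: sum.lessThan_Suc sum.op_ivl_Suc)
      also have "\<dots> = (\<Sum>l<Suc n. (if l = 0 then x $$ (k, 0) * u $ 0 else 0)
          + (if l = \<pi> k then (if \<pi> k = 0 then 0 else u $ \<pi> k) else 0))"
        by (rule sum.cong) auto
      also have "\<dots> = x $$ (k, 0) * u $ 0 + (if \<pi> k = 0 then 0 else u $ \<pi> k)"
        unfolding sum.distrib using \<pi>(2)[OF k] by (simp del: sum.lessThan_Suc)
      finally show ?thesis ..
    qed
    have u0: "u $ 0 = 0" using row[OF i(1)] i(2) \<pi>i by simp
    have "u $ l = 0" if "l < Suc n" for l
      using row[OF \<pi>(2)[OF that]] u0 by (simp add: \<pi>(1) split: if_splits)
    then have "u = 0\<^sub>v (Suc n)" using u(1) by auto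
    then show False using u(2) by blast
  qed
  moreover have "col P 0 = col x 0" using x by (auto simp: P_def)
  ultimately show ?thesis using that P by blast
qed

lemma matrix_inverse:
  fixes P :: "'a::field mat"
  assumes "P \<in> carrier_mat n n" "det P \<noteq> 0"
  obtains Q where "Q \<in> carrier_mat n n" "P * Q = 1\<^sub>m n" "Q * P = 1\<^sub>m n" "det Q \<noteq> 0"
proof -
  from det_non_zero_imp_unit[OF assms, unfolded Units_def, of "()"]
  obtain Q where Q: "Q \<in> carrier_mat n n" "P * Q = 1\<^sub>m n" "Q * P = 1\<^sub>m n" by (auto simp: ring_mat_def)
  then have "det P * det Q = 1" using det_mult[OF assms(1) Q(1)] by simp
  then have "det Q \<noteq> 0" by auto
  then show ?thesis using that[OF Q] by blast
qed

lemma det_mult3: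
  fixes A B C :: "'a::comm_ring_1 mat"
  assumes "A \<in> carrier_mat n n" "B \<in> carrier_mat n n" "C \<in> carrier_mat n n"
  shows "det (A * B * C) = det A * det B * det C"
  using det_mult[OF mult_carrier_mat[OF assms(1,2)] assms(3)] det_mult[OF assms(1,2)] by simp

lemma four_block_carrier_Suc:
  "A \<in> carrier_mat 1 1 \<Longrightarrow> D \<in> carrier_mat n m \<Longrightarrow> four_block_mat A B C D \<in> carrier_mat (Suc n) (Suc m)"
  using four_block_carrier_mat[of A 1 1 D n m B C] by simp

section \<open>The norm to the subfield, conjugate transposes and orthonormal frames\<close>

context quad_ext
begin

lemma two_neq_0: "(2 :: 'a) \<noteq> 0"
proof
  assume "(2 :: 'a) = 0"
  then have "(of_nat 2 :: 'a) = 0" by simp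
  then have "CHAR('a) dvd 2" by (simp only: of_nat_eq_0_iff_char_dvd)
  then have "CHAR('a) = 2" using prime_CHAR_finite_field[where ?'a = 'a] by (metis primes_dvd_imp_eq two_is_prime_nat)
  then have "even (CARD('a))" using CHAR_dvd_CARD[where ?'a = 'a] by simp
  then show False using odd_q by (simp add: CARD_a)
qed

lemma card_fixed: "card {x. cj x = x} = q"
proof -
  have "{x. cj x = x} = range \<iota>" by (auto simp: cj_eq_iff)
  then show ?thesis using card_image[of \<iota> UNIV] inj_f by (simp add: CARD_b)
qed

text \<open>Each fibre consists of roots of a polynomial of degree q + 1, and the q - 1 fibres over
  nonzero fixed elements share q^2 - 1 elements. Equality must hold in every fibre.\<close>

lemma card_norm_fibre:
  assumes c: "cj c = c" "c \<noteq> 0"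
  shows "card {x. x * cj x = c} = q + 1"
proof -
  define K where "K = {x. cj x = x} - {0}"
  define N where "N = (\<lambda>c. {x. x * cj x = c})"
  have finK: "finite K" by simp
  have cardK: "card K = q - 1" by (simp add: K_def card_Diff_singleton card_fixed)
  have le: "card (N c) \<le> q + 1" for c
    using card_power_eq_le(2)[of "q + 1" c] by (simp add: N_def cj_def)
  have "(\<Union>c\<in>K. N c) = UNIV - {0}" by (auto simp: N_def K_def cj.hom_mult mult.commute)
  then have "card (\<Union>c\<in>K. N c) = q\<^sup>2 - 1" by (simp add: card_Diff_singleton CARD_a)
  moreover have "card (\<Union>c\<in>K. N c) = (\<Sum>c\<in>K. card (N c))"
    using finK by (intro card_UN_disjoint) (auto simp: N_def)
  moreover have "q\<^sup>2 - 1 = (\<Sum>c\<in>K. q + 1)"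
    using q_ge_3 by (simp add: cardK power2_eq_square algebra_simps diff_mult_distrib)
  ultimately have eq: "(\<Sum>c\<in>K. card (N c)) = (\<Sum>c\<in>K. q + 1)" by simp
  have "card (N c) = q + 1"
  proof (rule ccontr)
    assume "card (N c) \<noteq> q + 1"
    then have "card (N c) < q + 1" using le[of c] by simp
    then have "(\<Sum>c\<in>K. card (N c)) < (\<Sum>c\<in>K. q + 1)"
      using le finK c by (intro sum_strict_mono_ex1) (auto simp: K_def)
    then show False using eq by simp
  qed
  then show ?thesis by (simp add: N_def)
qed

lemma norm_surj:
  assumes "cj c = c"
  obtains x where "x * cj x = c"
proof (cases "c = 0")
  case True
  then show ?thesis using that[of 0] by simp
next
  case False
  then have "card {x. x * cj x = c} \<noteq> 0" using card_norm_fibre assms by simp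
  then have "{x. x * cj x = c} \<noteq> {}" by force
  then show ?thesis using that by blast
qed

text \<open>The conjugate transpose, not the adjugate \<open>adj_mat\<close>.\<close>

definition adj :: "'a mat \<Rightarrow> 'a mat" where
  "adj A = transpose_mat (map_mat cj A)"

lemma adj_carrier [simp]: "A \<in> carrier_mat m n \<Longrightarrow> adj A \<in> carrier_mat n m"
  by (simp add: adj_def)

lemma dim_adj [simp]: "dim_row (adj A) = dim_col A" "dim_col (adj A) = dim_row A"
  by (simp_all add: adj_def)

lemma adj_index [simp]: "i < dim_col A \<Longrightarrow> j < dim_row A \<Longrightarrow> adj A $$ (i, j) = cj (A $$ (j, i))"
  by (simp add: adj_def)

lemma adj_adj [simp]: "adj (adj A) = A"
  by (rule eq_matI) auto

lemma adj_mult: "A \<in> carrier_mat m n \<Longrightarrow> B \<in> carrier_mat n k \<Longrightarrow> adj (A * B) = adj B * adj A"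
  by (rule eq_matI) (auto simp: scalar_prod_def cj.hom_sum cj.hom_mult mult.commute intro!: sum.cong)

lemma adj_one [simp]: "adj (1\<^sub>m n) = 1\<^sub>m n"
  by (rule eq_matI) auto

lemma adj_zero [simp]: "adj (0\<^sub>m m n) = 0\<^sub>m n m"
  by (rule eq_matI) auto

lemma adj_add: "A \<in> carrier_mat m n \<Longrightarrow> B \<in> carrier_mat m n \<Longrightarrow> adj (A + B) = adj A + adj B"
  by (rule eq_matI) (auto simp: cj.hom_add)

lemma adj_minus: "A \<in> carrier_mat m n \<Longrightarrow> B \<in> carrier_mat m n \<Longrightarrow> adj (A - B) = adj A - adj B"
  by (rule eq_matI) (auto simp: cj.hom_minus)

lemma adj_uminus: "adj (- A) = - adj A"
  by (rule eq_matI) (auto simp: cj.hom_uminus)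

lemma adj_smult: "adj (c \<cdot>\<^sub>m A) = cj c \<cdot>\<^sub>m adj A"
  by (rule eq_matI) (auto simp: cj.hom_mult)

lemma adj_four_block:
  assumes "A \<in> carrier_mat a c" "B \<in> carrier_mat a d" "C \<in> carrier_mat b c" "D \<in> carrier_mat b d"
  shows "adj (four_block_mat A B C D) = four_block_mat (adj A) (adj C) (adj B) (adj D)"
  using assms by (intro eq_matI) auto

lemma det_adj: "A \<in> carrier_mat n n \<Longrightarrow> det (adj A) = cj (det A)"
  unfolding adj_def by (simp add: det_transpose cj.hom_det)

definition unitary :: "nat \<Rightarrow> 'a mat set" where
  "unitary n = {U \<in> carrier_mat n n. adj U * U = 1\<^sub>m n}"

lemma unitary_carrier: "U \<in> unitary n \<Longrightarrow> U \<in> carrier_mat n n"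
  by (simp add: unitary_def)

lemma unitary_left: "U \<in> unitary n \<Longrightarrow> adj U * U = 1\<^sub>m n"
  by (simp add: unitary_def)

lemma unitary_right: "U \<in> unitary n \<Longrightarrow> U * adj U = 1\<^sub>m n"
  unfolding unitary_def by (auto intro: mat_mult_left_right_inverse[of "adj U" n])

lemma unitary_adj: "U \<in> unitary n \<Longrightarrow> adj U \<in> unitary n"
  using unitary_right by (auto simp: unitary_def)

lemma finite_unitary [simp]: "finite (unitary n)"
  by (rule finite_subset[OF _ finite_carrier_mat[of n n]]) (auto simp: unitary_def)

text \<open>Matrices of isometric embeddings of m-space into n-space. Counting frames and dividing
  by \<open>unitary m\<close> replaces counting nondegenerate subspaces.\<close>

definition frames :: "nat \<Rightarrow> nat \<Rightarrow> 'a mat set" where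
  "frames n m = {Y \<in> carrier_mat n m. adj Y * Y = 1\<^sub>m m}"

lemma frames_carrier: "Y \<in> frames n m \<Longrightarrow> Y \<in> carrier_mat n m"
  by (simp add: frames_def)

lemma frames_square: "frames n n = unitary n"
  by (simp add: frames_def unitary_def)

lemma finite_frames [simp]: "finite (frames n m)"
  by (rule finite_subset[OF _ finite_carrier_mat[of n m]]) (auto simp: frames_def)

lemma mult_frames:
  assumes X: "X \<in> frames n m" and Y: "Y \<in> frames m k"
  shows "X * Y \<in> frames n k"
proof -
  have c: "X \<in> carrier_mat n m" "Y \<in> carrier_mat m k" using X Y by (auto simp: frames_def)
  have "adj (X * Y) * (X * Y) = adj Y * (adj X * (X * Y))"
    unfolding adj_mult[OF c] using c by (intro assoc_mult_mat[of _ k m _ n _ k]) auto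
  also have "adj X * (X * Y) = adj X * X * Y"
    using c by (intro assoc_mult_mat[symmetric, of _ m n _ m _ k]) auto
  finally show ?thesis using X Y c by (simp add: frames_def)
qed

lemma unitary_mult_frame: "U \<in> unitary n \<Longrightarrow> Y \<in> frames n m \<Longrightarrow> U * Y \<in> frames n m"
  and frame_mult_unitary: "Y \<in> frames n m \<Longrightarrow> K \<in> unitary m \<Longrightarrow> Y * K \<in> frames n m"
  using mult_frames by (auto simp: frames_square[symmetric])

lemma unitary_cancel:
  assumes "U \<in> unitary n" "X \<in> carrier_mat n m"
  shows "adj U * (U * X) = X" "U * (adj U * X) = X"
proof -
  have U: "U \<in> carrier_mat n n" using assms by (simp add: unitary_def)
  have "adj U * (U * X) = adj U * U * X" "U * (adj U * X) = U * adj U * X"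
    using U assms by (auto intro!: assoc_mult_mat[symmetric])
  then show "adj U * (U * X) = X" "U * (adj U * X) = X"
    using assms unitary_left unitary_right by auto
qed

definition unit_frame :: "nat \<Rightarrow> nat \<Rightarrow> 'a mat" where
  "unit_frame n m = mat n m (\<lambda>(i, j). if i = j then 1 else 0)"

lemma unit_frame_carrier [simp]: "unit_frame n m \<in> carrier_mat n m"
  by (simp add: unit_frame_def)

lemma mult_unit_frame:
  assumes "A \<in> carrier_mat k n" "m \<le> n"
  shows "A * unit_frame n m = mat k m (\<lambda>ij. A $$ ij)"
proof (rule eq_matI)
  fix i j assume "i < dim_row (mat k m (\<lambda>ij. A $$ ij))" "j < dim_col (mat k m (\<lambda>ij. A $$ ij))"
  then have ij: "i < k" "j < m" by auto
  then have "(A * unit_frame n m) $$ (i, j) = (\<Sum>l<n. if l = j then A $$ (i, l) else 0)"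
    using assms by (simp add: scalar_prod_def unit_frame_def atLeast0LessThan if_distrib cong: if_cong)
  then show "(A * unit_frame n m) $$ (i, j) = mat k m (\<lambda>ij. A $$ ij) $$ (i, j)"
    using ij assms by simp
qed (use assms in \<open>auto simp: unit_frame_def\<close>)

lemma unit_frame_in_frames: "m \<le> n \<Longrightarrow> unit_frame n m \<in> frames n m"
proof -
  assume "m \<le> n"
  then have "adj (unit_frame n m) * unit_frame n m = mat m m (\<lambda>ij. adj (unit_frame n m) $$ ij)"
    by (intro mult_unit_frame) auto
  also have "\<dots> = 1\<^sub>m m" using \<open>m \<le> n\<close> by (intro eq_matI) (auto simp: unit_frame_def)
  finally show "unit_frame n m \<in> frames n m" by (simp add: frames_def)
qed

lemma unit_frame_Suc: "unit_frame (Suc n) (Suc m) = four_block_mat (1\<^sub>m 1) (0\<^sub>m 1 m) (0\<^sub>m n 1) (unit_frame n m)"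
  by (rule eq_matI) (auto simp: unit_frame_def)

text \<open>Polarization produces a vector of nonzero value, which is fixed by conjugation because
  the form is Hermitian. Surjectivity of the norm then rescales the value to 1.\<close>

lemma hermitian_ex_unit:
  assumes G: "G \<in> carrier_mat n n" "adj G = G" "G \<noteq> 0\<^sub>m n n"
  obtains x where "x \<in> carrier_mat n 1" "adj x * G * x = 1\<^sub>m 1"
proof -
  have Gs: "cj (G $$ (i, j)) = G $$ (j, i)" if "i < n" "j < n" for i j
    using adj_index[of j G i] G that by simp
  define f where "f = (\<lambda>x :: nat \<Rightarrow> 'a. \<Sum>k<n. \<Sum>l<n. cj (x k) * G $$ (k, l) * x l)"
  have f2: "f (\<lambda>k. (if k = i then a else 0) + (if k = j then b else 0)) =
      cj a * G $$ (i, i) * a + cj a * G $$ (i, j) * b + cj b * G $$ (j, i) * a + cj b * G $$ (j, j) * b"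
    if "i < n" "j < n" for i j a b
  proof -
    have "(\<Sum>l<n. cj ((if k = i then a else 0) + (if k = j then b else 0)) * G $$ (k, l)
        * ((if l = i then a else 0) + (if l = j then b else 0)))
      = ((if k = i then cj a else 0) + (if k = j then cj b else 0)) * (G $$ (k, i) * a + G $$ (k, j) * b)" for k
    proof -
      have "(\<Sum>l<n. cj ((if k = i then a else 0) + (if k = j then b else 0)) * G $$ (k, l)
        * ((if l = i then a else 0) + (if l = j then b else 0)))
        = cj ((if k = i then a else 0) + (if k = j then b else 0)) *
          ((\<Sum>l<n. if l = i then G $$ (k, i) * a else 0) + (\<Sum>l<n. if l = j then G $$ (k, j) * b else 0))"
        unfolding sum.distrib[symmetric] sum_distrib_left
        by (rule sum.cong) (auto simp: algebra_simps)
      then show ?thesis using that by (auto simp: cj.hom_add)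
    qed
    then have "f (\<lambda>k. (if k = i then a else 0) + (if k = j then b else 0)) =
      (\<Sum>k<n. ((if k = i then cj a else 0) + (if k = j then cj b else 0)) * (G $$ (k, i) * a + G $$ (k, j) * b))"
      unfolding f_def by (intro sum.cong refl)
    also have "\<dots> = (\<Sum>k<n. (if k = i then cj a * (G $$ (i, i) * a + G $$ (i, j) * b) else 0)
        + (if k = j then cj b * (G $$ (j, i) * a + G $$ (j, j) * b) else 0))"
      by (rule sum.cong) (auto simp: distrib_right)
    finally show ?thesis using that unfolding sum.distrib by (simp add: algebra_simps)
  qed
  have "\<exists>x. f x \<noteq> 0"
  proof (cases "\<exists>i<n. G $$ (i, i) \<noteq> 0")
    case True
    then obtain i where i: "i < n" "G $$ (i, i) \<noteq> 0" by blast
    then have "f (\<lambda>k. (if k = i then 1 else 0) + (if k = i then 0 else 0)) \<noteq> 0" using f2[of i i 1 0] by simp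
    then show ?thesis by blast
  next
    case False
    obtain i j where ij: "i < n" "j < n" "G $$ (i, j) \<noteq> 0" using G by (auto simp: mat_eq_iff)
    \<comment> \<open>With vanishing diagonal, the two cross terms at e_i + b e_j are conjugate to
      each other; this \<open>b\<close> makes each equal to 1, so the value is 2, nonzero in odd
      characteristic.\<close>
    define b where "b = 1 / G $$ (i, j)"
    have "cj b * G $$ (j, i) = cj (b * G $$ (i, j))" using Gs[OF ij(1,2)] by (simp add: cj.hom_mult)
    then have "cj b * G $$ (j, i) = 1" using ij by (simp add: b_def)
    then have "f (\<lambda>k. (if k = i then 1 else 0) + (if k = j then b else 0)) = 2"
      using f2[of i j 1 b] ij False by (simp add: b_def)
    then show ?thesis using two_neq_0 by metis
  qed
  then obtain x where x: "f x \<noteq> 0" by blast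
  have fx: "cj (f x) = f x"
    unfolding f_def cj.hom_sum by (subst sum.swap) (auto simp: cj.hom_mult Gs mult_ac intro!: sum.cong)
  then have "cj (1 / f x) = 1 / f x" using x by (simp add: divide_inverse cj.hom_inverse)
  then obtain c where c: "c * cj c = 1 / f x" by (rule norm_surj)
  define X where "X = mat n 1 (\<lambda>(k, _). c * x k)"
  have X: "X \<in> carrier_mat n 1" by (simp add: X_def)
  have "(adj X * G * X) $$ (0, 0) = (\<Sum>l<n. (\<Sum>k<n. cj (c * x k) * G $$ (k, l)) * (c * x l))"
    using X G by (simp add: scalar_prod_def atLeast0LessThan X_def adj_def)
  also have "\<dots> = (\<Sum>l<n. \<Sum>k<n. c * cj c * (cj (x k) * G $$ (k, l) * x l))"
    unfolding sum_distrib_right by (simp add: cj.hom_mult mult_ac)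
  also have "\<dots> = c * cj c * f x"
    unfolding f_def sum_distrib_left by (rule sum.swap)
  also have "\<dots> = 1" using c x by simp
  finally have "adj X * G * X = 1\<^sub>m 1" using X by (intro eq_matI) auto
  then show ?thesis using that X by blast
qed

lemma adj_congruence:
  assumes "G \<in> carrier_mat n n" "adj G = G" "P \<in> carrier_mat n m"
  shows "adj (adj P * G * P) = adj P * G * P"
proof -
  have "adj (adj P * G * P) = adj P * adj (adj P * G)" using assms by (intro adj_mult[of _ m n]) auto
  also have "adj (adj P * G) = G * P" using assms adj_mult[of "adj P" m n G n] by simp
  also have "adj P * (G * P) = adj P * G * P" using assms by (intro assoc_mult_mat[symmetric, of _ m n _ n]) auto
  finally show ?thesis .
qed

lemma congruence_mult:
  assumes "G \<in> carrier_mat n n" "P \<in> carrier_mat n m" "T \<in> carrier_mat m k"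
  shows "adj (P * T) * G * (P * T) = adj T * (adj P * G * P) * T"
proof -
  have "adj (P * T) * G * (P * T) = adj T * adj P * G * (P * T)" using adj_mult[OF assms(2,3)] by simp
  also have "adj T * adj P * G = adj T * (adj P * G)" using assms by (intro assoc_mult_mat[of _ k m _ n _ n]) auto
  also have "\<dots> * (P * T) = adj T * (adj P * G) * P * T"
    using assms by (intro assoc_mult_mat[symmetric, of _ k n _ m _ k]) auto
  also have "adj T * (adj P * G) * P = adj T * (adj P * G * P)"
    using assms by (intro assoc_mult_mat[of _ k m _ n _ m]) auto
  finally show ?thesis .
qed

text \<open>One orthogonalization step with prescribed first column. The induction hypothesis is an
  explicit premise because the lemma serves twice: in the induction diagonalizing a form, and
  afterwards, with \<open>G\<close> the identity, to complete a unit vector to a unitary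
  matrix.\<close>

lemma hermitian_extend:
  assumes IH: "\<And>G. G \<in> carrier_mat n n \<Longrightarrow> adj G = G \<Longrightarrow> det G \<noteq> 0 \<Longrightarrow> \<exists>K\<in>carrier_mat n n. adj K * G * K = 1\<^sub>m n"
    and G: "G \<in> carrier_mat (Suc n) (Suc n)" "adj G = G" "det G \<noteq> 0"
    and x: "x \<in> carrier_mat (Suc n) 1" "adj x * G * x = 1\<^sub>m 1"
  shows "\<exists>K\<in>carrier_mat (Suc n) (Suc n). adj K * G * K = 1\<^sub>m (Suc n) \<and> col K 0 = col x 0"
proof -
  have "x \<noteq> 0\<^sub>m (Suc n) 1"
  proof
    assume "x = 0\<^sub>m (Suc n) 1"
    then have "adj x * G * x = 0\<^sub>m 1 1" using G by (simp add: right_mult_zero_mat[of _ 1 "Suc n"])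
    moreover have "(1\<^sub>m 1 :: 'a mat) $$ (0, 0) \<noteq> 0\<^sub>m 1 1 $$ (0, 0)" by simp
    ultimately show False using x(2) by auto
  qed
  then obtain P where P: "P \<in> carrier_mat (Suc n) (Suc n)" "det P \<noteq> 0" "col P 0 = col x 0"
    using ex_invertible_first_col x(1) by blast
  define H where "H = adj P * G * P"
  have H: "H \<in> carrier_mat (Suc n) (Suc n)" "adj H = H"
    using P G adj_congruence[of G "Suc n" P] by (auto simp: H_def)
  have Hs: "cj (H $$ (i, j)) = H $$ (j, i)" if "i < Suc n" "j < Suc n" for i j
    using adj_index[of j H i] H that by simp
  have "H $$ (0, 0) = (adj x * G * x) $$ (0, 0)"
  proof -
    have Px: "P $$ (k, 0) = x $$ (k, 0)" if "k < Suc n" for k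
      using arg_cong[OF P(3), of "\<lambda>v. v $ k"] that P(1) x(1) by simp
    have "H $$ (0, 0) = (\<Sum>l<Suc n. (\<Sum>k<Suc n. cj (P $$ (k, 0)) * G $$ (k, l)) * P $$ (l, 0))"
      using P(1) G(1) by (simp add: H_def scalar_prod_def atLeast0LessThan del: sum.lessThan_Suc sum.op_ivl_Suc)
    also have "\<dots> = (\<Sum>l<Suc n. (\<Sum>k<Suc n. cj (x $$ (k, 0)) * G $$ (k, l)) * x $$ (l, 0))"
      by (intro sum.cong refl arg_cong2[where f = "(*)"]) (auto simp: Px)
    also have "\<dots> = (adj x * G * x) $$ (0, 0)"
      using x(1) G(1) by (simp add: scalar_prod_def atLeast0LessThan del: sum.lessThan_Suc sum.op_ivl_Suc)
    finally show ?thesis .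
  qed
  then have H00: "H $$ (0, 0) = 1" using x(2) by simp
  define b where "b = mat 1 n (\<lambda>(_, j). H $$ (0, Suc j))"
  define D where "D = mat n n (\<lambda>(i, j). H $$ (Suc i, Suc j))"
  have b: "b \<in> carrier_mat 1 n" and D: "D \<in> carrier_mat n n" by (auto simp: b_def D_def)
  have H_eq: "H = four_block_mat (1\<^sub>m 1) b (adj b) D"
    using H Hs H00 b by (intro eq_matI) (auto simp: b_def D_def less_Suc_eq_0_disj)
  have D_adj: "adj D = D" by (rule eq_matI) (auto simp: D_def Hs)
  \<comment> \<open>Block elimination of the first row and column; the remaining block
    \<open>D'\<close> is the Schur complement.\<close>
  define T where "T = four_block_mat (1\<^sub>m 1) (- b) (0\<^sub>m n 1) (1\<^sub>m n)"
  have T: "T \<in> carrier_mat (Suc n) (Suc n)" unfolding T_def by (rule four_block_carrier_Suc) auto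
  have adjT: "adj T = four_block_mat (1\<^sub>m 1) (0\<^sub>m 1 n) (- adj b) (1\<^sub>m n)"
    unfolding T_def using b by (subst adj_four_block[of _ 1 1 _ n _ n]) (auto simp: adj_uminus)
  define D' where "D' = D - adj b * b"
  have D': "D' \<in> carrier_mat n n" unfolding D'_def using b by (intro minus_carrier_mat mult_carrier_mat[of _ n 1]) auto
  have HT: "H * T = four_block_mat (1\<^sub>m 1) (0\<^sub>m 1 n) (adj b) D'"
  proof -
    have "H * T = four_block_mat (1\<^sub>m 1 * 1\<^sub>m 1 + b * 0\<^sub>m n 1) (1\<^sub>m 1 * (- b) + b * 1\<^sub>m n)
      (adj b * 1\<^sub>m 1 + D * 0\<^sub>m n 1) (adj b * (- b) + D * 1\<^sub>m n)"
      unfolding H_eq T_def using b D by (intro mult_four_block_mat[of _ 1 1 _ n _ n]) auto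
    also have "1\<^sub>m 1 * 1\<^sub>m 1 + b * 0\<^sub>m n 1 = 1\<^sub>m 1" using b by (simp add: right_mult_zero_mat[of _ 1 n])
    also have "1\<^sub>m 1 * (- b) + b * 1\<^sub>m n = 0\<^sub>m 1 n" using b by (auto intro!: eq_matI)
    also have "adj b * 1\<^sub>m 1 + D * 0\<^sub>m n 1 = adj b" using b D by (auto intro!: eq_matI)
    also have "adj b * (- b) + D * 1\<^sub>m n = D'"
      using b D by (auto simp: D'_def intro!: eq_matI)
    finally show ?thesis .
  qed
  have block: "adj T * H * T = four_block_mat (1\<^sub>m 1) (0\<^sub>m 1 n) (0\<^sub>m n 1) D'"
  proof -
    have "adj T * H * T = adj T * (H * T)" using T H by (intro assoc_mult_mat) auto
    also have "\<dots> = four_block_mat (1\<^sub>m 1 * 1\<^sub>m 1 + 0\<^sub>m 1 n * adj b) (1\<^sub>m 1 * 0\<^sub>m 1 n + 0\<^sub>m 1 n * D')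
      (- adj b * 1\<^sub>m 1 + 1\<^sub>m n * adj b) (- adj b * 0\<^sub>m 1 n + 1\<^sub>m n * D')"
      unfolding HT adjT using b D' by (intro mult_four_block_mat[of _ 1 1 _ n _ n]) auto
    also have "\<dots> = four_block_mat (1\<^sub>m 1) (0\<^sub>m 1 n) (0\<^sub>m n 1) D'"
      using b D' by (intro arg_cong4[where f = four_block_mat]) (auto intro!: eq_matI)
    finally show ?thesis .
  qed
  have detT: "det T = 1" unfolding T_def using b by (subst det_four_block_mat_lower_left_zero[of _ 1 _ n]) auto
  have "det H \<noteq> 0"
    unfolding H_def det_mult3[OF adj_carrier[OF P(1)] G(1) P(1)] using P G det_adj[OF P(1)] by simp
  then have "det (adj T * H * T) \<noteq> 0"
    unfolding det_mult3[OF adj_carrier[OF T] H(1) T] using detT det_adj[OF T] by simp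
  then have "det D' \<noteq> 0" unfolding block using D' by (simp add: det_four_block_mat_lower_left_zero[of _ 1 _ n])
  moreover have "adj D' = D'"
  proof -
    have bb: "adj b * b \<in> carrier_mat n n" using b by (intro mult_carrier_mat[of _ n 1]) auto
    have "adj (adj b * b) = adj b * b" using adj_mult[of "adj b" n 1 b n] b by simp
    then show ?thesis unfolding D'_def by (simp add: adj_minus[OF D bb] D_adj)
  qed
  ultimately obtain K' where K': "K' \<in> carrier_mat n n" "adj K' * D' * K' = 1\<^sub>m n" using IH D' by blast
  define L where "L = four_block_mat (1\<^sub>m 1) (0\<^sub>m 1 n) (0\<^sub>m n 1) K'"
  have L: "L \<in> carrier_mat (Suc n) (Suc n)" unfolding L_def using K' by (intro four_block_carrier_Suc) auto
  have adjL: "adj L = four_block_mat (1\<^sub>m 1) (0\<^sub>m 1 n) (0\<^sub>m n 1) (adj K')"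
    unfolding L_def using K' by (subst adj_four_block[of _ 1 1 _ n _ n]) auto
  have "adj L * (adj T * H * T) = four_block_mat (1\<^sub>m 1) (0\<^sub>m 1 n) (0\<^sub>m n 1) (adj K' * D')"
    unfolding block adjL using K' D' by (subst mult_four_block_mat[of _ 1 1 _ n _ n]) (auto intro!: eq_matI)
  then have "adj L * (adj T * H * T) * L = four_block_mat (1\<^sub>m 1) (0\<^sub>m 1 n) (0\<^sub>m n 1) (adj K' * D')
      * four_block_mat (1\<^sub>m 1) (0\<^sub>m 1 n) (0\<^sub>m n 1) K'"
    by (rule arg_cong2[where f = "(*)"]) (rule L_def)
  also have "\<dots> = four_block_mat (1\<^sub>m 1) (0\<^sub>m 1 n) (0\<^sub>m n 1) (adj K' * D' * K')"
    using K' D' by (subst mult_four_block_mat[of _ 1 1 _ n _ n]) (auto intro!: eq_matI)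
  finally have "adj L * (adj T * H * T) * L = 1\<^sub>m (Suc n)" unfolding K'(2) by (auto intro!: eq_matI)
  moreover define K where "K = P * T * L"
  have "adj K * G * K = adj L * (adj (P * T) * G * (P * T)) * L"
    unfolding K_def using P T L G by (intro congruence_mult) auto
  moreover have "adj (P * T) * G * (P * T) = adj T * H * T"
    unfolding H_def using P T G by (intro congruence_mult) auto
  ultimately have KG: "adj K * G * K = 1\<^sub>m (Suc n)" by simp
  have "col (P * T * L) 0 = (P * T) *\<^sub>v col L 0" using P T L by (intro col_mult2[of _ "Suc n" "Suc n" _ "Suc n"]) auto
  also have "col L 0 = unit_vec (Suc n) 0" unfolding L_def using K' by (auto simp: unit_vec_def)
  also have "P * T *\<^sub>v unit_vec (Suc n) 0 = P *\<^sub>v (T *\<^sub>v unit_vec (Suc n) 0)"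
    using P T by (intro assoc_mult_mat_vec) auto
  also have "T *\<^sub>v unit_vec (Suc n) 0 = col T 0" using T by (auto intro!: eq_vecI)
  also have "col T 0 = unit_vec (Suc n) 0" unfolding T_def using b by (auto simp: unit_vec_def)
  also have "P *\<^sub>v unit_vec (Suc n) 0 = col P 0" using P(1) by (auto intro!: eq_vecI)
  also have "col P 0 = col x 0" by (rule P(3))
  finally have "col K 0 = col x 0" unfolding K_def .
  then show ?thesis using KG P T L by (intro bexI[of _ K]) (auto simp: K_def)
qed

lemma hermitian_congruent_one:
  assumes "G \<in> carrier_mat n n" "adj G = G" "det G \<noteq> 0"
  shows "\<exists>K\<in>carrier_mat n n. adj K * G * K = 1\<^sub>m n"
  using assms
proof (induction n arbitrary: G)
  case 0
  then show ?case by (intro bexI[of _ "1\<^sub>m 0"]) (auto intro!: eq_matI)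
next
  case (Suc n)
  have "G \<noteq> 0\<^sub>m (Suc n) (Suc n)" using Suc.prems(3) by auto
  then obtain x where "x \<in> carrier_mat (Suc n) 1" "adj x * G * x = 1\<^sub>m 1"
    using hermitian_ex_unit[OF Suc.prems(1,2)] by blast
  from hermitian_extend[OF Suc.IH Suc.prems this] show ?case by blast
qed

section \<open>Orthonormal frames and the order of the unitary group\<close>

definition one_block :: "'a mat \<Rightarrow> 'a mat" where
  "one_block A = four_block_mat (1\<^sub>m 1) (0\<^sub>m 1 (dim_col A)) (0\<^sub>m (dim_row A) 1) A"

lemma one_block_carrier [simp]: "A \<in> carrier_mat n m \<Longrightarrow> one_block A \<in> carrier_mat (Suc n) (Suc m)"
  unfolding one_block_def by (intro four_block_carrier_Suc) auto

lemma one_block_mult: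
  assumes "A \<in> carrier_mat n m" "B \<in> carrier_mat m k"
  shows "one_block A * one_block B = one_block (A * B)"
  unfolding one_block_def using assms
  by (subst mult_four_block_mat[of _ 1 1 _ m _ n _ _ 1 _ k]) (auto intro!: eq_matI)

lemma one_block_one: "one_block (1\<^sub>m n) = 1\<^sub>m (Suc n)"
  unfolding one_block_def by (auto intro!: eq_matI)

lemma adj_one_block: "adj (one_block A) = one_block (adj A)"
  unfolding one_block_def by (rule eq_matI) auto

lemma unit_frame_one_block: "unit_frame (Suc n) (Suc m) = one_block (unit_frame n m)"
  unfolding one_block_def unit_frame_Suc by (simp add: unit_frame_def)

lemma one_block_inj: "A \<in> carrier_mat n m \<Longrightarrow> B \<in> carrier_mat n m \<Longrightarrow> one_block A = one_block B \<Longrightarrow> A = B"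
proof (rule eq_matI)
  assume c: "A \<in> carrier_mat n m" "B \<in> carrier_mat n m" and eq: "one_block A = one_block B"
  fix i j assume "i < dim_row B" "j < dim_col B"
  then have "one_block A $$ (Suc i, Suc j) = A $$ (i, j)" "one_block B $$ (Suc i, Suc j) = B $$ (i, j)"
    using c by (auto simp: one_block_def)
  then show "A $$ (i, j) = B $$ (i, j)" using eq by simp
qed auto

lemma one_blockI:
  assumes "A \<in> carrier_mat (Suc n) (Suc m)" "A $$ (0, 0) = 1"
    "\<And>j. j < m \<Longrightarrow> A $$ (0, Suc j) = 0" "\<And>i. i < n \<Longrightarrow> A $$ (Suc i, 0) = 0"
  obtains B where "B \<in> carrier_mat n m" "A = one_block B"
proof
  let ?B = "mat n m (\<lambda>(i, j). A $$ (Suc i, Suc j))"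
  show "?B \<in> carrier_mat n m" by simp
  show "A = one_block ?B"
  proof (rule eq_matI)
    fix i j assume "i < dim_row (one_block ?B)" "j < dim_col (one_block ?B)"
    then have "i < Suc n" "j < Suc m" by (auto simp: one_block_def)
    then show "A $$ (i, j) = one_block ?B $$ (i, j)"
      using assms by (cases i; cases j) (auto simp: one_block_def)
  qed (use assms in \<open>auto simp: one_block_def\<close>)
qed

text \<open>Witt's theorem for orthonormal tuples: complete the first column to a unitary matrix and
  move it to the first unit vector. Orthogonality then clears the first row, and the smaller frame
  is handled by induction, which also yields \<open>m \<le> n\<close>.\<close>

lemma frames_transitive:
  assumes "X \<in> frames n m"
  shows "m \<le> n \<and> (\<exists>U\<in>unitary n. U * X = unit_frame n m)"
  using assms
proof (induction m arbitrary: n X)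
  case 0
  then have X: "X \<in> carrier_mat n 0" by (simp add: frames_def)
  then have "1\<^sub>m n * X = unit_frame n 0" by (intro eq_matI) (auto simp: unit_frame_def)
  then show ?case by (intro conjI bexI[of _ "1\<^sub>m n"]) (auto simp: unitary_def)
next
  case (Suc m)
  then have X: "X \<in> carrier_mat n (Suc m)" and XX: "adj X * X = 1\<^sub>m (Suc m)" by (auto simp: frames_def)
  show ?case
  proof (cases n)
    case 0
    then have "(adj X * X) $$ (0, 0) = 0" using X by (simp add: scalar_prod_def)
    then show ?thesis unfolding XX by simp
  next
    case (Suc l)
    define x where "x = mat n 1 (\<lambda>ij. X $$ ij)"
    have x: "x \<in> carrier_mat (Suc l) 1" using Suc by (simp add: x_def)
    have "(adj x * x) $$ (0, 0) = (adj X * X) $$ (0, 0)" using X by (simp add: x_def scalar_prod_def)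
    then have xx: "adj x * x = 1\<^sub>m 1" unfolding XX using x by (intro eq_matI) auto
    then have "adj x * 1\<^sub>m (Suc l) * x = 1\<^sub>m 1" using x by simp
    \<comment> \<open>Used with the identity as Gram matrix, so \<open>K\<close> is unitary with
      first column \<open>x\<close>.\<close>
    then obtain K where K: "K \<in> carrier_mat (Suc l) (Suc l)" "adj K * 1\<^sub>m (Suc l) * K = 1\<^sub>m (Suc l)" "col K 0 = col x 0"
      using hermitian_extend[OF hermitian_congruent_one one_carrier_mat adj_one _ x] by auto
    then have Ku: "K \<in> unitary (Suc l)" by (simp add: unitary_def)
    define Y where "Y = adj K * X"
    have Yf: "Y \<in> frames n (Suc m)"
      unfolding Y_def using unitary_adj[OF Ku] Suc.prems Suc by (intro unitary_mult_frame) auto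
    then have Y: "Y \<in> carrier_mat (Suc l) (Suc m)" "adj Y * Y = 1\<^sub>m (Suc m)" using Suc by (auto simp: frames_def)
    have Y0: "Y $$ (i, 0) = (if i = 0 then 1 else 0)" if i: "i < Suc l" for i
    proof -
      have "Y $$ (i, 0) = row (adj K) i \<bullet> col X 0" using i K(1) X by (simp add: Y_def)
      also have "col X 0 = col x 0" using X by (auto simp: x_def)
      also have "\<dots> = col K 0" using K by simp
      also have "row (adj K) i \<bullet> col K 0 = (adj K * K) $$ (i, 0)" using i K(1) by simp
      also have "\<dots> = (if i = 0 then 1 else 0)" unfolding unitary_left[OF Ku] using i by simp
      finally show ?thesis .
    qed
    have "Y $$ (0, Suc j) = 0" if j: "j < m" for j
    proof -
      have "0 = (adj Y * Y) $$ (0, Suc j)" unfolding Y(2) using j by simp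
      also have "\<dots> = (\<Sum>k<Suc l. cj (Y $$ (k, 0)) * Y $$ (k, Suc j))"
        using Y(1) j by (simp add: scalar_prod_def atLeast0LessThan del: sum.lessThan_Suc sum.op_ivl_Suc)
      also have "\<dots> = (\<Sum>k<Suc l. if k = 0 then Y $$ (0, Suc j) else 0)"
        by (rule sum.cong) (auto simp: Y0)
      also have "\<dots> = Y $$ (0, Suc j)" by (simp del: sum.lessThan_Suc)
      finally show ?thesis ..
    qed
    then obtain Z where Z: "Z \<in> carrier_mat l m" "Y = one_block Z" using Y(1) Y0 by (auto elim: one_blockI)
    have "one_block (adj Z * Z) = one_block (1\<^sub>m m)"
      using Y(2) Z by (simp add: adj_one_block one_block_mult[of _ m l] one_block_one)
    then have "adj Z * Z = 1\<^sub>m m" by (rule one_block_inj[OF mult_carrier_mat[OF adj_carrier[OF Z(1)] Z(1)] one_carrier_mat])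
    then have "Z \<in> frames l m" using Z by (simp add: frames_def)
    from Suc.IH[OF this] obtain V where ml: "m \<le> l" and V: "V \<in> unitary l" "V * Z = unit_frame l m" by blast
    have Vc: "V \<in> carrier_mat l l" using V by (simp add: unitary_def)
    have V1: "one_block V \<in> unitary (Suc l)"
      using V Vc by (simp add: unitary_def adj_one_block one_block_mult[of _ l l] one_block_one)
    have "one_block V * (adj K * X) = unit_frame (Suc l) (Suc m)"
      unfolding Y_def[symmetric] Z(2) using V(2) one_block_mult[OF Vc Z(1)] by (simp add: unit_frame_one_block)
    moreover have "one_block V * (adj K * X) = one_block V * adj K * X"
      using Vc K(1) X Suc by (intro assoc_mult_mat[symmetric, of _ "Suc l" "Suc l" _ "Suc l"]) auto
    moreover have "one_block V * adj K \<in> unitary (Suc l)"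
      using unitary_mult_frame[OF V1, of "adj K" "Suc l"] unitary_adj[OF Ku] unfolding frames_square by blast
    ultimately show ?thesis using ml Suc by auto
  qed
qed

lemma frames_transitiveE:
  assumes "X \<in> frames n m"
  obtains U where "m \<le> n" "U \<in> unitary n" "U * X = unit_frame n m" "X = adj U * unit_frame n m"
proof -
  obtain U where U: "m \<le> n" "U \<in> unitary n" "U * X = unit_frame n m" using frames_transitive[OF assms] by blast
  moreover have "adj U * unit_frame n m = X"
    unfolding U(3)[symmetric] using U(2) assms by (intro unitary_cancel) (auto simp: frames_def)
  ultimately show ?thesis using that by blast
qed

lemma stabilizer_unit_frame:
  "bij_betw (\<lambda>V. four_block_mat (1\<^sub>m m) (0\<^sub>m m k) (0\<^sub>m k m) V) (unitary k)
    {U \<in> unitary (m + k). U * unit_frame (m + k) m = unit_frame (m + k) m}"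
proof -
  define F where "F = (\<lambda>V. four_block_mat (1\<^sub>m m) (0\<^sub>m m k) (0\<^sub>m k m) V :: 'a mat)"
  have Fc: "F V \<in> carrier_mat (m + k) (m + k)" if "V \<in> carrier_mat k k" for V
    using that unfolding F_def by (intro four_block_carrier_mat) auto
  have FF: "adj (F V) * F V = F (adj V * V)" if "V \<in> carrier_mat k k" for V
  proof -
    have "adj (F V) = F (adj V)"
      unfolding F_def using that by (subst adj_four_block[of _ m m _ k _ k]) auto
    also have "F (adj V) * F V = F (adj V * V)"
      unfolding F_def using that by (subst mult_four_block_mat[of _ m m _ k _ k]) (auto intro!: eq_matI)
    finally show ?thesis .
  qed
  have F1: "F (1\<^sub>m k) = 1\<^sub>m (m + k)" unfolding F_def by (auto intro!: eq_matI)
  have Finj: "V = W" if "V \<in> carrier_mat k k" "W \<in> carrier_mat k k" "F V = F W" for V W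
  proof (rule eq_matI)
    fix i j assume "i < dim_row W" "j < dim_col W"
    then have "F V $$ (m + i, m + j) = V $$ (i, j)" "F W $$ (m + i, m + j) = W $$ (i, j)"
      using that(1,2) by (auto simp: F_def)
    then show "V $$ (i, j) = W $$ (i, j)" using that(3) by simp
  qed (use that in auto)
  have "bij_betw F (unitary k) {U \<in> unitary (m + k). U * unit_frame (m + k) m = unit_frame (m + k) m}"
  proof (rule bij_betw_imageI)
    show "inj_on F (unitary k)" using Finj by (auto simp: inj_on_def unitary_def)
    show "F ` unitary k = {U \<in> unitary (m + k). U * unit_frame (m + k) m = unit_frame (m + k) m}"
    proof (intro equalityI subsetI)
      fix U assume "U \<in> F ` unitary k"
      then obtain V where V: "V \<in> unitary k" "U = F V" by blast
      have Vc: "V \<in> carrier_mat k k" using V by (simp add: unitary_def)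
      have "U \<in> unitary (m + k)" using V Vc FF F1 Fc by (simp add: unitary_def)
      moreover have "U * unit_frame (m + k) m = unit_frame (m + k) m"
        unfolding V(2) using Fc[OF Vc] Vc
        by (subst mult_unit_frame[of _ "m + k" "m + k"]) (auto simp: F_def unit_frame_def intro!: eq_matI)
      ultimately show "U \<in> {U \<in> unitary (m + k). U * unit_frame (m + k) m = unit_frame (m + k) m}" by blast
    next
      fix U assume "U \<in> {U \<in> unitary (m + k). U * unit_frame (m + k) m = unit_frame (m + k) m}"
      then have U: "U \<in> unitary (m + k)" and UE: "U * unit_frame (m + k) m = unit_frame (m + k) m" by auto
      have Uc: "U \<in> carrier_mat (m + k) (m + k)" using U by (simp add: unitary_def)
      have UE': "adj U * unit_frame (m + k) m = unit_frame (m + k) m"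
        using unitary_cancel(1)[OF U unit_frame_carrier[of "m + k" m]] unfolding UE .
      have col: "U $$ (i, j) = (if i = j then 1 else 0)" if "i < m + k" "j < m" for i j
        using UE mult_unit_frame[OF Uc, of m] that by (auto simp: unit_frame_def mat_eq_iff)
      \<comment> \<open>The inverse \<open>adj U\<close> fixes the same unit vectors, so the first
        rows of \<open>U\<close> are trivial as well as its first columns.\<close>
      have row: "U $$ (j, i) = (if i = j then 1 else 0)" if ij: "i < m + k" "j < m" for i j
      proof -
        have "cj (U $$ (j, i)) = (if i = j then 1 else 0)"
          using UE' mult_unit_frame[OF adj_carrier[OF Uc], of m] ij Uc by (auto simp: unit_frame_def mat_eq_iff)
        then have "cj (cj (U $$ (j, i))) = (if i = j then 1 else 0)" by (simp split: if_splits)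
        then show ?thesis by simp
      qed
      define V where "V = mat k k (\<lambda>(i, j). U $$ (m + i, m + j))"
      have UV: "U = F V"
        using Uc by (intro eq_matI) (auto simp: F_def V_def col row)
      have Vc: "V \<in> carrier_mat k k" by (simp add: V_def)
      have "F (adj V * V) = F (1\<^sub>m k)" using FF[OF Vc] F1 U UV by (simp add: unitary_def)
      then have "adj V * V = 1\<^sub>m k" by (rule Finj[OF mult_carrier_mat[OF adj_carrier[OF Vc] Vc] one_carrier_mat])
      then show "U \<in> F ` unitary k" using UV Vc by (auto simp: unitary_def)
    qed
  qed
  then show ?thesis by (simp add: F_def)
qed

text \<open>Orbit and stabilizer for the transitive action of \<open>unitary (m + k)\<close> on
  frames.\<close>

lemma card_unitary_frames: "card (unitary (m + k)) = card (frames (m + k) m) * card (unitary k)"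
proof (rule card_eq_fibres)
  let ?n = "m + k" and ?E = "unit_frame (m + k) m"
  show "(\<lambda>U. U * ?E) ` unitary ?n \<subseteq> frames ?n m"
    using unitary_mult_frame unit_frame_in_frames[of m ?n] by auto
  fix X assume "X \<in> frames ?n m"
  then obtain U where U: "U \<in> unitary ?n" "X = adj U * ?E" using frames_transitiveE by metis
  define V where "V = adj U"
  have V: "V \<in> unitary ?n" "X = V * ?E" using U unitary_adj by (auto simp: V_def)
  have Vc: "V \<in> carrier_mat ?n ?n" using V by (simp add: unitary_def)
  have "bij_betw (\<lambda>W. V * W) {W \<in> unitary ?n. W * ?E = ?E} {W \<in> unitary ?n. W * ?E = X}"
  proof (rule bij_betwI[where g = "\<lambda>W. adj V * W"])
    have ass: "A * B * ?E = A * (B * ?E)" if "A \<in> unitary ?n" "B \<in> unitary ?n" for A B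
      using that by (intro assoc_mult_mat[of _ ?n ?n _ ?n _ m]) (auto simp: unitary_def)
    have mult: "A * B \<in> unitary ?n" if "A \<in> unitary ?n" "B \<in> unitary ?n" for A B
      using unitary_mult_frame[OF that(1)] that(2) by (simp add: frames_square[symmetric])
    show "(\<lambda>W. V * W) \<in> {W \<in> unitary ?n. W * ?E = ?E} \<rightarrow> {W \<in> unitary ?n. W * ?E = X}"
      using V mult ass by auto
    show "(\<lambda>W. adj V * W) \<in> {W \<in> unitary ?n. W * ?E = X} \<rightarrow> {W \<in> unitary ?n. W * ?E = ?E}"
      using V mult ass unitary_adj unitary_cancel(1)[OF V(1) unit_frame_carrier[of ?n m]] by auto
  qed (use unitary_cancel[OF V(1)] unitary_carrier in blast)+
  then have "card {W \<in> unitary ?n. W * ?E = X} = card {W \<in> unitary ?n. W * ?E = ?E}"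
    by (rule bij_betw_same_card[symmetric])
  also have "\<dots> = card (unitary k)" using bij_betw_same_card[OF stabilizer_unit_frame] by simp
  finally show "card {W \<in> unitary ?n. W * ?E = X} = card (unitary k)" .
qed auto

text \<open>Right multiplication by \<open>K\<close> with \<open>adj K * G * K\<close> the identity
  turns factorizations of \<open>G\<close> into frames. This is the source of all fibre counts that
  do not depend on the Gram matrix.\<close>

lemma card_hermitian_factors:
  assumes G: "G \<in> carrier_mat m m" "adj G = G" "det G \<noteq> 0"
  shows "card {Y \<in> carrier_mat n m. adj Y * Y = G} = card (frames n m)"
proof -
  obtain K where K: "K \<in> carrier_mat m m" "adj K * G * K = 1\<^sub>m m" using hermitian_congruent_one[OF G] by blast
  have "det (adj K) * det G * det K = 1"
    using det_mult3[OF adj_carrier[OF K(1)] G(1) K(1)] unfolding K(2) by simp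
  then have "det K \<noteq> 0" by auto
  then obtain L where L: "L \<in> carrier_mat m m" "K * L = 1\<^sub>m m" "L * K = 1\<^sub>m m" using matrix_inverse[OF K(1)] by metis
  have "adj L * (adj K * G * K) * L = adj (K * L) * G * (K * L)"
    using congruence_mult[OF G(1) K(1) L(1)] by simp
  then have LL: "adj L * L = G" unfolding K(2) L(2) using G L by simp
  have one: "adj (Y * K) * (Y * K) = adj K * (adj Y * Y) * K" if "Y \<in> carrier_mat n m" for Y
    using congruence_mult[of "1\<^sub>m n" n Y m K m] that K by simp
  have two: "adj (Y * L) * (Y * L) = adj L * (adj Y * Y) * L" if "Y \<in> carrier_mat n m" for Y
    using congruence_mult[of "1\<^sub>m n" n Y m L m] that L by simp
  have "bij_betw (\<lambda>Y. Y * K) {Y \<in> carrier_mat n m. adj Y * Y = G} (frames n m)"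
  proof (rule bij_betwI[where g = "\<lambda>Y. Y * L"])
    show "(\<lambda>Y. Y * K) \<in> {Y \<in> carrier_mat n m. adj Y * Y = G} \<rightarrow> frames n m"
      using one K(2) mult_carrier_mat[OF _ K(1)] by (auto simp: frames_def)
    show "(\<lambda>Y. Y * L) \<in> frames n m \<rightarrow> {Y \<in> carrier_mat n m. adj Y * Y = G}"
    proof
      fix Y assume "Y \<in> frames n m"
      then have Y: "Y \<in> carrier_mat n m" "adj Y * Y = 1\<^sub>m m" by (auto simp: frames_def)
      have "adj (Y * L) * (Y * L) = G" unfolding two[OF Y(1)] Y(2) using L(1) LL by simp
      then show "Y * L \<in> {Y \<in> carrier_mat n m. adj Y * Y = G}"
        using mult_carrier_mat[OF Y(1) L(1)] by simp
    qed
    have "Y * K * L = Y" "Y * L * K = Y" if "Y \<in> carrier_mat n m" for Y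
      using that K L assoc_mult_mat[OF that K(1) L(1)] assoc_mult_mat[OF that L(1) K(1)] by auto
    then show "\<And>Y. Y \<in> {Y \<in> carrier_mat n m. adj Y * Y = G} \<Longrightarrow> Y * K * L = Y"
      "\<And>Y. Y \<in> frames n m \<Longrightarrow> Y * L * K = Y" by (auto simp: frames_def)
  qed
  then show ?thesis by (rule bij_betw_same_card)
qed

section \<open>Vectors of given Hermitian norm and the order of the unitary group\<close>

definition norm_count :: "nat \<Rightarrow> 'a \<Rightarrow> nat" where
  "norm_count n c = card {x \<in> carrier_vec n. (\<Sum>i<n. x $ i * cj (x $ i)) = c}"

lemma finite_carrier_vec [simp]: "finite (carrier_vec n :: 'c::finite vec set)"
proof -
  have "carrier_vec n \<subseteq> (\<lambda>A. col A 0) ` (carrier_mat n 1 :: 'c mat set)"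
  proof
    fix v :: "'c vec" assume "v \<in> carrier_vec n"
    then have "v = col (mat n 1 (\<lambda>(i, _). v $ i)) 0" by (intro eq_vecI) auto
    then show "v \<in> (\<lambda>A. col A 0) ` carrier_mat n 1" by (metis image_eqI mat_carrier)
  qed
  then show ?thesis by (rule finite_subset) auto
qed

lemma bij_betw_vCons: "bij_betw (\<lambda>(a, v). vCons a v) (UNIV \<times> carrier_vec n) (carrier_vec (Suc n))"
  by (rule bij_betwI[where g = "\<lambda>v. (v $ 0, vec_last v n)"])
    (auto simp: vec_last_def vCons_def intro!: eq_vecI split: nat.splits)

lemma norm_count_Suc: "norm_count (Suc n) c = (\<Sum>a\<in>UNIV. norm_count n (c - a * cj a))"
proof -
  define N where "N = (\<lambda>n (x :: 'a vec). \<Sum>i<n. x $ i * cj (x $ i))"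
  have nc: "norm_count n c = card {x \<in> carrier_vec n. N n x = c}" for n c
    by (simp only: norm_count_def N_def)
  have NS: "N (Suc n) (vCons a v) = a * cj a + N n v" for a v
    unfolding N_def by (subst sum.lessThan_Suc_shift) simp
  have "{x \<in> carrier_vec (Suc n). N (Suc n) x = c}
      = (\<lambda>(a, v). vCons a v) ` (SIGMA a:UNIV. {v \<in> carrier_vec n. N n v = c - a * cj a})"
  proof (intro equalityI subsetI)
    fix x assume x: "x \<in> {x \<in> carrier_vec (Suc n). N (Suc n) x = c}"
    then have "x \<in> (\<lambda>(a, v). vCons a v) ` (UNIV \<times> carrier_vec n)"
      using bij_betw_imp_surj_on[OF bij_betw_vCons] by blast
    then obtain a v where av: "x = vCons a v" "v \<in> carrier_vec n" by auto
    then have "N n v = c - a * cj a" using x NS by (auto simp: algebra_simps)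
    then show "x \<in> (\<lambda>(a, v). vCons a v) ` (SIGMA a:UNIV. {v \<in> carrier_vec n. N n v = c - a * cj a})"
      using av by force
  qed (auto simp: NS)
  moreover have "inj_on (\<lambda>(a, v). vCons a v) (SIGMA a:UNIV. {v \<in> carrier_vec n. N n v = c - a * cj a})"
    using bij_betw_imp_inj_on[OF bij_betw_vCons] by (rule inj_on_subset) auto
  ultimately show ?thesis
    unfolding nc by (simp add: card_image)
qed

text \<open>Scaling by an element of norm \<open>c\<close>; so only the counts for norm 0 and norm 1
  remain as unknowns.\<close>

lemma norm_count_scale:
  assumes c: "cj c = c" "c \<noteq> 0"
  shows "norm_count n c = norm_count n 1"
proof -
  obtain z where z: "z * cj z = c" using norm_surj c by blast
  have z0: "z \<noteq> 0" using z c by auto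
  have sum: "(\<Sum>i<n. (a \<cdot>\<^sub>v x) $ i * cj ((a \<cdot>\<^sub>v x) $ i)) = a * cj a * (\<Sum>i<n. x $ i * cj (x $ i))"
    if "x \<in> carrier_vec n" for a x
    unfolding sum_distrib_left using that by (intro sum.cong) (auto simp: cj.hom_mult)
  have "bij_betw (\<lambda>x. z \<cdot>\<^sub>v x) {x \<in> carrier_vec n. (\<Sum>i<n. x $ i * cj (x $ i)) = 1}
    {x \<in> carrier_vec n. (\<Sum>i<n. x $ i * cj (x $ i)) = c}"
  proof (rule bij_betwI[where g = "\<lambda>x. inverse z \<cdot>\<^sub>v x"])
    have "inverse z * cj (inverse z) * c = 1"
      unfolding z[symmetric] cj.hom_inverse using z0 cj.hom_0_iff[of z] by (simp add: field_simps)
    then show "(\<lambda>x. inverse z \<cdot>\<^sub>v x) \<in> {x \<in> carrier_vec n. (\<Sum>i<n. x $ i * cj (x $ i)) = c}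
      \<rightarrow> {x \<in> carrier_vec n. (\<Sum>i<n. x $ i * cj (x $ i)) = 1}"
      using sum by auto
  qed (use sum z z0 in \<open>auto simp: smult_smult_assoc\<close>)
  then show ?thesis unfolding norm_count_def by (rule bij_betw_same_card[symmetric])
qed

lemma card_vec: "card (carrier_vec n :: 'a vec set) = q ^ (2 * n)"
proof (induction n)
  case (Suc n)
  have "card (carrier_vec (Suc n) :: 'a vec set) = card (UNIV \<times> carrier_vec n :: ('a \<times> 'a vec) set)"
    using bij_betw_same_card[OF bij_betw_vCons[where ?'c = 'a]] by metis
  also have "\<dots> = q ^ (2 * Suc n)"
    by (simp add: card_cartesian_product Suc CARD_a flip: power_add)
  finally show ?case .
next
  case 0
  have "carrier_vec 0 = {vNil :: 'a vec}" by auto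
  then show ?case by simp
qed

lemma norm_fixed: "cj (\<Sum>i<n. x i * cj (x i)) = (\<Sum>i<n. x i * cj (x i))"
  by (simp add: cj.hom_sum cj.hom_mult mult.commute)

lemma norm_count_total: "q ^ (2 * n) = norm_count n 0 + (q - 1) * norm_count n 1"
proof -
  define F where "F = {c. cj c = c}"
  have "q ^ (2 * n) = card (carrier_vec n :: 'a vec set)" by (simp add: card_vec)
  also have "carrier_vec n = (\<Union>c\<in>F. {x \<in> carrier_vec n. (\<Sum>i<n. x $ i * cj (x $ i)) = c})"
    using norm_fixed by (auto simp: F_def)
  also have "card \<dots> = (\<Sum>c\<in>F. norm_count n c)"
    unfolding norm_count_def by (intro card_UN_disjoint) auto
  also have "\<dots> = norm_count n 0 + (\<Sum>c\<in>F - {0}. norm_count n c)"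
    by (rule sum.remove) (auto simp: F_def)
  also have "(\<Sum>c\<in>F - {0}. norm_count n c) = (\<Sum>c\<in>F - {0}. norm_count n 1)"
    by (intro sum.cong refl norm_count_scale) (auto simp: F_def)
  also have "\<dots> = (q - 1) * norm_count n 1"
    by (simp add: card_Diff_singleton F_def card_fixed)
  finally show ?thesis .
qed

lemma norm_count_1: "real (norm_count (Suc n) 1) = real q ^ n * (real q ^ Suc n - (-1) ^ Suc n)"
proof -
  \<comment> \<open>Splitting off one coordinate expresses the new count by the counts for norms 1
    and 0; \<open>norm_count_total\<close> eliminates the latter, since (q^2 - q - 1) - (q + 1)(q -
    1) = -q.\<close>
  have rec: "real (norm_count (Suc n) 1) = (q + 1) * real q ^ (2 * n) - q * real (norm_count n 1)" for n
  proof -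
    define A where "A = {a. a * cj a = 1}"
    have cA: "card A = q + 1" using card_norm_fibre[of 1] by (simp add: A_def)
    have cA': "card (UNIV - A) = q\<^sup>2 - (q + 1)" by (simp add: card_Diff_subset cA CARD_a)
    have le: "q + 1 \<le> q\<^sup>2" using cA CARD_a card_mono[of UNIV A] by simp
    have "norm_count (Suc n) 1 = (\<Sum>a\<in>UNIV. norm_count n (1 - a * cj a))" by (rule norm_count_Suc)
    also have "\<dots> = (\<Sum>a\<in>UNIV - A. norm_count n (1 - a * cj a)) + (\<Sum>a\<in>A. norm_count n (1 - a * cj a))"
      by (rule sum.subset_diff) auto
    also have "(\<Sum>a\<in>A. norm_count n (1 - a * cj a)) = (\<Sum>a\<in>A. norm_count n 0)"
      by (rule sum.cong) (auto simp: A_def)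
    also have "(\<Sum>a\<in>UNIV - A. norm_count n (1 - a * cj a)) = (\<Sum>a\<in>UNIV - A. norm_count n 1)"
      by (intro sum.cong refl norm_count_scale) (auto simp: A_def cj.hom_minus cj.hom_mult mult.commute)
    finally have "norm_count (Suc n) 1 = (q\<^sup>2 - (q + 1)) * norm_count n 1 + (q + 1) * norm_count n 0"
      by (simp add: cA cA')
    then have 1: "real (norm_count (Suc n) 1) = (real q ^ 2 - (q + 1)) * norm_count n 1 + (q + 1) * norm_count n 0"
      using le by (simp add: of_nat_diff)
    have 2: "real q ^ (2 * n) = norm_count n 0 + (real q - 1) * norm_count n 1"
      using arg_cong[OF norm_count_total[of n], of real] q_ge_3 by (simp add: of_nat_diff)
    show ?thesis unfolding 1 2 by (simp add: algebra_simps power2_eq_square)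
  qed
  show ?thesis
  proof (induction n)
    case 0
    have "norm_count 0 1 = 0" by (simp add: norm_count_def)
    then show ?case using rec[of 0] by simp
  next
    case (Suc n)
    have e: "real q ^ (2 * Suc n) = real q ^ Suc n * real q ^ Suc n" by (simp only: mult_2 power_add)
    show ?case unfolding rec[of "Suc n"] Suc e by (simp add: algebra_simps)
  qed
qed

lemma card_frames_1: "card (frames n 1) = norm_count n 1"
proof -
  have "bij_betw (\<lambda>v. mat n 1 (\<lambda>(i, _). v $ i)) {x \<in> carrier_vec n. (\<Sum>i<n. x $ i * cj (x $ i)) = 1} (frames n 1)"
  proof (rule bij_betwI[where g = "\<lambda>A. col A 0"])
    show "(\<lambda>v. mat n 1 (\<lambda>(i, _). v $ i)) \<in> {x \<in> carrier_vec n. (\<Sum>i<n. x $ i * cj (x $ i)) = 1} \<rightarrow> frames n 1"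
      by (auto simp: frames_def scalar_prod_def atLeast0LessThan mult.commute adj_def intro!: eq_matI)
    show "(\<lambda>A. col A 0) \<in> frames n 1 \<rightarrow> {x \<in> carrier_vec n. (\<Sum>i<n. x $ i * cj (x $ i)) = 1}"
    proof
      fix A assume A: "A \<in> frames n 1"
      then have "(\<Sum>i<n. col A 0 $ i * cj (col A 0 $ i)) = (adj A * A) $$ (0, 0)"
        using frames_carrier[OF A] by (simp add: scalar_prod_def atLeast0LessThan mult.commute)
      also have "\<dots> = 1" using A by (simp add: frames_def)
      finally show "col A 0 \<in> {x \<in> carrier_vec n. (\<Sum>i<n. x $ i * cj (x $ i)) = 1}"
        using A by (auto simp: frames_def)
    qed
  qed (auto simp: frames_def intro!: eq_matI)
  then show ?thesis unfolding norm_count_def by (rule bij_betw_same_card[symmetric])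
qed

text \<open>A unitary matrix is a unit first column together with an element of the stabilizer, a
  unitary group of dimension one less. The exponents add up through n + (n + 1) + n^2 = (n +
  1)^2.\<close>

lemma card_unitary: "real (card (unitary n)) = real q ^ (n\<^sup>2) * phi_U n (real q)"
proof (induction n)
  case 0
  have "unitary 0 = {1\<^sub>m 0}" by (auto simp: unitary_def intro!: eq_matI)
  then show ?case by (simp add: phi_U_def)
next
  case (Suc n)
  have q0: "real q \<noteq> 0" using q_ge_3 by simp
  have "card (unitary (Suc n)) = norm_count (Suc n) 1 * card (unitary n)"
    using card_unitary_frames[of 1 n] by (simp add: card_frames_1[unfolded One_nat_def])
  then have "real (card (unitary (Suc n)))
      = real q ^ n * (real q ^ Suc n - (-1) ^ Suc n) * (real q ^ (n\<^sup>2) * phi_U n (real q))"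
    by (simp add: norm_count_1 Suc)
  also have "real q ^ Suc n - (-1) ^ Suc n = real q ^ Suc n * (1 - (-1) ^ Suc n * real q powi (- int (Suc n)))"
  proof -
    have "real q powi (- int (Suc n)) = inverse (real q ^ Suc n)" by (simp only: power_int_minus power_int_of_nat)
    then show ?thesis using q0 by (simp add: field_simps)
  qed
  also have "real q ^ n * (real q ^ Suc n * (1 - (-1) ^ Suc n * real q powi (- int (Suc n)))) * (real q ^ (n\<^sup>2) * phi_U n (real q))
    = real q ^ (n + Suc n + n\<^sup>2) * ((1 - (-1) ^ Suc n * real q powi (- int (Suc n))) * phi_U n (real q))"
    unfolding power_add by (simp only: mult_ac)
  also have "n + Suc n + n\<^sup>2 = (Suc n)\<^sup>2" by (simp add: power2_eq_square)
  also have "(1 - (-1) ^ Suc n * real q powi (- int (Suc n))) * phi_U n (real q) = phi_U (Suc n) (real q)"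
    unfolding phi_U_def by simp
  finally show ?case .
qed

section \<open>Hermitian matrices with given characteristic polynomial\<close>

definition hermitian :: "nat \<Rightarrow> 'a mat set" where
  "hermitian n = {A \<in> carrier_mat n n. adj A = A}"

lemma finite_hermitian [simp]: "finite (hermitian n)"
  by (rule finite_subset[OF _ finite_carrier_mat[of n n]]) (auto simp: hermitian_def)

lemma char_poly_adj: "A \<in> carrier_mat n n \<Longrightarrow> char_poly (adj A) = cjp (char_poly A)"
  unfolding adj_def by (simp add: char_poly_transpose_mat[of _ n] cj.char_poly_hom[of _ n])

lemma char_poly_hermitian:
  assumes "A \<in> hermitian n"
  obtains h where "h \<in> monics n" "char_poly A = emb h"
proof -
  have A: "A \<in> carrier_mat n n" "adj A = A" using assms by (auto simp: hermitian_def)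
  have "cjp (char_poly A) = char_poly A" using char_poly_adj[OF A(1)] A(2) by simp
  then obtain h where h: "char_poly A = emb h" by (rule cjp_fixed_imp_emb)
  have "degree h = n" using degree_char_poly[OF A(1)] unfolding h by simp
  moreover have "\<iota> (lead_coeff h) = \<iota> 1" using lead_coeff_char_poly[OF A(1)] unfolding h by simp
  then have "lead_coeff h = 1" using inj_f by (meson injD)
  ultimately have "h \<in> monics n" by (simp add: monics_def)
  then show ?thesis using h by (rule that)
qed

lemma adj_mat_poly:
  assumes A: "A \<in> carrier_mat n n" "adj A = A"
  shows "adj (mat_poly A p) = mat_poly A (cjp p)"
proof (induction p)
  case 0
  show ?case using A by (simp add: mat_poly_0[OF A(1)])
next
  case (pCons a p)
  have "adj (A * mat_poly A p) = A * mat_poly A (cjp p)"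
    using adj_mult[OF A(1) mat_poly_carrier[OF A(1)], of p] A(2) pCons mat_poly_commute_self[OF A(1)] by simp
  moreover have "A * mat_poly A p \<in> carrier_mat n n" using A(1) mat_poly_carrier[OF A(1)] by (rule mult_carrier_mat)
  ultimately show ?case
    by (simp add: mat_poly_pCons[OF A(1)] adj_add[of _ n n] adj_smult cj.map_poly_pCons_hom)
qed

text \<open>By the Hankel symmetrizer the companion matrix is self-adjoint for a nonsingular
  Hermitian form. Changing to an orthonormal basis of that form makes it Hermitian in the standard
  sense.\<close>

lemma ex_hermitian_char_poly:
  assumes h: "h \<in> monics n" "n > 0"
  obtains A where "A \<in> hermitian n" "char_poly A = emb h"
proof -
  have deg: "degree (emb h) = n" "lead_coeff (emb h) = 1" using h by (auto simp: monics_def)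
  define S where "S = mat n n (\<lambda>(i, j). coeff (emb h) (i + j + 1))"
  define C where "C = companion_mat (emb h)"
  have C: "C \<in> carrier_mat n n" using companion_carrier[of "emb h"] unfolding C_def deg .
  have S: "S \<in> carrier_mat n n" by (simp add: S_def)
  have "map_mat cj C = C"
  proof (rule eq_matI)
    fix i j assume "i < dim_row C" "j < dim_col C"
    moreover have "monom 1 (Suc j) mod emb h = emb (monom 1 (Suc j) mod h)" by (simp add: map_poly_mod)
    ultimately show "map_mat cj C $$ (i, j) = C $$ (i, j)" by (simp add: C_def companion_mat_def)
  qed auto
  then have adjC: "adj C = transpose_mat C" by (simp add: adj_def)
  have CS: "C * S = S * adj C" and detS: "det S \<noteq> 0"
    unfolding adjC unfolding C_def S_def using companion_symmetrizer[OF deg(2)] unfolding deg(1) by blast+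
  have "adj S = S" by (rule eq_matI) (auto simp: S_def add.commute)
  then obtain K where K: "K \<in> carrier_mat n n" "adj K * S * K = 1\<^sub>m n"
    using hermitian_congruent_one[OF S _ detS] by blast
  have "det (adj K) * det S * det K = 1"
    using det_mult3[OF adj_carrier[OF K(1)] S K(1)] unfolding K(2) by simp
  then have "det K \<noteq> 0" by auto
  then obtain L where L: "L \<in> carrier_mat n n" "K * L = 1\<^sub>m n" "L * K = 1\<^sub>m n" using matrix_inverse[OF K(1)] by metis
  note ac = assoc_mult_mat[of _ n n _ n _ n]
  have aL: "adj L * adj K = 1\<^sub>m n" "adj K * adj L = 1\<^sub>m n"
    by (rule adj_mult[OF K(1) L(1), unfolded L(2) adj_one, symmetric],
      rule adj_mult[OF L(1) K(1), unfolded L(3) adj_one, symmetric])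
  have SK: "S * K = adj L"
  proof -
    have "adj L * (adj K * S * K) = adj L * adj K * (S * K)" using K(1) L(1) S by (simp add: ac)
    then show ?thesis unfolding K(2) aL using L(1) K(1) S by simp
  qed
  \<comment> \<open>Since \<open>adj L\<close> inverts \<open>adj K\<close>, this is a conjugate of
    \<open>C\<close>; since it also equals \<open>S * K\<close>, the same matrix is a congruence
    transform of the Hermitian matrix \<open>S * adj C\<close>.\<close>
  define A where "A = adj K * C * adj L"
  have A: "A \<in> carrier_mat n n" unfolding A_def using K(1) C L(1) by (intro mult_carrier_mat[of _ n n]) auto
  have "A = adj K * (C * S) * K" unfolding A_def SK[symmetric] using K(1) C S by (simp add: ac)
  then have A1: "A = adj K * (S * adj C) * K" unfolding CS .
  have "adj (C * S) = S * adj C" using adj_mult[OF C S] \<open>adj S = S\<close> by simp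
  then have "adj (S * adj C) = S * adj C" using CS by simp
  moreover have "S * adj C \<in> carrier_mat n n" using S C by simp
  ultimately have "adj A = A" unfolding A1 using K(1) by (intro adj_congruence)
  moreover have "similar_mat A C"
  proof (rule similar_matI[of A C "adj K" "adj L" n])
    show "{A, C, adj K, adj L} \<subseteq> carrier_mat n n" using A C K(1) L(1) by auto
  qed (use aL A_def in auto)
  then have "char_poly A = char_poly C" by (rule char_poly_similar)
  then have "char_poly A = emb h" using char_poly_companion[of "emb h"] deg h(2) by (simp add: C_def)
  ultimately show ?thesis using that A by (auto simp: hermitian_def)
qed

text \<open>Double count of the pairs (K, B) with B = K A K^-1 Hermitian. Over a fixed
  \<open>B\<close> the matrices \<open>K\<close> form a coset of the centralizer of
  \<open>A\<close>; over a fixed \<open>K\<close> there is at most one \<open>B\<close>.\<close>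

theorem card_hermitian_char_poly:
  assumes h: "h \<in> monics n" "squarefree h" "n > 0"
  shows "card {A \<in> hermitian n. char_poly A = emb h} * poly_totient (emb h)
    = card (unitary n) * poly_totient h"
proof -
  obtain A where A: "A \<in> hermitian n" "char_poly A = emb h" using ex_hermitian_char_poly h by metis
  have Ac: "A \<in> carrier_mat n n" and Aa: "adj A = A" using A by (auto simp: hermitian_def)
  have sf: "squarefree (emb h)" using h(2) by (simp add: squarefree_emb_iff)
  have deg: "degree h = n" "degree (emb h) = n" using h(1) by (auto simp: monics_def)
  obtain v where v: "cyclic_vec A v" using squarefree_imp_cyclic[OF Ac] A(2) sf by metis
  note ac = assoc_mult_mat[of _ n n _ n _ n]
  define GL where "GL = {K \<in> carrier_mat n n. det K \<noteq> (0::'a)}"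
  have finGL: "finite GL" by (rule finite_subset[OF _ finite_carrier_mat[of n n]]) (auto simp: GL_def)
  define M where "M = {B \<in> hermitian n. char_poly B = emb h}"
  define Q where "Q = {(K, B). K \<in> GL \<and> B \<in> hermitian n \<and> B * K = K * A}"
  have finM: "finite M" unfolding M_def by simp
  have "Q \<subseteq> GL \<times> hermitian n" by (auto simp: Q_def)
  then have finQ: "finite Q" by (rule finite_subset) (use finGL in simp)
  \<comment> \<open>The centralizer of the cyclic matrix \<open>A\<close> is the unit group of the
    residue ring over the large field.\<close>
  have units: "bij_betw (mat_poly A) {p \<in> polys_lt n. coprime p (emb h)} {X \<in> GL. X * A = A * X}"
  proof (rule bij_betw_imageI)
    show "inj_on (mat_poly A) {p \<in> polys_lt n. coprime p (emb h)}"
      using cyclic_mat_poly_inj[OF Ac v] by (auto simp: inj_on_def)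
    show "mat_poly A ` {p \<in> polys_lt n. coprime p (emb h)} = {X \<in> GL. X * A = A * X}"
    proof (intro equalityI subsetI)
      fix X assume "X \<in> mat_poly A ` {p \<in> polys_lt n. coprime p (emb h)}"
      then show "X \<in> {X \<in> GL. X * A = A * X}"
        using cyclic_mat_poly_invertible_iff[OF Ac v] A(2) mat_poly_commute_self[OF Ac] mat_poly_carrier[OF Ac]
        by (auto simp: GL_def)
    next
      fix X assume X: "X \<in> {X \<in> GL. X * A = A * X}"
      then obtain p where "p \<in> polys_lt n" "X = mat_poly A p"
        using cyclic_commutant[OF Ac v, of X] by (auto simp: GL_def)
      then show "X \<in> mat_poly A ` {p \<in> polys_lt n. coprime p (emb h)}"
        using X cyclic_mat_poly_invertible_iff[OF Ac v, of p] A(2) by (auto simp: GL_def)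
    qed
  qed
  have "card Q = card M * poly_totient (emb h)"
  proof (rule card_eq_fibres[of Q M snd])
    show "snd ` Q \<subseteq> M"
    proof
      fix B assume "B \<in> snd ` Q"
      then obtain K where K: "K \<in> GL" "B \<in> hermitian n" "B * K = K * A" by (auto simp: Q_def)
      then have Kc: "K \<in> carrier_mat n n" and Bc: "B \<in> carrier_mat n n" by (auto simp: GL_def hermitian_def)
      obtain L where L: "L \<in> carrier_mat n n" "K * L = 1\<^sub>m n" "L * K = 1\<^sub>m n"
        using matrix_inverse[OF Kc] K(1) by (auto simp: GL_def)
      have "K * A * L = B * (K * L)" unfolding K(3)[symmetric] using Kc Bc L by (simp add: ac)
      then have "B = K * A * L" using Bc L by simp
      then have "similar_mat B A"
        using L Kc Bc Ac by (intro similar_matI[of B A K L n]) auto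
      then have "char_poly B = char_poly A" by (rule char_poly_similar)
      then show "B \<in> M" using K A by (simp add: M_def)
    qed
    fix B assume B: "B \<in> M"
    then have Bc: "B \<in> carrier_mat n n" by (auto simp: M_def hermitian_def)
    obtain w where w: "cyclic_vec B w" using squarefree_imp_cyclic[OF Bc] B sf by (auto simp: M_def)
    obtain K where K: "K \<in> carrier_mat n n" "det K \<noteq> 0" "B * K = K * A"
      using cyclic_similar[OF Bc w Ac v] B A by (auto simp: M_def)
    obtain L where L: "L \<in> carrier_mat n n" "K * L = 1\<^sub>m n" "L * K = 1\<^sub>m n" "det L \<noteq> 0"
      using matrix_inverse[OF K(1,2)] by metis
    have LB: "L * B = A * L"
    proof -
      have "L * B = L * (B * K) * L" using L(1,2) Bc K(1) by (simp add: ac)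
      also have "\<dots> = (L * K) * A * L" unfolding K(3) using L(1) K(1) Ac by (simp add: ac)
      finally show ?thesis using L(3) Ac by simp
    qed
    have cancel: "K * (L * X) = X" "L * (K * X) = X" if "X \<in> carrier_mat n n" for X
      using that K(1) L assoc_mult_mat[OF K(1) L(1) that] assoc_mult_mat[OF L(1) K(1) that] by auto
    have bij: "bij_betw (\<lambda>X. (K * X, B)) {X \<in> GL. X * A = A * X} {z \<in> Q. snd z = B}"
    proof (rule bij_betwI[where g = "\<lambda>z. L * fst z"])
      show "(\<lambda>X. (K * X, B)) \<in> {X \<in> GL. X * A = A * X} \<rightarrow> {z \<in> Q. snd z = B}"
      proof
        fix X assume "X \<in> {X \<in> GL. X * A = A * X}"
        then have X: "X \<in> carrier_mat n n" "det X \<noteq> 0" "X * A = A * X" by (auto simp: GL_def)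
        have "B * (K * X) = K * A * X" unfolding K(3)[symmetric] using Bc K(1) X by (simp add: ac)
        also have "\<dots> = K * X * A" using K(1) X Ac by (simp add: ac)
        finally show "(K * X, B) \<in> {z \<in> Q. snd z = B}"
          using B K(1,2) X det_mult[OF K(1) X(1)] by (auto simp: Q_def GL_def M_def)
      qed
      show "(\<lambda>z. L * fst z) \<in> {z \<in> Q. snd z = B} \<rightarrow> {X \<in> GL. X * A = A * X}"
      proof
        fix z assume "z \<in> {z \<in> Q. snd z = B}"
        then obtain Y where z: "z = (Y, B)" and Y: "Y \<in> carrier_mat n n" "det Y \<noteq> 0" "B * Y = Y * A"
          by (auto simp: Q_def GL_def)
        have "L * Y * A = L * (B * Y)" unfolding Y(3) using L(1) Y(1) Ac by (simp add: ac)
        also have "\<dots> = L * B * Y" using L(1) Y(1) Bc by (simp add: ac)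
        also have "\<dots> = A * (L * Y)" unfolding LB using L(1) Y(1) Ac by (simp add: ac)
        finally show "L * fst z \<in> {X \<in> GL. X * A = A * X}"
          using z L(1,4) Y det_mult[OF L(1) Y(1)] by (auto simp: GL_def)
      qed
    qed (use cancel in \<open>auto simp: GL_def Q_def\<close>)
    have "card {z \<in> Q. snd z = B} = card {p \<in> polys_lt n. coprime p (emb h)}"
      using bij_betw_same_card[OF bij] bij_betw_same_card[OF units] by simp
    then show "card {z \<in> Q. snd z = B} = poly_totient (emb h)" by (simp add: poly_totient_def deg)
  qed (use finQ finM in auto)
  moreover have "card Q = poly_totient h * card (unitary n)"
  proof -
    \<comment> \<open>For given \<open>K\<close> the only candidate is K A K^-1, which is Hermitian
      exactly when \<open>adj K * K\<close> commutes with \<open>A\<close>. Each admissible value of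
      \<open>adj K * K\<close> is taken by as many \<open>K\<close> as there are unitary
      matrices.\<close>
    define KK where "KK = {K \<in> GL. (adj K * K) * A = A * (adj K * K)}"
    define GG where "GG = {G \<in> GL. adj G = G \<and> G * A = A * G}"
    have fin: "finite KK" "finite GG" using finGL by (auto simp: KK_def GG_def)
    have "bij_betw fst Q KK"
    proof (rule bij_betw_imageI)
      have uniq: "B = B'" if "(K, B) \<in> Q" "(K, B') \<in> Q" for K B B'
      proof -
        have K: "K \<in> carrier_mat n n" "det K \<noteq> 0" and B: "B \<in> carrier_mat n n" "B' \<in> carrier_mat n n"
          and eq: "B * K = B' * K" using that by (auto simp: Q_def GL_def hermitian_def)
        obtain L where L: "L \<in> carrier_mat n n" "K * L = 1\<^sub>m n" using matrix_inverse[OF K] by metis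
        have "B * K * L = B' * K * L" using eq by simp
        then show ?thesis using K(1) L B by (simp add: ac)
      qed
      show "inj_on fst Q" using uniq by (auto simp: inj_on_def)
      show "fst ` Q = KK"
      proof (intro equalityI subsetI)
        fix K assume "K \<in> fst ` Q"
        then obtain B where K: "K \<in> GL" and B: "B \<in> carrier_mat n n" "adj B = B" "B * K = K * A"
          by (auto simp: Q_def hermitian_def)
        have Kc: "K \<in> carrier_mat n n" using K by (simp add: GL_def)
        have KB: "adj K * B = A * adj K"
          using arg_cong[OF B(3), of adj] adj_mult[OF B(1) Kc] adj_mult[OF Kc Ac] B(2) Aa by simp
        have "adj K * K * A = adj K * (B * K)" unfolding B(3) using Kc Ac by (simp add: ac)
        also have "\<dots> = adj K * B * K" using Kc B(1) by (simp add: ac)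
        also have "\<dots> = A * (adj K * K)" unfolding KB using Kc Ac by (simp add: ac)
        finally show "K \<in> KK" using K by (simp add: KK_def)
      next
        fix K assume "K \<in> KK"
        then have K: "K \<in> GL" "adj K * K * A = A * (adj K * K)" and Kc: "K \<in> carrier_mat n n" "det K \<noteq> 0"
          by (auto simp: KK_def GL_def)
        obtain L where L: "L \<in> carrier_mat n n" "K * L = 1\<^sub>m n" "L * K = 1\<^sub>m n" using matrix_inverse[OF Kc] by metis
        have aL: "adj L * adj K = 1\<^sub>m n" using adj_mult[OF Kc(1) L(1)] L by simp
        define B where "B = K * A * L"
        have Bc: "B \<in> carrier_mat n n" using Kc(1) Ac L(1) by (simp add: B_def)
        have "adj K * K * A * L = A * adj K * (K * L)"
          unfolding K(2) using Kc(1) Ac L(1) mult_carrier_mat[OF adj_carrier[OF Kc(1)] Kc(1)] by (simp add: ac)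
        then have 1: "adj K * K * A * L = A * adj K" using L(2) Ac Kc(1) by simp
        have "B = adj L * adj K * B" unfolding aL using Bc by simp
        also have "\<dots> = adj L * (adj K * K * A * L)" unfolding B_def using Kc(1) Ac L(1) by (simp add: ac)
        also have "\<dots> = adj L * A * adj K" unfolding 1 using Kc(1) Ac L(1) by (simp add: ac)
        also have "\<dots> = adj B"
          unfolding B_def using Kc(1) Ac L(1) adj_mult[OF mult_carrier_mat[OF Kc(1) Ac] L(1)] adj_mult[OF Kc(1) Ac] Aa
          by (simp add: ac)
        finally have "adj B = B" ..
        moreover have "B * K = K * A" unfolding B_def using Kc(1) Ac L(1,3) by (simp add: ac)
        ultimately have "(K, B) \<in> Q" using K(1) Bc by (simp add: Q_def hermitian_def)
        then show "K \<in> fst ` Q" by force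
      qed
    qed
    then have "card Q = card KK" by (rule bij_betw_same_card)
    also have "card KK = card GG * card (unitary n)"
    proof (rule card_eq_fibres[of KK GG "\<lambda>K. adj K * K"])
      show "(\<lambda>K. adj K * K) ` KK \<subseteq> GG"
      proof
        fix G assume "G \<in> (\<lambda>K. adj K * K) ` KK"
        then obtain K where K: "K \<in> KK" "G = adj K * K" by blast
        have Kc: "K \<in> carrier_mat n n" "det K \<noteq> 0" using K by (auto simp: KK_def GL_def)
        have "adj G = G" unfolding K(2) using adj_mult[OF adj_carrier[OF Kc(1)] Kc(1)] by simp
        moreover have "det G \<noteq> 0"
          unfolding K(2) det_mult[OF adj_carrier[OF Kc(1)] Kc(1)] det_adj[OF Kc(1)] using Kc by simp
        ultimately show "G \<in> GG" using K Kc(1) by (auto simp: GG_def KK_def GL_def)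
      qed
      fix G assume G: "G \<in> GG"
      have "{K \<in> KK. adj K * K = G} = {K \<in> carrier_mat n n. adj K * K = G}"
      proof (intro equalityI subsetI)
        fix K assume "K \<in> {K \<in> carrier_mat n n. adj K * K = G}"
        then have K: "K \<in> carrier_mat n n" "adj K * K = G" by auto
        have "cj (det K) * det K = det G" using det_mult[OF adj_carrier[OF K(1)] K(1)] det_adj[OF K(1)] K(2) by simp
        then have "det K \<noteq> 0" using G by (auto simp: GG_def GL_def)
        then show "K \<in> {K \<in> KK. adj K * K = G}" using K G by (auto simp: KK_def GL_def GG_def)
      qed (auto simp: KK_def GL_def)
      then show "card {K \<in> KK. adj K * K = G} = card (unitary n)"
        using card_hermitian_factors[of G n n] G frames_square by (auto simp: GG_def GL_def)
    qed (use fin in auto)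
    \<comment> \<open>Commuting with \<open>A\<close> makes \<open>G\<close> a polynomial in
      \<open>A\<close>; being Hermitian puts its coefficients into the subfield, and invertibility
      makes it a unit modulo \<open>h\<close>.\<close>
    also have "card GG = poly_totient h"
    proof -
      have "bij_betw (\<lambda>p. mat_poly A (emb p)) {p \<in> polys_lt n. coprime p h} GG"
      proof (rule bij_betw_imageI)
        have lt: "emb p \<in> polys_lt n \<longleftrightarrow> p \<in> polys_lt n" for p by (simp add: polys_lt_def)
        have cop: "coprime (emb p) (emb h) \<longleftrightarrow> coprime p h" for p
        proof
          assume c: "coprime (emb p) (emb h)"
          show "coprime p h"
          proof (rule coprimeI)
            fix d assume "d dvd p" "d dvd h"
            then have "emb d dvd emb p" "emb d dvd emb h" by (auto simp: emb_dvd_iff)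
            then have "is_unit (emb d)" using coprime_common_divisor[OF c] by blast
            then have "emb d dvd emb 1" unfolding emb.hom_one .
            then show "is_unit d" by (simp only: emb_dvd_iff)
          qed
        qed (rule coprime_emb)
        show "inj_on (\<lambda>p. mat_poly A (emb p)) {p \<in> polys_lt n. coprime p h}"
        proof (rule inj_onI)
          fix p r assume "p \<in> {p \<in> polys_lt n. coprime p h}" "r \<in> {p \<in> polys_lt n. coprime p h}"
            and "mat_poly A (emb p) = mat_poly A (emb r)"
          then have "emb p = emb r" using cyclic_mat_poly_inj[OF Ac v] lt by blast
          then show "p = r" by simp
        qed
        show "(\<lambda>p. mat_poly A (emb p)) ` {p \<in> polys_lt n. coprime p h} = GG"
        proof (intro equalityI subsetI)
          fix G assume "G \<in> (\<lambda>p. mat_poly A (emb p)) ` {p \<in> polys_lt n. coprime p h}"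
          then obtain p where p: "p \<in> polys_lt n" "coprime p h" "G = mat_poly A (emb p)" by blast
          have "det G \<noteq> 0" using cyclic_mat_poly_invertible_iff[OF Ac v] A(2) cop p by simp
          then show "G \<in> GG"
            using p(3) mat_poly_carrier[OF Ac] mat_poly_commute_self[OF Ac] adj_mat_poly[OF Ac Aa]
            by (simp add: GG_def GL_def)
        next
          fix G assume G: "G \<in> GG"
          then obtain p where p: "p \<in> polys_lt n" "G = mat_poly A p"
            using cyclic_commutant[OF Ac v, of G] by (auto simp: GG_def GL_def)
          have "mat_poly A (cjp p) = mat_poly A p" using G p(2) adj_mat_poly[OF Ac Aa, of p] by (simp add: GG_def)
          moreover have "cjp p \<in> polys_lt n" using p(1) by (simp add: polys_lt_def)
          ultimately have "cjp p = p" using cyclic_mat_poly_inj[OF Ac v] p(1) by blast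
          then obtain r where r: "p = emb r" by (rule cjp_fixed_imp_emb)
          have "coprime (emb r) (emb h)"
            using cyclic_mat_poly_invertible_iff[OF Ac v, of p] G p(2) A(2) r by (simp add: GG_def GL_def)
          then show "G \<in> (\<lambda>p. mat_poly A (emb p)) ` {p \<in> polys_lt n. coprime p h}"
            using p r lt cop by auto
        qed
      qed
      then show ?thesis using bij_betw_same_card by (fastforce simp: poly_totient_def deg)
    qed
    finally show ?thesis .
  qed
  ultimately show ?thesis unfolding M_def[symmetric] by (metis mult.commute)
qed

definition good_hermitian :: "nat \<Rightarrow> 'a mat set" where
  "good_hermitian n = {A \<in> hermitian n. squarefree (char_poly A) \<and> poly (char_poly A) 0 \<noteq> 0
    \<and> poly (char_poly A) 1 \<noteq> 0}"

lemma card_good_hermitian: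
  assumes "n > 0"
  shows "real (card (good_hermitian n)) = real (card (unitary n)) * (\<Sum>h\<in>good n. weight h)"
proof -
  have fin: "finite (good n)" by (simp add: good_def)
  have poly_emb: "poly (emb h) 0 = 0 \<longleftrightarrow> poly h 0 = 0" "poly (emb h) 1 = 0 \<longleftrightarrow> poly h 1 = 0" for h
    by simp_all
  have "good_hermitian n = (\<Union>h\<in>good n. {A \<in> hermitian n. char_poly A = emb h})"
  proof (intro equalityI subsetI)
    fix A assume A: "A \<in> good_hermitian n"
    then obtain h where h: "h \<in> monics n" "char_poly A = emb h"
      using char_poly_hermitian by (auto simp: good_hermitian_def)
    then have "h \<in> good n" using A poly_emb by (simp add: good_hermitian_def good_def squarefree_emb_iff)
    then show "A \<in> (\<Union>h\<in>good n. {A \<in> hermitian n. char_poly A = emb h})"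
      using A h by (auto simp: good_hermitian_def)
  qed (use poly_emb in \<open>auto simp: good_hermitian_def good_def squarefree_emb_iff\<close>)
  then have "card (good_hermitian n) = (\<Sum>h\<in>good n. card {A \<in> hermitian n. char_poly A = emb h})"
    using fin by (auto intro!: card_UN_disjoint)
  also have "real \<dots> = (\<Sum>h\<in>good n. real (card (unitary n)) * weight h)"
    unfolding of_nat_sum
  proof (rule sum.cong[OF refl])
    fix h assume h: "h \<in> good n"
    have "poly_totient (emb h) > 0"
    proof -
      have "degree (emb h) > 0" using h assms by (auto simp: good_def monics_def)
      then have "1 \<in> {f \<in> polys_lt (degree (emb h)). coprime f (emb h)}" by (simp add: polys_lt_iff)
      moreover have "finite {f \<in> polys_lt (degree (emb h)). coprime f (emb h)}" by simp
      ultimately show ?thesis unfolding poly_totient_def by (metis card_gt_0_iff empty_iff)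
    qed
    moreover have "real (card {A \<in> hermitian n. char_poly A = emb h}) * real (poly_totient (emb h))
        = real (card (unitary n)) * real (poly_totient h)"
      using card_hermitian_char_poly[of h n] h assms by (simp add: good_def flip: of_nat_mult)
    ultimately show "real (card {A \<in> hermitian n. char_poly A = emb h}) = real (card (unitary n)) * weight h"
      by (simp add: weight_def field_simps)
  qed
  finally show ?thesis by (simp add: sum_distrib_left)
qed

end

section \<open>Homogenized characteristic polynomials\<close>

text \<open>Two block eliminations of the same matrix compute its determinant. The inverse of
  \<open>S\<close> is replaced by \<open>S'\<close>, an inverse up to the scalar \<open>s\<close>,
  so that the identity holds over polynomials without division.\<close>

lemma sylvester_det:
  fixes S S' U V :: "'r::idom mat"
  assumes S: "S \<in> carrier_mat n n" "S' \<in> carrier_mat n n" and UV: "U \<in> carrier_mat n m" "V \<in> carrier_mat m n"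
    and SS: "S' * S = s \<cdot>\<^sub>m 1\<^sub>m n"
  shows "s ^ m * det (S - U * V) = det S * det (s \<cdot>\<^sub>m 1\<^sub>m m - V * S' * U)"
proof -
  let ?P = "four_block_mat S U V (1\<^sub>m m)"
  have c: "U * V \<in> carrier_mat n n" "V * S' \<in> carrier_mat m n" "V * S' * U \<in> carrier_mat m m"
    using S UV by auto
  have c': "S - U * V \<in> carrier_mat n n" using c(1) by (rule minus_carrier_mat)
  have "four_block_mat (1\<^sub>m n) U (0\<^sub>m m n) (1\<^sub>m m) * four_block_mat (S - U * V) (0\<^sub>m n m) V (1\<^sub>m m) = ?P"
    using S UV c by (subst mult_four_block_mat[of _ n n _ m _ m]) (auto intro!: arg_cong4[where f = four_block_mat] eq_matI)
  then have "det ?P = det (four_block_mat (1\<^sub>m n) U (0\<^sub>m m n) (1\<^sub>m m)) * det (four_block_mat (S - U * V) (0\<^sub>m n m) V (1\<^sub>m m))"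
    using S UV c c' det_mult[of "four_block_mat (1\<^sub>m n) U (0\<^sub>m m n) (1\<^sub>m m)" "n + m"
      "four_block_mat (S - U * V) (0\<^sub>m n m) V (1\<^sub>m m)"] by auto
  also have "\<dots> = det (S - U * V)"
    using S UV c' by (simp add: det_four_block_mat_lower_left_zero[of _ n _ m] det_four_block_mat_upper_right_zero[of _ n _ m])
  finally have P: "det ?P = det (S - U * V)" .
  have VSS: "V * S' * S = s \<cdot>\<^sub>m V"
    using assoc_mult_mat[OF UV(2) S(2) S(1)] unfolding SS
    using mult_smult_distrib[OF UV(2) one_carrier_mat] UV by simp
  have block: "four_block_mat (1\<^sub>m n) (0\<^sub>m n m) (- (V * S')) (s \<cdot>\<^sub>m 1\<^sub>m m) * ?P
      = four_block_mat S U (0\<^sub>m m n) (s \<cdot>\<^sub>m 1\<^sub>m m - V * S' * U)"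
  proof -
    have "four_block_mat (1\<^sub>m n) (0\<^sub>m n m) (- (V * S')) (s \<cdot>\<^sub>m 1\<^sub>m m) * ?P
      = four_block_mat (1\<^sub>m n * S + 0\<^sub>m n m * V) (1\<^sub>m n * U + 0\<^sub>m n m * 1\<^sub>m m)
        (- (V * S') * S + s \<cdot>\<^sub>m 1\<^sub>m m * V) (- (V * S') * U + s \<cdot>\<^sub>m 1\<^sub>m m * 1\<^sub>m m)"
      using S UV c by (intro mult_four_block_mat[of _ n n _ m _ m]) auto
    also have "1\<^sub>m n * S + 0\<^sub>m n m * V = S" using S UV by (auto intro!: eq_matI)
    also have "1\<^sub>m n * U + 0\<^sub>m n m * 1\<^sub>m m = U" using UV by (auto intro!: eq_matI)
    also have "- (V * S') * S + s \<cdot>\<^sub>m 1\<^sub>m m * V = 0\<^sub>m m n"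
    proof -
      have "- (V * S') * S = - (s \<cdot>\<^sub>m V)" unfolding VSS[symmetric] using UV S by simp
      moreover have "s \<cdot>\<^sub>m 1\<^sub>m m * V = s \<cdot>\<^sub>m V" using mult_smult_assoc_mat[OF one_carrier_mat UV(2)] UV by simp
      ultimately show ?thesis using UV by (auto intro!: eq_matI)
    qed
    also have "- (V * S') * U + s \<cdot>\<^sub>m 1\<^sub>m m * 1\<^sub>m m = s \<cdot>\<^sub>m 1\<^sub>m m - V * S' * U"
    proof -
      have "- (V * S') * U = - (V * S' * U)" using UV S by simp
      moreover have "- X + s \<cdot>\<^sub>m 1\<^sub>m m * 1\<^sub>m m = s \<cdot>\<^sub>m 1\<^sub>m m - X" if "X \<in> carrier_mat m m" for X :: "'r mat"
        using that by (auto intro!: eq_matI)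
      ultimately show ?thesis using c(3) by simp
    qed
    finally show ?thesis .
  qed
  have "det (four_block_mat (1\<^sub>m n) (0\<^sub>m n m) (- (V * S')) (s \<cdot>\<^sub>m 1\<^sub>m m)) * det ?P
      = det (four_block_mat S U (0\<^sub>m m n) (s \<cdot>\<^sub>m 1\<^sub>m m - V * S' * U))"
    unfolding block[symmetric] using S UV c by (intro det_mult[symmetric, of _ "n + m"]) auto
  moreover have "det (four_block_mat (1\<^sub>m n) (0\<^sub>m n m) (- (V * S')) (s \<cdot>\<^sub>m 1\<^sub>m m)) = s ^ m"
    using c by (subst det_four_block_mat_upper_right_zero[of _ n _ m]) auto
  moreover have "det (four_block_mat S U (0\<^sub>m m n) (s \<cdot>\<^sub>m 1\<^sub>m m - V * S' * U)) = det S * det (s \<cdot>\<^sub>m 1\<^sub>m m - V * S' * U)"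
    using S UV c by (intro det_four_block_mat_lower_left_zero) auto
  ultimately show ?thesis unfolding P by simp
qed

lemma poly_altdef_le:
  fixes h :: "'a::comm_semiring_1 poly"
  assumes "degree h \<le> m"
  shows "poly h x = (\<Sum>k\<le>m. coeff h k * x ^ k)"
  unfolding poly_altdef using assms by (intro sum.mono_neutral_left) (auto simp: coeff_eq_0)

text \<open>The value b^m h(a/b) with denominators cleared; faithful for
  \<open>degree h \<le> m\<close>, as higher coefficients are dropped.\<close>

definition homog :: "'a::comm_ring_1 poly \<Rightarrow> 'a poly \<Rightarrow> nat \<Rightarrow> 'a poly \<Rightarrow> 'a poly" where
  "homog a b m h = (\<Sum>k\<le>m. smult (coeff h k) (a ^ k * b ^ (m - k)))"

definition const_fract :: "'a::idom \<Rightarrow> 'a poly fract" where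
  "const_fract c = to_fract [:c:]"

interpretation to_fract_hom: inj_comm_ring_hom "to_fract :: 'a::idom \<Rightarrow> 'a fract"
  by unfold_locales (auto simp: to_fract_add to_fract_mult)

interpretation const_fract: inj_comm_ring_hom "const_fract :: 'a::idom \<Rightarrow> 'a poly fract"
  by unfold_locales (auto simp: const_fract_def one_pCons to_fract_add[symmetric] to_fract_mult[symmetric] simp del: to_fract_add to_fract_mult)

lemma to_fract_homog:
  fixes h :: "'a::idom poly"
  assumes "b \<noteq> 0" "degree h \<le> m"
  shows "to_fract (homog a b m h) = to_fract b ^ m * poly (map_poly const_fract h) (to_fract a / to_fract b)"
proof -
  have "degree (map_poly const_fract h) \<le> m" using assms(2) by simp
  then have "poly (map_poly const_fract h) x = (\<Sum>k\<le>m. const_fract (coeff h k) * x ^ k)" for x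
    by (simp add: poly_altdef_le)
  then have "to_fract b ^ m * poly (map_poly const_fract h) (to_fract a / to_fract b)
      = (\<Sum>k\<le>m. to_fract b ^ m * (const_fract (coeff h k) * (to_fract a / to_fract b) ^ k))"
    by (simp add: sum_distrib_left)
  also have "\<dots> = (\<Sum>k\<le>m. to_fract (smult (coeff h k) (a ^ k * b ^ (m - k))))"
  proof (rule sum.cong[OF refl])
    fix k assume "k \<in> {..m}"
    then have k: "to_fract b ^ m = to_fract b ^ k * to_fract b ^ (m - k)" by (simp flip: power_add)
    have b: "to_fract b \<noteq> 0" using assms(1) by simp
    have "smult (coeff h k) (a ^ k * b ^ (m - k)) = [:coeff h k:] * (a ^ k * b ^ (m - k))" by simp
    then have "to_fract (smult (coeff h k) (a ^ k * b ^ (m - k)))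
        = const_fract (coeff h k) * (to_fract a ^ k * to_fract b ^ (m - k))"
      by (simp only: const_fract_def to_fract_hom.hom_mult to_fract_hom.hom_power)
    then show "to_fract b ^ m * (const_fract (coeff h k) * (to_fract a / to_fract b) ^ k)
        = to_fract (smult (coeff h k) (a ^ k * b ^ (m - k)))"
      unfolding k using b by (simp add: power_divide)
  qed
  finally show ?thesis by (simp add: homog_def to_fract_hom.hom_sum)
qed

lemma homog_mult:
  fixes f g :: "'a::idom poly"
  assumes "b \<noteq> 0" "degree f \<le> m" "degree g \<le> n"
  shows "homog a b (m + n) (f * g) = homog a b m f * homog a b n g"
proof -
  interpret cf: map_poly_comm_ring_hom "const_fract :: 'a \<Rightarrow> _" ..
  have "degree (f * g) \<le> m + n" using assms degree_mult_le[of f g] by linarith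
  then have "to_fract (homog a b (m + n) (f * g)) = to_fract (homog a b m f * homog a b n g)"
    using assms by (simp add: to_fract_homog to_fract_hom.hom_mult cf.hom_mult power_add)
  then show ?thesis by (rule to_fract_hom.injectivity)
qed

lemma homog_add: "homog a b m (f + g) = homog a b m f + homog a b m g"
  by (simp add: homog_def smult_add_left sum.distrib)

lemma homog_1: "homog a b m 1 = b ^ m"
proof -
  have "homog a b m 1 = (\<Sum>k\<le>m. if k = 0 then b ^ m else 0)"
    unfolding homog_def by (rule sum.cong) (auto simp: coeff_1)
  then show ?thesis by simp
qed

text \<open>Over the fraction field a - b Z is b (a/b - Z), whose determinant is b^m times the
  characteristic polynomial at a/b.\<close>

lemma det_eq_homog_char_poly:
  fixes Z :: "'a::field mat"
  assumes Z: "Z \<in> carrier_mat m m" and b: "b \<noteq> 0"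
  shows "det (a \<cdot>\<^sub>m 1\<^sub>m m - b \<cdot>\<^sub>m map_mat (\<lambda>c. [:c:]) Z) = homog a b m (char_poly Z)"
proof -
  let ?X = "a \<cdot>\<^sub>m 1\<^sub>m m - b \<cdot>\<^sub>m map_mat (\<lambda>c. [:c:]) Z"
  let ?Z = "map_mat const_fract Z"
  define k where "k = to_fract a / to_fract b"
  have ZF: "?Z \<in> carrier_mat m m" using Z by simp
  have b0: "to_fract b \<noteq> 0" using b by simp
  have sm: "to_fract (smult c b) = to_fract [:c:] * to_fract b" for c
  proof -
    have "smult c b = [:c:] * b" by simp
    then show ?thesis by (simp only: to_fract_hom.hom_mult)
  qed
  have "map_mat to_fract ?X = to_fract b \<cdot>\<^sub>m (- char_matrix ?Z k)"
    using Z b0 by (intro eq_matI)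
      (auto simp: char_matrix_def k_def const_fract_def algebra_simps to_fract_hom.hom_minus sm)
  then have "det (map_mat to_fract ?X) = to_fract b ^ m * det (- char_matrix ?Z k)"
    using ZF by (simp add: char_matrix_def)
  also have "det (- char_matrix ?Z k) = poly (char_poly ?Z) k" using char_poly_matrix[OF ZF] by simp
  also have "char_poly ?Z = map_poly const_fract (char_poly Z)" by (rule const_fract.char_poly_hom[OF Z])
  also have "to_fract b ^ m * poly (map_poly const_fract (char_poly Z)) k = to_fract (homog a b m (char_poly Z))"
    unfolding k_def using b degree_char_poly[OF Z] by (simp add: to_fract_homog)
  finally have "to_fract (det ?X) = to_fract (homog a b m (char_poly Z))" by (simp only: to_fract_hom.hom_det)
  then show ?thesis by (rule to_fract_hom.injectivity)
qed

text \<open>The chain and quotient rules for b^m h(a/b), multiplied by \<open>b\<close>. The factor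
  \<open>pderiv a * b - a * pderiv b\<close> locates the critical points of a/b.\<close>

lemma pderiv_homog:
  fixes h :: "'a::idom poly"
  assumes "degree h \<le> Suc m"
  shows "b * pderiv (homog a b (Suc m) h) = of_nat (Suc m) * pderiv b * homog a b (Suc m) h
    + (pderiv a * b - a * pderiv b) * homog a b m (pderiv h)"
proof -
  have tm: "b * pderiv (smult c (a ^ k * b ^ (Suc m - k)))
      = of_nat (Suc m) * pderiv b * smult c (a ^ k * b ^ (Suc m - k))
        + (pderiv a * b - a * pderiv b) * smult (of_nat k * c) (a ^ (k - 1) * b ^ (Suc m - k))"
    if k: "k \<le> Suc m" for k c
  proof -
    have a: "of_nat k * a ^ (k - 1) * a = of_nat k * a ^ k" by (cases k) (auto simp: mult_ac)
    have b: "of_nat (Suc m - k) * b ^ (Suc m - k - 1) * b = of_nat (Suc m - k) * b ^ (Suc m - k)"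
      by (cases "Suc m - k") (auto simp: mult_ac)
    have dp: "pderiv (f ^ j) = of_nat j * f ^ (j - 1) * pderiv f" for f :: "'a poly" and j
    proof (cases j)
      case (Suc i)
      show ?thesis unfolding Suc pderiv_power_Suc of_nat_poly by simp
    qed simp
    have "b * pderiv (a ^ k * b ^ (Suc m - k))
        = (of_nat (Suc m - k) * b ^ (Suc m - k - 1) * b) * pderiv b * a ^ k
          + of_nat k * a ^ (k - 1) * pderiv a * b * b ^ (Suc m - k)"
      by (simp add: pderiv_mult dp algebra_simps)
    also have "\<dots> = (of_nat (Suc m) - of_nat k) * pderiv b * (a ^ k * b ^ (Suc m - k))
          + of_nat k * a ^ (k - 1) * pderiv a * b * b ^ (Suc m - k)"
      unfolding b using k by (simp add: of_nat_diff mult_ac)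
    also have "\<dots> = of_nat (Suc m) * pderiv b * (a ^ k * b ^ (Suc m - k))
          - (of_nat k * a ^ k) * pderiv b * b ^ (Suc m - k)
          + of_nat k * a ^ (k - 1) * pderiv a * b * b ^ (Suc m - k)"
      by (simp add: algebra_simps)
    also have "\<dots> = of_nat (Suc m) * pderiv b * (a ^ k * b ^ (Suc m - k))
        + (pderiv a * b - a * pderiv b) * (of_nat k * (a ^ (k - 1) * b ^ (Suc m - k)))"
      unfolding a[symmetric] by (simp add: algebra_simps)
    finally have *: "b * pderiv (a ^ k * b ^ (Suc m - k)) = of_nat (Suc m) * pderiv b * (a ^ k * b ^ (Suc m - k))
        + (pderiv a * b - a * pderiv b) * (of_nat k * (a ^ (k - 1) * b ^ (Suc m - k)))" .
    have sm: "smult (of_nat k * c) f = smult c (of_nat k * f)" for f :: "'a poly"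
      by (simp add: of_nat_poly mult.commute)
    show ?thesis
      unfolding pderiv_smult sm mult_smult_right * smult_add_right[symmetric] ..
  qed
  have "homog a b m (pderiv h) = (\<Sum>k\<le>m. smult (of_nat (Suc k) * coeff h (Suc k)) (a ^ k * b ^ (m - k)))"
    by (simp add: homog_def coeff_pderiv)
  also have "\<dots> = (\<Sum>k\<le>Suc m. smult (of_nat k * coeff h k) (a ^ (k - 1) * b ^ (Suc m - k)))"
    by (subst sum.atMost_Suc_shift) simp
  finally have hp: "homog a b m (pderiv h) = (\<Sum>k\<le>Suc m. smult (of_nat k * coeff h k) (a ^ (k - 1) * b ^ (Suc m - k)))" .
  have ps: "pderiv (\<Sum>k\<le>M. f k) = (\<Sum>k\<le>M. pderiv (f k))" for M and f :: "nat \<Rightarrow> 'a poly"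
    by (induction M) (auto simp: pderiv_add)
  show ?thesis
    unfolding hp unfolding homog_def ps sum_distrib_left sum.distrib[symmetric]
    using tm by (intro sum.cong refl) auto
qed

text \<open>The choice of \<open>a\<close> and \<open>b\<close> comes from (x + 1)^2 - 4 x Z. Both
  \<open>a\<close> and \<open>a - b\<close> are squares, so a/b takes the values 0 and 1 only at x =
  -1 and x = 1, each time doubly.\<close>

context
  fixes a b :: "'a::{field,finite} poly"
  assumes two: "(2::'a) \<noteq> 0"
  defines "a \<equiv> [:1, 1:]\<^sup>2" and "b \<equiv> [:0, 4:]"
begin

lemma four: "(4::'a) \<noteq> 0"
proof -
  have "(4::'a) = 2 * 2" by simp
  then show ?thesis using two by (metis mult_eq_0_iff)
qed

lemma b0: "b \<noteq> 0"
  using four by (simp add: b_def)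

lemma ab: "a - b = [:-1, 1:]\<^sup>2"
  by (simp add: a_def b_def power2_eq_square)

lemma poly_homog_m1: "poly (homog a b m h) (-1) = coeff h 0 * (-4) ^ m"
proof -
  have "poly (homog a b m h) (-1) = (\<Sum>k\<le>m. coeff h k * (0 ^ k * (-4) ^ (m - k)))"
    by (simp add: homog_def poly_sum a_def b_def)
  also have "\<dots> = (\<Sum>k\<le>m. if k = 0 then coeff h 0 * (-4) ^ m else 0)"
    by (rule sum.cong) auto
  finally show ?thesis by simp
qed

lemma poly_homog_0: "poly (homog a b m h) 0 = coeff h m"
proof -
  have "poly (homog a b m h) 0 = (\<Sum>k\<le>m. coeff h k * 0 ^ (m - k))"
    by (simp add: homog_def poly_sum a_def b_def)
  also have "\<dots> = (\<Sum>k\<le>m. if k = m then coeff h m else 0)"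
    by (rule sum.cong) auto
  finally show ?thesis by simp
qed

lemma poly_homog_1:
  assumes "degree h \<le> m"
  shows "poly (homog a b m h) 1 = 4 ^ m * poly h 1"
proof -
  have "poly (homog a b m h) 1 = (\<Sum>k\<le>m. coeff h k * (4 ^ k * 4 ^ (m - k)))"
    by (simp add: homog_def poly_sum a_def b_def)
  also have "\<dots> = (\<Sum>k\<le>m. 4 ^ m * coeff h k)"
    by (rule sum.cong) (auto simp flip: power_add)
  also have "\<dots> = 4 ^ m * poly h 1" by (simp add: poly_altdef_le[OF assms] sum_distrib_left)
  finally show ?thesis .
qed

lemma degree_homog:
  assumes "degree h = m" "h \<noteq> 0"
  shows "degree (homog a b m h) \<ge> 2 * m"
proof (rule le_degree)
  have da: "degree (a ^ k) = 2 * k" and db: "degree (b ^ k) = k" for k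
    using four by (auto simp: a_def b_def degree_power_eq)
  have la: "lead_coeff (a ^ m) = 1" by (simp add: a_def lead_coeff_power)
  have "coeff (homog a b m h) (2 * m) = (\<Sum>k\<le>m. coeff h k * coeff (a ^ k * b ^ (m - k)) (2 * m))"
    by (simp add: homog_def coeff_sum)
  also have "\<dots> = (\<Sum>k\<le>m. if k = m then coeff h m else 0)"
  proof (rule sum.cong[OF refl])
    fix k assume k: "k \<in> {..m}"
    show "coeff h k * coeff (a ^ k * b ^ (m - k)) (2 * m) = (if k = m then coeff h m else 0)"
    proof (cases "k = m")
      case True
      then show ?thesis using la da[of m] by simp
    next
      case False
      have "degree (a ^ k * b ^ (m - k)) \<le> 2 * k + (m - k)"
        using degree_mult_le[of "a ^ k" "b ^ (m - k)"] da[of k] db[of "m - k"] by simp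
      also have "\<dots> < 2 * m" using k False by auto
      finally show ?thesis using False by (simp add: coeff_eq_0)
    qed
  qed
  also have "\<dots> = lead_coeff h" using assms by simp
  finally show "coeff (homog a b m h) (2 * m) \<noteq> 0" using leading_coeff_neq_0[OF assms(2)] by metis
qed

lemma not_unit_homog:
  assumes "degree h > 0"
  shows "\<not> is_unit (homog a b (degree h) h)"
proof
  assume u: "is_unit (homog a b (degree h) h)"
  have "h \<noteq> 0" using assms by auto
  then have dg: "degree (homog a b (degree h) h) > 0" using degree_homog[of h "degree h"] assms by simp
  then have "homog a b (degree h) h \<noteq> 0" by (metis degree_0 less_irrefl)
  from is_unit_iff_degree[OF this] u dg show False by linarith
qed

text \<open>Homogenization is multiplicative, so a square factor of \<open>h\<close> produces a
  square factor; the linear factors x and x - 1 become the squares (x + 1)^2 and (x - 1)^2.\<close>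

lemma squarefree_homogD:
  assumes h: "degree h = m" "h \<noteq> 0" and sf: "squarefree (homog a b m h)"
  shows "squarefree h" "poly h 0 \<noteq> 0" "poly h 1 \<noteq> 0"
proof -
  have nsf: "\<not> is_unit p \<Longrightarrow> \<not> p\<^sup>2 dvd homog a b m h" for p using squarefreeD[OF sf] by blast
  have lin: False if fp: "homog a b 1 f = p\<^sup>2" "degree p > 0" "degree f = 1" "f dvd h" for f p
  proof -
    obtain k where k: "h = f * k" using fp(4) by (rule dvdE)
    have "f \<noteq> 0" "k \<noteq> 0" using k h by auto
    then have "m = 1 + degree k" using h fp(3) unfolding k by (simp add: degree_mult_eq)
    then have "homog a b m h = homog a b 1 f * homog a b (degree k) k"
      unfolding k using fp(3) b0 homog_mult[of b f 1 k "degree k" a] by simp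
    then have "p\<^sup>2 dvd homog a b m h" unfolding fp(1) by simp
    moreover have "\<not> is_unit p" using fp(2) is_unit_iff_degree[of p] by auto
    ultimately show False using nsf by blast
  qed
  show "squarefree h"
  proof (rule squarefreeI, rule ccontr)
    fix d assume d: "d\<^sup>2 dvd h" "\<not> is_unit d"
    obtain k where k: "h = d * (d * k)" using d(1) by (metis dvdE mult.assoc power2_eq_square)
    have nz: "d \<noteq> 0" "k \<noteq> 0" using k h by auto
    then have dd: "degree d > 0" using d(2) by (simp add: is_unit_iff_degree)
    have "m = degree d + (degree d + degree k)" using h nz unfolding k by (simp add: degree_mult_eq)
    then have "homog a b m h = homog a b (degree d) d * (homog a b (degree d) d * homog a b (degree k) k)"
      unfolding k using b0 nz by (simp add: homog_mult degree_mult_eq)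
    then have "(homog a b (degree d) d)\<^sup>2 dvd homog a b m h" by (simp add: power2_eq_square mult.assoc[symmetric])
    then show False using nsf not_unit_homog[OF dd] by blast
  qed
  show "poly h 0 \<noteq> 0"
  proof
    assume "poly h 0 = 0"
    then have "[:0, 1:] dvd h" using poly_eq_0_iff_dvd[of h 0] by simp
    moreover have "homog a b 1 [:0, 1:] = [:1, 1:]\<^sup>2" by (simp add: homog_def a_def)
    ultimately show False using lin[of "[:0, 1:]" "[:1, 1:]"] by simp
  qed
  show "poly h 1 \<noteq> 0"
  proof
    assume "poly h 1 = 0"
    then have "[:-1, 1:] dvd h" using poly_eq_0_iff_dvd[of h 1] by simp
    moreover have "homog a b 1 [:-1, 1:] = [:-1, 1:]\<^sup>2" unfolding ab[symmetric] by (simp add: homog_def)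
    ultimately show False using lin[of "[:-1, 1:]" "[:-1, 1:]"] by simp
  qed
qed

text \<open>A repeated prime factor \<open>P\<close> divides the critical-point factor 4 (x + 1)(x -
  1) or the homogenized derivative of \<open>h\<close>. The first is excluded by the values at -1
  and 1, which are \<open>poly h 0\<close> and \<open>poly h 1\<close> up to powers of -4 and 4; the
  second by separability of \<open>h\<close>.\<close>

lemma squarefree_homogI:
  assumes h: "h \<in> monics m" "squarefree h" and h01: "poly h 0 \<noteq> 0" "poly h 1 \<noteq> 0"
  shows "squarefree (homog a b m h)"
proof (cases m)
  case 0
  then have "h = 1" using h by (auto simp: monics_def elim!: degree_eq_zeroE)
  then show ?thesis using 0 by (simp add: homog_1)
next
  case (Suc l)
  let ?R = "homog a b m h"
  have deg: "degree h = m" "coeff h m = 1" using h by (auto simp: monics_def)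
  have m1: "poly ?R (-1) \<noteq> 0" using h01(1) four by (simp add: poly_homog_m1 poly_0_coeff_0)
  have p1: "poly ?R 1 \<noteq> 0" using h01(2) four deg by (simp add: poly_homog_1)
  have z: "poly ?R 0 \<noteq> 0" using deg by (simp add: poly_homog_0)
  have R0: "?R \<noteq> 0" using z by auto
  have root: False if "irreducible P" "P dvd ?R" "P dvd [:-c, 1:]" "poly ?R c \<noteq> 0" for P c
  proof -
    have "[:-c, 1:] dvd P"
      using irreducibleD'[OF irreducible_linear_field_poly[of 1 "-c"] that(3)] irreducible_not_unit[OF that(1)] by auto
    then have "[:-c, 1:] dvd ?R" using that(2) by (rule dvd_trans)
    then show False using that(4) poly_eq_0_iff_dvd by blast
  qed
  have "coprime ?R (pderiv ?R)"
  proof (rule coprimeI, rule ccontr)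
    fix d assume d: "d dvd ?R" "d dvd pderiv ?R" "\<not> is_unit d"
    have "d \<noteq> 0" using d R0 by auto
    then have "degree d > 0" using d(3) by (simp add: is_unit_iff_degree)
    then obtain P where P: "irreducible P" "P dvd d" using ex_monic_irreducible_factor by metis
    have PR: "P dvd ?R" "P dvd pderiv ?R" using P(2) d by (auto intro: dvd_trans)
    have prime: "prime_elem P" using P(1) by (rule field_poly_irreducible_imp_prime)
    have pab: "pderiv a * b - a * pderiv b = [:4:] * ([:1, 1:] * [:-1, 1:])"
      by (simp add: a_def b_def pderiv_pCons power2_eq_square)
    have "P dvd b * pderiv ?R - of_nat m * pderiv b * ?R" using PR by (intro dvd_diff) auto
    also have "b * pderiv ?R - of_nat m * pderiv b * ?R = (pderiv a * b - a * pderiv b) * homog a b l (pderiv h)"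
      using pderiv_homog[of h l b a] deg Suc by simp
    finally have "P dvd [:4:] * ([:1, 1:] * [:-1, 1:]) * homog a b l (pderiv h)" unfolding pab .
    then have "P dvd [:4:] \<or> P dvd [:1, 1:] \<or> P dvd [:-1, 1:] \<or> P dvd homog a b l (pderiv h)"
      using prime by (simp only: prime_elem_dvd_mult_iff disj_assoc)
    moreover have "\<not> P dvd [:4:]"
    proof
      assume "P dvd [:4:]"
      moreover have "is_unit [:4::'a:]" using four by (simp add: is_unit_const_poly_iff)
      ultimately have "is_unit P" using dvd_unit_imp_unit by blast
      then show False using P(1) irreducible_not_unit by blast
    qed
    moreover have "\<not> P dvd [:1, 1:]" using root[of P "-1"] P(1) PR(1) m1 by auto
    moreover have "\<not> P dvd [:-1, 1:]" using root[of P 1] P(1) PR(1) p1 by auto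
    ultimately have Ph: "P dvd homog a b l (pderiv h)" by blast
    obtain u v where uv: "u * h + v * pderiv h = 1"
      using poly_bezout[OF squarefree_imp_coprime_pderiv[OF h(2)]] .
    define N where "N = degree u + degree v"
    \<comment> \<open>Homogenizing the Bezout identity turns 1 into a power of \<open>b\<close>. As
      \<open>pderiv h\<close> lives in degree \<open>l\<close>, one less than \<open>m\<close>, its
      cofactor is taken in degree \<open>Suc N\<close>. Then \<open>P\<close> divides 4 x, although
      the value at 0 is the leading coefficient 1.\<close>
    have "b ^ (N + m) = homog a b (N + m) (u * h + v * pderiv h)" by (simp add: uv homog_1)
    also have "\<dots> = homog a b (N + m) (u * h) + homog a b (Suc N + l) (v * pderiv h)"
      unfolding homog_add by (simp add: Suc)
    also have "homog a b (N + m) (u * h) = homog a b N u * ?R"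
      using b0 deg by (intro homog_mult) (auto simp: N_def)
    also have "homog a b (Suc N + l) (v * pderiv h) = homog a b (Suc N) v * homog a b l (pderiv h)"
      using b0 deg Suc degree_pderiv_le[of h] by (intro homog_mult) (auto simp: N_def)
    finally have "P dvd b ^ (N + m)" using PR(1) Ph by simp
    then have "P dvd b" using prime prime_elem_dvd_power by blast
    then have "P dvd [:4:] * [:-0, 1:]" by (simp add: b_def)
    then have "P dvd [:-0, 1:]" using prime \<open>\<not> P dvd [:4:]\<close> prime_elem_dvd_mult_iff by blast
    then show False using root[of P 0] P(1) PR(1) z by blast
  qed
  then show ?thesis by (rule coprime_pderiv_imp_squarefree)
qed

text \<open>The exponent \<open>e\<close> is 0 in even and 1 in odd dimension. The extra factor x -
  1 does no harm because the other factor has the value 4^m h(1) at 1.\<close>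

lemma squarefree_homog_iff:
  assumes h: "h \<in> monics m" and e: "e \<le> 1"
  shows "squarefree ([:-1, 1:] ^ e * homog a b m h) \<longleftrightarrow> squarefree h \<and> poly h 0 \<noteq> 0 \<and> poly h 1 \<noteq> 0"
proof
  assume "squarefree ([:-1, 1:] ^ e * homog a b m h)"
  then have "squarefree (homog a b m h)" by (rule squarefree_mono[rotated]) simp
  then show "squarefree h \<and> poly h 0 \<noteq> 0 \<and> poly h 1 \<noteq> 0"
    using squarefree_homogD[of h m] h monics_nonzero[OF h] by (auto simp: monics_def)
next
  assume *: "squarefree h \<and> poly h 0 \<noteq> 0 \<and> poly h 1 \<noteq> 0"
  then have sf: "squarefree (homog a b m h)" using h by (intro squarefree_homogI) auto
  show "squarefree ([:-1, 1:] ^ e * homog a b m h)"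
  proof (cases "e = 0")
    case False
    then have e1: "e = 1" using e by simp
    have nd: "\<not> [:-1, 1:] dvd homog a b m h"
    proof
      assume "[:-1, 1:] dvd homog a b m h"
      then have "poly (homog a b m h) 1 = 0" using poly_eq_0_iff_dvd[of _ 1] by blast
      then show False using * h four by (simp add: poly_homog_1 monics_def)
    qed
    have irr: "irreducible [:-1, 1::'a:]" by (rule irreducible_linear_field_poly) simp
    have cop: "coprime [:-1, 1:] (homog a b m h)" using irr nd by (rule irreducible_poly_coprime)
    have "squarefree [:-1, 1::'a:]"
      by (rule coprime_pderiv_imp_squarefree) (simp add: pderiv_pCons one_pCons[symmetric])
    then have cop1: "coprime [:-1, 1::'a:] (pderiv [:-1, 1:])" and cop2: "coprime (homog a b m h) (pderiv (homog a b m h))"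
      using sf squarefree_imp_coprime_pderiv by blast+
    show ?thesis
    proof (rule coprime_pderiv_imp_squarefree)
      let ?f = "[:-1, 1::'a:]" and ?g = "homog a b m h"
      have pf: "pderiv ?f = 1" by (simp add: pderiv_pCons one_pCons)
      have pd: "pderiv (?f * ?g) = ?f * pderiv ?g + ?g * pderiv ?f" by (rule pderiv_mult)
      have "coprime ?f (pderiv (?f * ?g))"
      proof (rule irreducible_poly_coprime[OF irr])
        show "\<not> ?f dvd pderiv (?f * ?g)"
          unfolding pd pf using nd by (metis dvd_add_right_iff dvd_triv_left mult_1_right)
      qed
      moreover have "coprime ?g (pderiv (?f * ?g))"
      proof (rule coprimeI)
        fix d assume d: "d dvd ?g" "d dvd pderiv (?f * ?g)"
        have "d dvd ?g * pderiv ?f" using d(1) by simp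
        then have "d dvd ?f * pderiv ?g" using d(2) unfolding pd by (simp add: dvd_add_left_iff)
        moreover have "coprime d ?f"
        proof (rule coprimeI)
          fix c assume "c dvd d" "c dvd ?f"
          then show "is_unit c" using coprime_common_divisor[OF cop, of c] d(1) by (blast intro: dvd_trans)
        qed
        ultimately have "d dvd pderiv ?g" by (simp only: coprime_poly_dvd_mult_iff)
        then show "is_unit d" using coprime_common_divisor[OF cop2 d(1)] by blast
      qed
      ultimately show "coprime ([:-1, 1:] ^ e * ?g) (pderiv ([:-1, 1:] ^ e * ?g))"
        unfolding e1 power_one_right by (simp only: coprime_poly_mult_left_iff)
    qed
  qed (use sf in simp)
qed

end

section \<open>Involutions in the unitary group\<close>

lemma kernel_dim_zero_mat: "kernel.dim n (0\<^sub>m n n :: 'a::field mat) = n"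
proof -
  let ?A = "0\<^sub>m n n :: 'a mat"
  have A: "?A \<in> carrier_mat n n" by simp
  have "pivot_fun ?A (\<lambda>_. n) n" by (rule pivot_funI) auto
  then have row: "row_echelon_form ?A" unfolding row_echelon_form_def by auto
  interpret kernel n n ?A by unfold_locales simp
  have "{i. i < n \<and> row ?A i \<noteq> 0\<^sub>v n} = {}" by auto
  then have c: "card {i. i < n \<and> row ?A i \<noteq> 0\<^sub>v n} = 0" by (simp only: card.empty)
  from find_base_vectors[OF row A, unfolded c] show "dim = n" by simp
qed

lemma wide_mat_kernel:
  fixes A :: "'a::field mat"
  assumes A: "A \<in> carrier_mat k m" and "k < m"
  obtains z where "z \<in> carrier_vec m" "z \<noteq> 0\<^sub>v m" "A *\<^sub>v z = 0\<^sub>v k"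
proof -
  \<comment> \<open>Padding with zero rows gives a singular square matrix with the same
    kernel.\<close>
  define B where "B = mat m m (\<lambda>(i, j). if i < k then A $$ (i, j) else 0)"
  have B: "B \<in> carrier_mat m m" by (simp add: B_def)
  have "det B = 0"
  proof (rule ccontr)
    assume "det B \<noteq> 0"
    then obtain C where C: "C \<in> carrier_mat m m" "B * C = 1\<^sub>m m" using matrix_inverse[OF B] by metis
    have "(B * C) $$ (k, k) = 0" using assms(2) C(1) by (simp add: B_def scalar_prod_def)
    then show False unfolding C(2) using assms(2) by simp
  qed
  then obtain z where z: "z \<in> carrier_vec m" "z \<noteq> 0\<^sub>v m" "B *\<^sub>v z = 0\<^sub>v m"
    using det_0_iff_vec_prod_zero_field[OF B] by blast
  have "A *\<^sub>v z = 0\<^sub>v k"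
  proof (rule eq_vecI)
    fix i assume "i < dim_vec (0\<^sub>v k :: 'a vec)"
    then have i: "i < k" "i < m" using assms(2) by auto
    have "(A *\<^sub>v z) $ i = (B *\<^sub>v z) $ i" using i A z(1) by (simp add: B_def scalar_prod_def)
    then show "(A *\<^sub>v z) $ i = 0\<^sub>v k $ i" unfolding z(3) using i by simp
  qed (use A in auto)
  then show ?thesis using that z by blast
qed

lemma reflection_square:
  fixes P :: "'r::comm_ring_1 mat"
  assumes P: "P \<in> carrier_mat n n" "P * P = P"
  shows "(2 \<cdot>\<^sub>m P - 1\<^sub>m n) * (2 \<cdot>\<^sub>m P - 1\<^sub>m n) = 1\<^sub>m n"
proof -
  let ?T = "2 \<cdot>\<^sub>m P - 1\<^sub>m n"
  have T: "?T \<in> carrier_mat n n" using P by auto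
  have "P * ?T = P * (2 \<cdot>\<^sub>m P) - P * 1\<^sub>m n" using P by (intro mult_minus_distrib_mat[of _ n n]) auto
  also have "P * (2 \<cdot>\<^sub>m P) = 2 \<cdot>\<^sub>m P" using mult_smult_distrib[OF P(1) P(1)] P(2) by simp
  finally have PT: "P * ?T = P" using P(1) by (auto intro!: eq_matI)
  have "?T * ?T = 2 \<cdot>\<^sub>m P * ?T - 1\<^sub>m n * ?T" using P T by (intro minus_mult_distrib_mat[of _ n n _ _ n]) auto
  also have "2 \<cdot>\<^sub>m P * ?T = 2 \<cdot>\<^sub>m P" using mult_smult_assoc_mat[OF P(1) T] PT by simp
  finally show ?thesis using P(1) T by (auto intro!: eq_matI)
qed

lemma charpoly_factor_product:
  fixes B :: "'r::comm_ring_1 mat"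
  assumes B: "B \<in> carrier_mat n n" "B * B = 1\<^sub>m n"
  shows "(x \<cdot>\<^sub>m 1\<^sub>m n - B) * (x \<cdot>\<^sub>m 1\<^sub>m n + B) = (x * x - 1) \<cdot>\<^sub>m 1\<^sub>m n"
proof -
  let ?S = "x \<cdot>\<^sub>m 1\<^sub>m n + B"
  have S: "?S \<in> carrier_mat n n" using B by auto
  have "B * ?S = B * (x \<cdot>\<^sub>m 1\<^sub>m n) + B * B" using B by (intro mult_add_distrib_mat[of _ n n]) auto
  also have "B * (x \<cdot>\<^sub>m 1\<^sub>m n) = x \<cdot>\<^sub>m B" using mult_smult_distrib[OF B(1) one_carrier_mat] B by simp
  finally have BS: "B * ?S = x \<cdot>\<^sub>m B + 1\<^sub>m n" using B by simp
  have "(x \<cdot>\<^sub>m 1\<^sub>m n - B) * ?S = x \<cdot>\<^sub>m 1\<^sub>m n * ?S - B * ?S"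
    using B S by (intro minus_mult_distrib_mat[of _ n n _ _ n]) auto
  also have "x \<cdot>\<^sub>m 1\<^sub>m n * ?S = x \<cdot>\<^sub>m ?S" using mult_smult_assoc_mat[OF one_carrier_mat S] left_mult_one_mat[OF S] by simp
  finally show ?thesis unfolding BS using B(1) by (intro eq_matI) (auto simp: algebra_simps)
qed

section \<open>Involutions as frames up to a unitary change of basis\<close>

context quad_ext
begin

definition invol :: "nat \<Rightarrow> 'a mat \<Rightarrow> 'a mat" where
  "invol n Y = 2 \<cdot>\<^sub>m (Y * adj Y) - 1\<^sub>m n"

lemma frame_projection:
  assumes Y: "Y \<in> frames n k"
  shows "Y * adj Y \<in> carrier_mat n n" "Y * adj Y * (Y * adj Y) = Y * adj Y" "adj (Y * adj Y) = Y * adj Y"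
proof -
  have Yc: "Y \<in> carrier_mat n k" "adj Y * Y = 1\<^sub>m k" using Y by (auto simp: frames_def)
  show c: "Y * adj Y \<in> carrier_mat n n" using Yc(1) by auto
  have "Y * adj Y * (Y * adj Y) = Y * (adj Y * (Y * adj Y))"
    using Yc(1) c by (intro assoc_mult_mat[of _ n k _ n _ n]) auto
  also have "adj Y * (Y * adj Y) = adj Y * Y * adj Y"
    using Yc(1) by (intro assoc_mult_mat[symmetric, of _ k n _ k _ n]) auto
  finally show "Y * adj Y * (Y * adj Y) = Y * adj Y" using Yc by simp
  show "adj (Y * adj Y) = Y * adj Y" using adj_mult[OF Yc(1) adj_carrier[OF Yc(1)]] by simp
qed

lemma invol_carrier [simp]: "invol n Y \<in> carrier_mat n n"
  by (simp add: invol_def minus_carrier_mat)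

lemma invol_index:
  assumes "Y \<in> carrier_mat n k" "i < n" "j < n"
  shows "invol n Y $$ (i, j) = 2 * (Y * adj Y) $$ (i, j) - (if i = j then 1 else 0)"
  using assms by (simp add: invol_def del: index_mult_mat(1))

lemma invol_square: "Y \<in> frames n k \<Longrightarrow> invol n Y * invol n Y = 1\<^sub>m n"
  unfolding invol_def by (intro reflection_square frame_projection)

lemma cj_2 [simp]: "cj 2 = 2"
  using cj.hom_add[of 1 1] by simp

lemma adj_invol: "Y \<in> frames n k \<Longrightarrow> adj (invol n Y) = invol n Y"
  using frame_projection[of Y n k] unfolding invol_def by (simp add: adj_minus[of _ n n] adj_smult)

lemma invol_unitary: "Y \<in> frames n k \<Longrightarrow> invol n Y \<in> unitary n"
  using invol_square adj_invol by (simp add: unitary_def)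

lemma invol_conj:
  assumes U: "U \<in> unitary n" and Y: "Y \<in> frames n k"
  shows "invol n (U * Y) = U * invol n Y * adj U"
proof -
  have Uc: "U \<in> carrier_mat n n" and Yc: "Y \<in> carrier_mat n k" using U Y by (auto simp: unitary_def frames_def)
  have aU: "adj U \<in> carrier_mat n n" and aY: "adj Y \<in> carrier_mat k n" using Uc Yc by auto
  define P where "P = Y * adj Y"
  have P: "P \<in> carrier_mat n n" using frame_projection(1)[OF Y] by (simp add: P_def)
  have "U * Y * adj (U * Y) = U * Y * (adj Y * adj U)" using adj_mult[OF Uc Yc] by simp
  also have "\<dots> = U * Y * adj Y * adj U"
    using Uc Yc aU aY by (intro assoc_mult_mat[symmetric, of _ n k _ n _ n]) auto
  also have "U * Y * adj Y = U * P" unfolding P_def using Uc Yc aY by (intro assoc_mult_mat[of _ n n _ k _ n]) auto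
  finally have 1: "U * Y * adj (U * Y) = U * P * adj U" .
  have "U * (2 \<cdot>\<^sub>m P - 1\<^sub>m n) = U * (2 \<cdot>\<^sub>m P) - U * 1\<^sub>m n" using Uc P by (intro mult_minus_distrib_mat[of _ n n]) auto
  also have "\<dots> = 2 \<cdot>\<^sub>m (U * P) - U" using mult_smult_distrib[OF Uc P] Uc by simp
  finally have "U * (2 \<cdot>\<^sub>m P - 1\<^sub>m n) * adj U = (2 \<cdot>\<^sub>m (U * P) - U) * adj U" by simp
  also have "\<dots> = 2 \<cdot>\<^sub>m (U * P) * adj U - U * adj U"
    using Uc P aU by (intro minus_mult_distrib_mat[of _ n n _ _ n]) auto
  also have "2 \<cdot>\<^sub>m (U * P) * adj U = 2 \<cdot>\<^sub>m (U * P * adj U)"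
    using mult_smult_assoc_mat[OF mult_carrier_mat[OF Uc P] aU] .
  finally show ?thesis unfolding invol_def P_def[symmetric] 1 unitary_right[OF U] ..
qed

lemma invol_mult_vec:
  assumes Y: "Y \<in> frames n k" and v: "v \<in> carrier_vec n"
  shows "invol n Y *\<^sub>v v = 2 \<cdot>\<^sub>v (Y *\<^sub>v (adj Y *\<^sub>v v)) - v"
proof -
  have Yc: "Y \<in> carrier_mat n k" using Y by (simp add: frames_def)
  have "invol n Y *\<^sub>v v = 2 \<cdot>\<^sub>m (Y * adj Y) *\<^sub>v v - 1\<^sub>m n *\<^sub>v v"
    unfolding invol_def using frame_projection(1)[OF Y] v by (intro minus_mult_distrib_mat_vec) auto
  also have "2 \<cdot>\<^sub>m (Y * adj Y) *\<^sub>v v = 2 \<cdot>\<^sub>v (Y * adj Y *\<^sub>v v)"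
    using frame_projection(1)[OF Y] v by (intro eq_vecI) auto
  also have "Y * adj Y *\<^sub>v v = Y *\<^sub>v (adj Y *\<^sub>v v)"
    using Yc v by (intro assoc_mult_mat_vec[of _ n k _ n]) auto
  finally show ?thesis using v by simp
qed

text \<open>A nonzero idempotent has an \<open>x\<close> with \<open>adj x * e * x\<close> equal to
  1, and then e x is a unit vector fixed by \<open>e\<close>. Moving it to the first unit vector
  splits off a block 1 and leaves a smaller Hermitian idempotent.\<close>

lemma hermitian_idempotent:
  assumes "e \<in> carrier_mat n n" "adj e = e" "e * e = e"
  shows "\<exists>k. \<exists>Y\<in>frames n k. e = Y * adj Y"
  using assms
proof (induction n arbitrary: e)
  case 0
  then have "e = 0\<^sub>m 0 0 * adj (0\<^sub>m 0 0)" by (intro eq_matI) auto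
  moreover have "0\<^sub>m 0 0 \<in> frames 0 0" by (auto simp: frames_def intro!: eq_matI)
  ultimately show ?case by blast
next
  case (Suc n)
  note e = Suc.prems
  show ?case
  proof (cases "e = 0\<^sub>m (Suc n) (Suc n)")
    case True
    then have "e = 0\<^sub>m (Suc n) 0 * adj (0\<^sub>m (Suc n) 0)" by (intro eq_matI) (auto simp: scalar_prod_def)
    moreover have "0\<^sub>m (Suc n) 0 \<in> frames (Suc n) 0" by (auto simp: frames_def intro!: eq_matI)
    ultimately show ?thesis by blast
  next
    case False
    obtain x where x: "x \<in> carrier_mat (Suc n) 1" "adj x * e * x = 1\<^sub>m 1"
      using hermitian_ex_unit[OF e(1,2) False] .
    define y where "y = e * x"
    have y: "y \<in> carrier_mat (Suc n) 1" using e(1) x(1) by (simp add: y_def)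
    have ey: "e * y = y" unfolding y_def using assoc_mult_mat[OF e(1) e(1) x(1)] e(3) by simp
    have "adj y * y = adj x * e * y" unfolding y_def using adj_mult[OF e(1) x(1)] e(2) by simp
    also have "\<dots> = adj x * (e * y)" using e(1) x(1) y by (intro assoc_mult_mat[of _ 1 "Suc n" _ "Suc n" _ 1]) auto
    also have "e * y = e * x" using ey unfolding y_def[symmetric] .
    also have "adj x * (e * x) = 1\<^sub>m 1"
      unfolding x(2)[symmetric] using e(1) x(1) by (intro assoc_mult_mat[symmetric, of _ 1 "Suc n" _ "Suc n" _ 1]) auto
    finally have "y \<in> frames (Suc n) 1" using y by (simp add: frames_def)
    then obtain V where V: "V \<in> unitary (Suc n)" "V * y = unit_frame (Suc n) 1" "y = adj V * unit_frame (Suc n) 1"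
      by (rule frames_transitiveE)
    have Vc: "V \<in> carrier_mat (Suc n) (Suc n)" and aV: "adj V \<in> carrier_mat (Suc n) (Suc n)"
      using V by (auto simp: unitary_def)
    note ac = assoc_mult_mat[of _ "Suc n" "Suc n" _ "Suc n" _ "Suc n"]
    define f where "f = V * e * adj V"
    have f: "f \<in> carrier_mat (Suc n) (Suc n)" unfolding f_def using Vc e(1) aV by auto
    have fa: "adj f = f"
      unfolding f_def using adj_mult[OF mult_carrier_mat[OF Vc e(1)] aV] adj_mult[OF Vc e(1)] e(1,2) Vc aV
      by (simp add: ac)
    have "f * f = V * (e * (adj V * (V * (e * adj V))))" unfolding f_def using Vc e(1) aV by (simp add: ac)
    also have "adj V * (V * (e * adj V)) = e * adj V" using unitary_cancel(1)[OF V(1) mult_carrier_mat[OF e(1) aV]] .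
    also have "e * (e * adj V) = e * adj V" using assoc_mult_mat[OF e(1) e(1) aV] e(3) by simp
    also have "V * (e * adj V) = f" unfolding f_def using Vc e(1) aV by (simp add: ac)
    finally have ff: "f * f = f" .
    have "f * unit_frame (Suc n) 1 = V * e * (adj V * unit_frame (Suc n) 1)"
      unfolding f_def using Vc e(1) aV by (intro assoc_mult_mat[of _ "Suc n" "Suc n" _ "Suc n" _ 1]) auto
    also have "\<dots> = V * (e * y)" unfolding V(3)[symmetric] using Vc e(1) y by (intro assoc_mult_mat) auto
    also have "\<dots> = unit_frame (Suc n) 1" unfolding ey V(2) ..
    finally have fE: "f * unit_frame (Suc n) 1 = unit_frame (Suc n) 1" .
    have f0: "f $$ (i, 0) = (if i = 0 then 1 else 0)" if "i < Suc n" for i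
      using fE mult_unit_frame[OF f, of 1] that by (auto simp: unit_frame_def mat_eq_iff)
    have f0': "f $$ (0, j) = (if j = 0 then 1 else 0)" if j: "j < Suc n" for j
    proof -
      have "f $$ (0, j) = adj f $$ (0, j)" using fa by simp
      also have "\<dots> = cj (f $$ (j, 0))" using f j by simp
      finally show ?thesis using f0[OF j] by simp
    qed
    obtain g where g: "g \<in> carrier_mat n n" "f = one_block g"
      using one_blockI[OF f] f0 f0' by auto
    have "one_block (adj g) = one_block g" using fa g(2) by (simp add: adj_one_block)
    then have ga: "adj g = g" by (rule one_block_inj[OF adj_carrier[OF g(1)] g(1)])
    have "one_block (g * g) = one_block g" using ff one_block_mult[OF g(1) g(1)] unfolding g(2)[symmetric] by simp
    then have gg: "g * g = g" by (rule one_block_inj[OF mult_carrier_mat[OF g(1) g(1)] g(1)])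
    obtain k Y where Y: "Y \<in> frames n k" "g = Y * adj Y" using Suc.IH[OF g(1) ga gg] by blast
    have Yc: "Y \<in> carrier_mat n k" "adj Y * Y = 1\<^sub>m k" using Y(1) by (auto simp: frames_def)
    have Y1: "one_block Y \<in> frames (Suc n) (Suc k)"
      using Yc one_block_mult[OF adj_carrier[OF Yc(1)] Yc(1)] by (simp add: frames_def adj_one_block one_block_one)
    have fY: "f = one_block Y * adj (one_block Y)"
      using g(2) Y(2) one_block_mult[OF Yc(1) adj_carrier[OF Yc(1)]] by (simp add: adj_one_block)
    define W where "W = adj V * one_block Y"
    have W: "W \<in> frames (Suc n) (Suc k)" unfolding W_def using unitary_adj[OF V(1)] Y1 by (rule unitary_mult_frame)
    have Y1c: "one_block Y \<in> carrier_mat (Suc n) (Suc k)" using Yc by simp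
    have "W * adj W = adj V * one_block Y * (adj (one_block Y) * V)"
      unfolding W_def using adj_mult[OF aV Y1c] by simp
    also have "\<dots> = adj V * (one_block Y * (adj (one_block Y) * V))"
      using aV Y1c Vc by (intro assoc_mult_mat[of _ "Suc n" "Suc n" _ "Suc k" _ "Suc n"]) auto
    also have "one_block Y * (adj (one_block Y) * V) = f * V"
      unfolding fY using Y1c Vc by (intro assoc_mult_mat[symmetric, of _ "Suc n" "Suc k" _ "Suc n" _ "Suc n"]) auto
    also have "f * V = V * e"
    proof -
      have "f * V = V * (e * (adj V * V))" unfolding f_def using Vc e(1) aV by (simp add: ac)
      then show ?thesis using unitary_left[OF V(1)] Vc e(1) by simp
    qed
    also have "adj V * (V * e) = e" using unitary_cancel(1)[OF V(1) e(1)] .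
    finally show ?thesis using W by metis
  qed
qed

text \<open>A unitary involution is its own adjoint, so (t + 1)/2 is a Hermitian idempotent and
  factors through a frame.\<close>

lemma involution_eq_invol:
  assumes t: "t \<in> unitary n" "t * t = 1\<^sub>m n"
  obtains k Y where "Y \<in> frames n k" "t = invol n Y"
proof -
  have tc: "t \<in> carrier_mat n n" using t by (simp add: unitary_def)
  have "adj t * (t * t) = t" using unitary_cancel(1)[OF t(1) tc] .
  then have ta: "adj t = t" unfolding t(2) using tc by simp
  define c where "c = inverse (2 :: 'a)"
  have c: "c * 2 = 1" using two_neq_0 by (simp add: c_def)
  have cjc: "cj c = c" by (simp only: c_def cj.hom_inverse cj_2)
  define e where "e = c \<cdot>\<^sub>m (t + 1\<^sub>m n)"
  have e: "e \<in> carrier_mat n n" using tc by (simp add: e_def)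
  have ea: "adj e = e" using tc ta cjc by (simp add: e_def adj_smult adj_add[of _ n n])
  have s: "t + 1\<^sub>m n \<in> carrier_mat n n" using tc by simp
  have "(t + 1\<^sub>m n) * (t + 1\<^sub>m n) = t * (t + 1\<^sub>m n) + 1\<^sub>m n * (t + 1\<^sub>m n)"
    using tc s by (intro add_mult_distrib_mat[of _ n n _ _ n]) auto
  also have "t * (t + 1\<^sub>m n) = t * t + t * 1\<^sub>m n" using tc by (intro mult_add_distrib_mat[of _ n n]) auto
  finally have "(t + 1\<^sub>m n) * (t + 1\<^sub>m n) = 2 \<cdot>\<^sub>m (t + 1\<^sub>m n)"
    unfolding t(2) using tc by (auto intro!: eq_matI)
  moreover have "e * e = c \<cdot>\<^sub>m (c \<cdot>\<^sub>m ((t + 1\<^sub>m n) * (t + 1\<^sub>m n)))"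
    unfolding e_def using mult_smult_assoc_mat[OF s smult_carrier_mat[OF s]] mult_smult_distrib[OF s s] by simp
  moreover have "c \<cdot>\<^sub>m (c \<cdot>\<^sub>m (2 \<cdot>\<^sub>m (t + 1\<^sub>m n))) = c \<cdot>\<^sub>m (t + 1\<^sub>m n)"
  proof -
    have "a \<cdot>\<^sub>m (b \<cdot>\<^sub>m X) = (a * b) \<cdot>\<^sub>m X" for a b :: 'a and X
      by (rule eq_matI) (auto simp: mult.assoc)
    then show ?thesis by (simp add: mult.assoc c)
  qed
  ultimately have "e * e = e" unfolding e_def by simp
  then obtain k Y where Y: "Y \<in> frames n k" "e = Y * adj Y" using hermitian_idempotent[OF e ea] by blast
  have "t = 2 \<cdot>\<^sub>m e - 1\<^sub>m n"
    unfolding e_def using tc c by (intro eq_matI) (auto simp: mult.commute[of 2] simp flip: mult.assoc)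
  then show ?thesis using that Y by (simp add: invol_def)
qed

text \<open>A unitary conjugation moves the frame to the standard one, where the matrix minus the
  identity is diagonal with \<open>k\<close> entries 0 and the others -2.\<close>

lemma kernel_dim_invol:
  assumes Y: "Y \<in> frames n k"
  shows "kernel_dim (invol n Y - 1\<^sub>m n) = k"
proof -
  obtain U where U: "k \<le> n" "U \<in> unitary n" "U * Y = unit_frame n k" using frames_transitiveE[OF Y] .
  define r where "r = n - k"
  have n: "n = k + r" using U(1) by (simp add: r_def)
  have Uc: "U \<in> carrier_mat n n" and aU: "adj U \<in> carrier_mat n n" using U(2) by (auto simp: unitary_def)
  define A where "A = invol n Y - 1\<^sub>m n"
  have A: "A \<in> carrier_mat n n" by (simp add: A_def minus_carrier_mat)
  define N where "N = four_block_mat (0\<^sub>m k k) (0\<^sub>m k r) (0\<^sub>m r k) (- 2 \<cdot>\<^sub>m 1\<^sub>m r :: 'a mat)"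
  have N: "N \<in> carrier_mat n n" unfolding N_def n by (intro four_block_carrier_mat) auto
  have EE: "(unit_frame n k * adj (unit_frame n k)) $$ (i, j) = (if i = j \<and> i < k then 1 else 0)"
    if "i < n" "j < n" for i j
  proof -
    have "(unit_frame n k * adj (unit_frame n k)) $$ (i, j)
      = (\<Sum>l<k. (if i = l then 1 else 0) * cj (if j = l then 1 else 0))"
      using that by (simp add: unit_frame_def scalar_prod_def atLeast0LessThan adj_def)
    also have "\<dots> = (\<Sum>l<k. if l = i then (if i = j then 1 else 0) else 0)" by (rule sum.cong) auto
    also have "\<dots> = (if i = j \<and> i < k then 1 else 0)" by auto
    finally show ?thesis .
  qed
  have "U * A * adj U = invol n (U * Y) - 1\<^sub>m n"
  proof -
    have "U * A * adj U = (U * invol n Y - U) * adj U"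
      unfolding A_def using mult_minus_distrib_mat[OF Uc invol_carrier one_carrier_mat] Uc by simp
    also have "\<dots> = U * invol n Y * adj U - U * adj U"
      using Uc aU by (intro minus_mult_distrib_mat[of _ n n _ _ n]) auto
    finally show ?thesis using invol_conj[OF U(2) Y] unitary_right[OF U(2)] by simp
  qed
  also have "\<dots> = N"
  proof (rule eq_matI)
    fix i j assume "i < dim_row N" "j < dim_col N"
    then have ij: "i < n" "j < n" using N by auto
    then have "N $$ (i, j) = (if i = j \<and> \<not> i < k then - 2 else 0)" unfolding n N_def by auto
    then show "(invol n (U * Y) - 1\<^sub>m n) $$ (i, j) = N $$ (i, j)"
      unfolding U(3) using ij by (simp add: invol_index[OF unit_frame_carrier] EE del: index_mult_mat(1))
  qed (use N in \<open>auto simp: U(3)\<close>)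
  finally have UAU: "U * A * adj U = N" .
  have "similar_mat_wit N A U (adj U)"
    by (rule similar_mat_witI[OF unitary_right[OF U(2)] unitary_left[OF U(2)] UAU[symmetric] N A Uc aU])
  then have "kernel.dim n N = kernel.dim n A" by (rule similar_mat_wit_kernel_dim[OF N])
  moreover have "kernel.dim n N = kernel.dim k (0\<^sub>m k k :: 'a mat) + kernel.dim r (- 2 \<cdot>\<^sub>m 1\<^sub>m r :: 'a mat)"
    unfolding n by (rule kernel_four_block_0_mat[OF N_def]) auto
  moreover have "kernel.dim r (- 2 \<cdot>\<^sub>m 1\<^sub>m r :: 'a mat) = 0"
    using two_neq_0 by (intro kernel_upper_triangular) (auto simp: diag_mat_def)
  ultimately have "kernel.dim n A = k" by (simp add: kernel_dim_zero_mat)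
  then show ?thesis using A by (simp add: kernel_dim_def A_def[symmetric])
qed

text \<open>Equal involutions have equal projections, and then \<open>adj Y * Y'\<close> is the
  unitary change of basis between the two frames.\<close>

lemma invol_eq_iff:
  assumes "Y \<in> frames n k" "Y' \<in> frames n k"
  shows "invol n Y' = invol n Y \<longleftrightarrow> (\<exists>K\<in>unitary k. Y' = Y * K)"
proof
  have Y: "Y \<in> carrier_mat n k" "adj Y * Y = 1\<^sub>m k" "Y' \<in> carrier_mat n k" "adj Y' * Y' = 1\<^sub>m k"
    using assms by (auto simp: frames_def)
  assume "invol n Y' = invol n Y"
  then have idx: "invol n Y' $$ (i, j) = invol n Y $$ (i, j)" for i j by simp
  have P: "Y' * adj Y' = Y * adj Y"
  proof (rule eq_matI)
    fix i j assume "i < dim_row (Y * adj Y)" "j < dim_col (Y * adj Y)"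
    then have ij: "i < n" "j < n" using Y by auto
    have "2 * (Y' * adj Y') $$ (i, j) = 2 * (Y * adj Y) $$ (i, j)"
      using idx[of i j] unfolding invol_index[OF Y(1) ij] invol_index[OF Y(3) ij] by simp
    then show "(Y' * adj Y') $$ (i, j) = (Y * adj Y) $$ (i, j)"
      using two_neq_0 by (simp del: index_mult_mat(1))
  qed (use Y in auto)
  define K where "K = adj Y * Y'"
  have K: "K \<in> carrier_mat k k" unfolding K_def using mult_carrier_mat[OF adj_carrier[OF Y(1)] Y(3)] .
  have "Y * K = Y * adj Y * Y'" unfolding K_def using Y by (intro assoc_mult_mat[symmetric, of _ n k _ n _ k]) auto
  also have "\<dots> = Y' * adj Y' * Y'" unfolding P ..
  also have "\<dots> = Y' * (adj Y' * Y')" using Y by (intro assoc_mult_mat[of _ n k _ n _ k]) auto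
  finally have YK: "Y * K = Y'" using Y by simp
  have "adj K * K = adj Y' * Y * (adj Y * Y')" unfolding K_def using adj_mult[OF adj_carrier[OF Y(1)] Y(3)] by simp
  also have "\<dots> = adj Y' * (Y * (adj Y * Y'))" using Y by (intro assoc_mult_mat[of _ k n _ k _ k]) auto
  also have "Y * (adj Y * Y') = Y'" using YK unfolding K_def .
  finally have "K \<in> unitary k" using K Y(4) by (simp add: unitary_def)
  then show "\<exists>K\<in>unitary k. Y' = Y * K" using YK by auto
next
  have Y: "Y \<in> carrier_mat n k" using assms by (auto simp: frames_def)
  assume "\<exists>K\<in>unitary k. Y' = Y * K"
  then obtain K where K: "K \<in> unitary k" "Y' = Y * K" by blast
  have Kc: "K \<in> carrier_mat k k" using K by (simp add: unitary_def)
  have "Y' * adj Y' = Y * K * (adj K * adj Y)" unfolding K(2) using adj_mult[OF Y Kc] by simp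
  also have "\<dots> = Y * (K * (adj K * adj Y))" using Y Kc by (intro assoc_mult_mat[of _ n k _ k _ n]) auto
  also have "K * (adj K * adj Y) = adj Y" using unitary_cancel(2)[OF K(1) adj_carrier[OF Y]] .
  finally show "invol n Y' = invol n Y" by (simp add: invol_def)
qed

lemma card_invol_fibre:
  assumes "Y \<in> frames n k"
  shows "card {Y' \<in> frames n k. invol n Y' = invol n Y} = card (unitary k)"
proof -
  have Y: "Y \<in> carrier_mat n k" "adj Y * Y = 1\<^sub>m k" using assms by (auto simp: frames_def)
  have "bij_betw (\<lambda>K. Y * K) (unitary k) {Y' \<in> frames n k. invol n Y' = invol n Y}"
  proof (rule bij_betwI[where g = "\<lambda>Z. adj Y * Z"])
    have YK: "adj Y * (Y * K) = K" if "K \<in> unitary k" for K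
    proof -
      have K: "K \<in> carrier_mat k k" using that by (simp add: unitary_def)
      have "adj Y * (Y * K) = adj Y * Y * K" using Y(1) K by (intro assoc_mult_mat[symmetric, of _ k n _ k _ k]) auto
      then show ?thesis using Y(2) K by simp
    qed
    show "(\<lambda>K. Y * K) \<in> unitary k \<rightarrow> {Y' \<in> frames n k. invol n Y' = invol n Y}"
      using invol_eq_iff[OF assms] frame_mult_unitary[OF assms] by blast
    show "(\<lambda>Z. adj Y * Z) \<in> {Y' \<in> frames n k. invol n Y' = invol n Y} \<rightarrow> unitary k"
      using invol_eq_iff[OF assms] YK by auto
    show "\<And>K. K \<in> unitary k \<Longrightarrow> adj Y * (Y * K) = K" by (rule YK)
    show "\<And>Z. Z \<in> {Y' \<in> frames n k. invol n Y' = invol n Y} \<Longrightarrow> Y * (adj Y * Z) = Z"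
      using invol_eq_iff[OF assms] YK by auto
  qed
  then show ?thesis by (rule bij_betw_same_card[symmetric])
qed

text \<open>The form conjugates its second argument, so the isometry condition is the transpose of
  \<open>adj A * A = 1\<^sub>m n\<close>.\<close>

lemma carrier_GU: "carrier (GU n q :: 'a mat monoid) = unitary n"
proof (intro equalityI subsetI)
  have q: "q > 0" using q_ge_3 by simp
  have cj_eq: "(\<lambda>x :: 'a. x ^ q) = cj" by (simp add: cj_def fun_eq_iff)
  {
    fix A :: "'a mat" assume A: "A \<in> carrier (GU n q)"
    then have "A \<in> carrier_mat n n" by (simp add: GU_def)
    then show "A \<in> unitary n"
      using isometry_left_inverse[OF q A] unfolding cj_eq by (simp add: unitary_def adj_def)
  }
  fix A assume A: "A \<in> unitary n"
  have Ac: "A \<in> carrier_mat n n" using A by (simp add: unitary_def)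
  have "unitary_form q (A *\<^sub>v u) (A *\<^sub>v v) = unitary_form q u v" if u: "u \<in> carrier_vec n" and v: "v \<in> carrier_vec n" for u v
  proof -
    have wc: "map_vec cj (A *\<^sub>v v) \<in> carrier_vec n" using Ac v by simp
    have "map_vec cj (A *\<^sub>v v) = map_mat cj A *\<^sub>v map_vec cj v" by (rule cj.mult_mat_vec_hom[OF Ac v])
    moreover have "transpose_mat A *\<^sub>v (map_mat cj A *\<^sub>v map_vec cj v) = transpose_mat A * map_mat cj A *\<^sub>v map_vec cj v"
      using Ac v by (intro assoc_mult_mat_vec[symmetric, of _ n n _ n]) auto
    moreover have "transpose_mat A * map_mat cj A = 1\<^sub>m n"
    proof -
      have "transpose_mat (adj A * A) = transpose_mat A * map_mat cj A"
        using Ac by (subst transpose_mult[of _ n n _ n]) (auto simp: adj_def)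
      then show ?thesis unfolding unitary_left[OF A] by simp
    qed
    ultimately have "transpose_mat A *\<^sub>v map_vec cj (A *\<^sub>v v) = map_vec cj v" using v by simp
    then have "(A *\<^sub>v u) \<bullet> map_vec cj (A *\<^sub>v v) = u \<bullet> map_vec cj v"
      using transpose_vec_mult_scalar[OF Ac u wc] Ac u v wc
      by (metis comm_scalar_prod mult_mat_vec_carrier map_carrier_vec)
    then show ?thesis unfolding unitary_form_def cj_eq .
  qed
  then show "A \<in> carrier (GU n q)" using Ac by (simp add: GU_def)
qed

lemma GU_simps [simp]: "mult (GU n q :: 'a mat monoid) = (*)" "one (GU n q :: 'a mat monoid) = 1\<^sub>m n"
  by (simp_all add: GU_def)

lemma order_GU: "Coset.order (GU n q :: 'a mat monoid) = card (unitary n)"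
  by (simp add: Coset.order_def carrier_GU)

lemma inv_GU:
  assumes "A \<in> unitary n"
  shows "inv\<^bsub>GU n q\<^esub> A = adj A"
proof -
  interpret group "GU n q :: 'a mat monoid" using q_ge_3 by (intro GU_group) simp
  show ?thesis
    using assms unitary_adj[OF assms] unitary_left[OF assms] by (intro inv_equality) (auto simp: carrier_GU)
qed

lemma C_U_eq:
  assumes "n > 0"
  shows "C_U n q = invol n ` frames n (n div 2)"
proof (intro equalityI subsetI)
  fix t :: "'a mat" assume "t \<in> C_U n q"
  then have t: "t \<in> unitary n" "t * t = 1\<^sub>m n" and k: "kernel_dim (t - 1\<^sub>m n) = n div 2"
    by (auto simp: C_U_def carrier_GU)
  obtain k Y where Y: "Y \<in> frames n k" "t = invol n Y" using involution_eq_invol[OF t] .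
  then have "k = n div 2" using k kernel_dim_invol[OF Y(1)] by simp
  then show "t \<in> invol n ` frames n (n div 2)" using Y by blast
next
  fix t assume "t \<in> invol n ` frames n (n div 2)"
  then obtain Y where Y: "Y \<in> frames n (n div 2)" "t = invol n Y" by blast
  \<comment> \<open>The identity has a fixed space of dimension \<open>n\<close>, which differs from
    \<open>n div 2\<close> because \<open>n > 0\<close>.\<close>
  have "t \<noteq> 1\<^sub>m n"
  proof
    assume t1: "t = 1\<^sub>m n"
    have "1\<^sub>m n \<in> frames n n" by (simp add: frames_def)
    moreover have "invol n (1\<^sub>m n) = t" unfolding t1 invol_def by (auto intro!: eq_matI)
    ultimately have "n div 2 = n" using kernel_dim_invol[of "1\<^sub>m n" n n] kernel_dim_invol[OF Y(1)] Y(2) by simp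
    then show False using assms by simp
  qed
  then show "t \<in> C_U n q"
    using Y invol_unitary invol_square kernel_dim_invol by (auto simp: C_U_def carrier_GU)
qed

lemma finite_C_U [simp]: "finite (C_U n q :: 'a mat set)"
  by (rule finite_subset[OF _ finite_unitary[of n]]) (auto simp: C_U_def carrier_GU)

lemma card_C_U:
  assumes "n > 0"
  shows "card (frames n (n div 2)) = card (C_U n q :: 'a mat set) * card (unitary (n div 2))"
proof (rule card_eq_fibres[of _ _ "invol n"])
  fix t :: "'a mat" assume "t \<in> C_U n q"
  then obtain Y where "Y \<in> frames n (n div 2)" "t = invol n Y" using C_U_eq[OF assms] by auto
  then show "card {Y' \<in> frames n (n div 2). invol n Y' = t} = card (unitary (n div 2))"
    using card_invol_fibre by simp
qed (auto simp: C_U_eq[OF assms])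

lemma C_U_conj:
  assumes "n > 0" "t \<in> C_U n q" "U \<in> unitary n"
  shows "U * t * adj U \<in> C_U n q"
proof -
  obtain Y where Y: "Y \<in> frames n (n div 2)" "t = invol n Y" using assms C_U_eq by auto
  then have "U * t * adj U = invol n (U * Y)" using invol_conj[OF assms(3) Y(1)] by simp
  then show ?thesis using C_U_eq[OF assms(1)] unitary_mult_frame[OF assms(3) Y(1)] by auto
qed

lemma unitary_mult: "A \<in> unitary n \<Longrightarrow> B \<in> unitary n \<Longrightarrow> A * B \<in> unitary n"
  using unitary_mult_frame[of A n B n] by (simp add: frames_square)

section \<open>Products of two balanced involutions\<close>

definition base_invol :: "nat \<Rightarrow> nat \<Rightarrow> 'a mat" where
  "base_invol n m = invol n (unit_frame n m)"

text \<open>The Gram matrix of the projections of the columns of \<open>Y\<close> to the first \<open>m\<close> coordinates.\<close>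

definition top_gram :: "nat \<Rightarrow> nat \<Rightarrow> 'a mat \<Rightarrow> 'a mat" where
  "top_gram n m Y = adj (adj (unit_frame n m) * Y) * (adj (unit_frame n m) * Y)"

lemma base_invol_index:
  assumes "m \<le> n" "i < n" "j < n"
  shows "base_invol n m $$ (i, j) = (if i = j then if i < m then 1 else - 1 else 0)"
proof -
  have "(unit_frame n m * adj (unit_frame n m)) $$ (i, j)
      = (\<Sum>l<m. (if i = l then 1 else 0) * cj (if j = l then 1 else 0))"
    using assms by (simp add: unit_frame_def scalar_prod_def atLeast0LessThan adj_def)
  also have "\<dots> = (\<Sum>l<m. if l = i then (if i = j then 1 else 0) else 0)" by (rule sum.cong) auto
  also have "\<dots> = (if i = j \<and> i < m then 1 else 0)" by auto
  finally show ?thesis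
    using assms by (simp add: base_invol_def invol_index[OF unit_frame_carrier] del: index_mult_mat(1))
qed

lemma char_poly_base_invol_mult:
  assumes Y: "Y \<in> frames n m" and n: "n = m + r" "m \<le> r"
  shows "char_poly (base_invol n m * invol n Y)
    = [:-1, 1:] ^ (r - m) * homog ([:1, 1:]\<^sup>2) [:0, 4:] m (char_poly (top_gram n m Y))"
proof -
  interpret const: comm_ring_hom "\<lambda>c :: 'a. [:c:]" by unfold_locales (auto simp: one_pCons)
  define C :: "'a mat \<Rightarrow> 'a poly mat" where "C = map_mat (\<lambda>c. [:c:])"
  define X :: "'a poly" where "X = [:0, 1:]"
  define D where "D = base_invol n m"
  define E where "E = unit_frame n m"
  define Z where "Z = top_gram n m Y"
  have Cc: "C A \<in> carrier_mat a b" if "A \<in> carrier_mat a b" for A a b using that by (simp add: C_def)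
  have Cm: "C (A * B) = C A * C B" if "A \<in> carrier_mat a b" "B \<in> carrier_mat b c" for A B a b c
    unfolding C_def using that by (rule const.mat_hom_mult)
  have C1: "C (1\<^sub>m k) = 1\<^sub>m k" for k unfolding C_def by (rule eq_matI) auto
  have Yc: "Y \<in> carrier_mat n m" "adj Y * Y = 1\<^sub>m m" using Y by (auto simp: frames_def)
  have aY: "adj Y \<in> carrier_mat m n" using Yc by simp
  have Ef: "E \<in> frames n m" unfolding E_def using n by (intro unit_frame_in_frames) simp
  have Ec: "E \<in> carrier_mat n m" unfolding E_def by (rule unit_frame_carrier)
  have Dc: "D \<in> carrier_mat n n" by (simp add: D_def base_invol_def)
  have DD: "D * D = 1\<^sub>m n" unfolding D_def base_invol_def using Ef unfolding E_def by (rule invol_square)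
  have DY: "D * Y \<in> carrier_mat n m" using Dc Yc by simp
  \<comment> \<open>The matrix x - D (2 Y adj Y - 1) is the diagonal matrix x + D minus 2 D Y adj Y,
    a product passing through dimension \<open>m\<close>. As \<open>D\<close> is an involution, x -
    D inverts x + D up to x^2 - 1, which is the setting of \<open>sylvester_det\<close>.\<close>
  define U where "U = C (2 \<cdot>\<^sub>m (D * Y))"
  define V where "V = C (adj Y)"
  define S where "S = X \<cdot>\<^sub>m 1\<^sub>m n + C D"
  define S' where "S' = X \<cdot>\<^sub>m 1\<^sub>m n - C D"
  have U: "U \<in> carrier_mat n m" and V: "V \<in> carrier_mat m n" and CD: "C D \<in> carrier_mat n n"
    using DY aY Dc by (auto simp: U_def V_def Cc)
  have S: "S \<in> carrier_mat n n" "S' \<in> carrier_mat n n" using CD by (auto simp: S_def S'_def)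
  have SS: "S' * S = (X * X - 1) \<cdot>\<^sub>m 1\<^sub>m n"
    unfolding S_def S'_def using CD Cm[OF Dc Dc] DD C1 by (intro charpoly_factor_product) auto
  have syl: "(X * X - 1) ^ m * det (S - U * V) = det S * det ((X * X - 1) \<cdot>\<^sub>m 1\<^sub>m m - V * S' * U)"
    using S U V SS by (rule sylvester_det)
  have "S - U * V = char_poly_matrix (D * invol n Y)"
  proof -
    define P where "P = Y * adj Y"
    have P: "P \<in> carrier_mat n n" unfolding P_def using Yc aY by simp
    have "2 \<cdot>\<^sub>m (D * Y) * adj Y = 2 \<cdot>\<^sub>m (D * Y * adj Y)" using DY aY by (rule mult_smult_assoc_mat)
    also have "D * Y * adj Y = D * P" unfolding P_def using Dc Yc(1) aY by (rule assoc_mult_mat)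
    finally have "2 \<cdot>\<^sub>m (D * Y) * adj Y = 2 \<cdot>\<^sub>m (D * P)" .
    then have UV: "U * V = C (2 \<cdot>\<^sub>m (D * P))"
      unfolding U_def V_def using Cm[OF smult_carrier_mat[OF DY] aY, of 2] by simp
    have "D * invol n Y = D * (2 \<cdot>\<^sub>m P) - D * 1\<^sub>m n"
      unfolding invol_def P_def[symmetric] using Dc P by (intro mult_minus_distrib_mat[of _ n n]) auto
    also have "D * (2 \<cdot>\<^sub>m P) = 2 \<cdot>\<^sub>m (D * P)" using Dc P by (rule mult_smult_distrib)
    finally have T: "D * invol n Y = 2 \<cdot>\<^sub>m (D * P) - D" using Dc by simp
    have DP: "D * P \<in> carrier_mat n n" using Dc P by simp
    show ?thesis
      unfolding UV T S_def C_def X_def char_poly_matrix_def using Dc DP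
      by (intro eq_matI) (auto simp del: index_mult_mat(1))
  qed
  then have detSUV: "det (S - U * V) = char_poly (D * invol n Y)" by (simp add: char_poly_def)
  have DZ: "adj Y * (D * Y) = 2 \<cdot>\<^sub>m Z - 1\<^sub>m m"
  proof -
    have aE: "adj E \<in> carrier_mat m n" using Ec by simp
    define W where "W = adj E * Y"
    have W: "W \<in> carrier_mat m m" unfolding W_def using aE Yc by simp
    have aW: "adj W = adj Y * E" unfolding W_def using adj_mult[OF aE Yc(1)] by simp
    have "D * Y = 2 \<cdot>\<^sub>m (E * adj E) * Y - 1\<^sub>m n * Y"
      unfolding D_def base_invol_def invol_def E_def[symmetric]
      using Ec Yc by (intro minus_mult_distrib_mat[of _ n n _ _ m]) auto
    also have "2 \<cdot>\<^sub>m (E * adj E) * Y = 2 \<cdot>\<^sub>m (E * adj E * Y)"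
      using mult_carrier_mat[OF Ec aE] Yc(1) by (rule mult_smult_assoc_mat)
    also have "E * adj E * Y = E * W" unfolding W_def using Ec aE Yc(1) by (rule assoc_mult_mat)
    finally have DY_eq: "D * Y = 2 \<cdot>\<^sub>m (E * W) - Y" using Yc by simp
    have EW: "E * W \<in> carrier_mat n m" using Ec W by simp
    have "adj Y * (D * Y) = adj Y * (2 \<cdot>\<^sub>m (E * W)) - adj Y * Y"
      unfolding DY_eq using aY EW Yc by (intro mult_minus_distrib_mat[of _ m n]) auto
    also have "adj Y * (2 \<cdot>\<^sub>m (E * W)) = 2 \<cdot>\<^sub>m (adj Y * (E * W))" using aY EW by (rule mult_smult_distrib)
    also have "adj Y * (E * W) = adj Y * E * W" using aY Ec W by (rule assoc_mult_mat[symmetric])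
    also have "\<dots> = Z" unfolding Z_def top_gram_def aW[symmetric] E_def[symmetric] W_def[symmetric] ..
    finally show ?thesis unfolding Yc(2) .
  qed
  have Z: "Z \<in> carrier_mat m m" unfolding Z_def top_gram_def using Ec Yc by (auto simp: E_def[symmetric])
  \<comment> \<open>Using \<open>D * D = 1\<^sub>m n\<close>, the product \<open>V * S' * U\<close>
    is 2 x (2 Z - 1) - 2; subtracting it from x^2 - 1 completes the square (x + 1)^2.\<close>
  have "(X * X - 1) \<cdot>\<^sub>m 1\<^sub>m m - V * S' * U = ([:1, 1:]\<^sup>2) \<cdot>\<^sub>m 1\<^sub>m m - [:0, 4:] \<cdot>\<^sub>m C Z"
  proof -
    have VS: "V * S' = X \<cdot>\<^sub>m V - V * C D"
    proof -
      have "V * S' = V * (X \<cdot>\<^sub>m 1\<^sub>m n) - V * C D"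
        unfolding S'_def using V CD by (intro mult_minus_distrib_mat[of _ m n]) auto
      also have "V * (X \<cdot>\<^sub>m 1\<^sub>m n) = X \<cdot>\<^sub>m V" using mult_smult_distrib[OF V one_carrier_mat] V by simp
      finally show ?thesis .
    qed
    have VCD: "V * C D \<in> carrier_mat m n" using V CD by simp
    have "V * S' * U = X \<cdot>\<^sub>m V * U - V * C D * U"
      unfolding VS using V VCD U by (intro minus_mult_distrib_mat[of _ m n _ _ m]) auto
    also have "X \<cdot>\<^sub>m V * U = X \<cdot>\<^sub>m (V * U)" using V U by (rule mult_smult_assoc_mat)
    also have "V * U = C (2 \<cdot>\<^sub>m (2 \<cdot>\<^sub>m Z - 1\<^sub>m m))"
    proof -
      have "V * U = C (adj Y * (2 \<cdot>\<^sub>m (D * Y)))" unfolding U_def V_def 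
        by (rule Cm[OF aY smult_carrier_mat[OF DY], symmetric])
      also have "adj Y * (2 \<cdot>\<^sub>m (D * Y)) = 2 \<cdot>\<^sub>m (adj Y * (D * Y))" using aY DY by (rule mult_smult_distrib)
      finally show ?thesis unfolding DZ .
    qed
    also have "V * C D * U = C (2 \<cdot>\<^sub>m 1\<^sub>m m)"
    proof -
      have "V * C D * U = V * (C D * U)" using V CD U by (rule assoc_mult_mat)
      also have "C D * U = C (D * (2 \<cdot>\<^sub>m (D * Y)))" 
        unfolding U_def by (rule Cm[OF Dc smult_carrier_mat[OF DY], symmetric])
      also have "D * (2 \<cdot>\<^sub>m (D * Y)) = 2 \<cdot>\<^sub>m (D * (D * Y))" using Dc DY by (rule mult_smult_distrib)
      also have "D * (D * Y) = Y" using assoc_mult_mat[OF Dc Dc Yc(1)] DD Yc by simp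
      also have "V * C (2 \<cdot>\<^sub>m Y) = C (adj Y * (2 \<cdot>\<^sub>m Y))" 
        unfolding V_def by (rule Cm[OF aY smult_carrier_mat[OF Yc(1)], symmetric])
      also have "adj Y * (2 \<cdot>\<^sub>m Y) = 2 \<cdot>\<^sub>m (adj Y * Y)" using aY Yc(1) by (rule mult_smult_distrib)
      finally show ?thesis unfolding Yc(2) .
    qed
    finally show ?thesis
      using Z by (intro eq_matI) (auto simp: C_def X_def power2_eq_square algebra_simps numeral_poly)
  qed
  then have detW: "det ((X * X - 1) \<cdot>\<^sub>m 1\<^sub>m m - V * S' * U) = homog ([:1, 1:]\<^sup>2) [:0, 4:] m (char_poly Z)"
    using det_eq_homog_char_poly[OF Z, of "[:0, 4:]" "[:1, 1:]\<^sup>2"] four[OF two_neq_0] by (simp add: C_def)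
  have "S = four_block_mat ([:1, 1:] \<cdot>\<^sub>m 1\<^sub>m m) (0\<^sub>m m r) (0\<^sub>m r m) ([:-1, 1:] \<cdot>\<^sub>m 1\<^sub>m r)"
    (is "_ = ?B")
  proof (rule eq_matI)
    fix i j assume "i < dim_row ?B" "j < dim_col ?B"
    then have ij: "i < n" "j < n" using n by auto
    then have "S $$ (i, j) = X * (if i = j then 1 else 0) + [:D $$ (i, j):]"
      unfolding S_def C_def using Dc by simp
    also have "\<dots> = ?B $$ (i, j)"
      using ij n by (auto simp: D_def base_invol_index X_def)
        (auto simp: poly_eq_iff coeff_pCons split: nat.splits)
    finally show "S $$ (i, j) = ?B $$ (i, j)" .
  qed (use S n in auto)
  then have "det S = [:1, 1:] ^ m * [:-1, 1:] ^ r"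
    by (simp add: det_four_block_mat_lower_left_zero[of _ m _ r])
  moreover have XX: "X * X - 1 = [:1, 1:] * [:-1, 1:]" 
    unfolding X_def by (simp, auto simp: poly_eq_iff coeff_pCons split: nat.splits)
  moreover have "[:-1, 1::'a:] ^ r = [:-1, 1:] ^ m * [:-1, 1:] ^ (r - m)" using n by (simp flip: power_add)
  \<comment> \<open>Sylvester's identity carries the factor (x^2 - 1)^m. The determinant (x + 1)^m
    (x - 1)^r of \<open>S\<close> contains it and leaves (x - 1)^(r - m).\<close>
  ultimately have eq: "([:1, 1:] ^ m * [:-1, 1:] ^ m) * char_poly (D * invol n Y)
      = ([:1, 1:] ^ m * [:-1, 1:] ^ m) * ([:-1, 1:] ^ (r - m) * homog ([:1, 1:]\<^sup>2) [:0, 4:] m (char_poly Z))"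
    using syl unfolding detSUV detW unfolding XX power_mult_distrib by (simp only: mult_ac)
  have "[:1, 1::'a:] ^ m * [:-1, 1:] ^ m \<noteq> 0" by simp
  from iffD1[OF mult_left_cancel[OF this] eq] show ?thesis unfolding D_def Z_def .
qed

lemma top_gram_hermitian: "Y \<in> carrier_mat n m \<Longrightarrow> top_gram n m Y \<in> hermitian m"
proof -
  assume Y: "Y \<in> carrier_mat n m"
  have W: "adj (unit_frame n m) * Y \<in> carrier_mat m m"
    using adj_carrier[OF unit_frame_carrier[of n m]] Y by (rule mult_carrier_mat)
  then show ?thesis
    using adj_mult[OF adj_carrier[OF W] W] mult_carrier_mat[OF adj_carrier[OF W] W]
    by (simp add: hermitian_def top_gram_def)
qed

lemma squarefree_base_invol_mult_iff:
  assumes Y: "Y \<in> frames n m" and n: "n = m + r" "m \<le> r" "r \<le> Suc m"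
  shows "squarefree (char_poly (base_invol n m * invol n Y)) \<longleftrightarrow> top_gram n m Y \<in> good_hermitian m"
proof -
  have Z: "top_gram n m Y \<in> hermitian m" using Y by (intro top_gram_hermitian) (simp add: frames_def)
  then have Zc: "top_gram n m Y \<in> carrier_mat m m" by (simp add: hermitian_def)
  have "char_poly (top_gram n m Y) \<in> monics m"
    using degree_char_poly[OF Zc] lead_coeff_char_poly[OF Zc] by (simp add: monics_def)
  then show ?thesis
    unfolding char_poly_base_invol_mult[OF Y n(1,2)] using n Z
    by (subst squarefree_homog_iff[OF two_neq_0]) (auto simp: good_hermitian_def)
qed

lemma good_hermitian_det:
  assumes "Z \<in> good_hermitian m"
  shows "det Z \<noteq> 0" "det (1\<^sub>m m - Z) \<noteq> 0"
proof -
  have Z: "Z \<in> carrier_mat m m" using assms by (simp add: good_hermitian_def hermitian_def)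
  have "- char_matrix Z 0 = - 1 \<cdot>\<^sub>m Z" using Z by (intro eq_matI) (auto simp: char_matrix_def)
  then have "poly (char_poly Z) 0 = (- 1) ^ m * det Z" using char_poly_matrix[OF Z, of 0] Z by simp
  then show "det Z \<noteq> 0" using assms by (auto simp: good_hermitian_def)
  have "- char_matrix Z 1 = 1\<^sub>m m - Z" using Z by (intro eq_matI) (auto simp: char_matrix_def)
  then show "det (1\<^sub>m m - Z) \<noteq> 0" using char_poly_matrix[OF Z, of 1] assms by (simp add: good_hermitian_def)
qed

text \<open>The top block of \<open>Y\<close> has Gram matrix \<open>Z\<close>, and orthonormality
  says exactly that the bottom block has Gram matrix \<open>1\<^sub>m m - Z\<close>. Both are
  nonsingular, so the blocks can be chosen independently with counts not depending on
  \<open>Z\<close>.\<close>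

lemma card_top_gram_fibre:
  assumes Z: "Z \<in> good_hermitian m"
  shows "card {Y \<in> frames (m + r) m. top_gram (m + r) m Y = Z} = card (unitary m) * card (frames r m)"
proof -
  have Zc: "Z \<in> carrier_mat m m" "adj Z = Z" using Z by (auto simp: good_hermitian_def hermitian_def)
  define A where "A = {Y \<in> carrier_mat m m. adj Y * Y = Z}"
  define B where "B = {Y \<in> carrier_mat r m. adj Y * Y = 1\<^sub>m m - Z}"
  define top where "top = (\<lambda>Y :: 'a mat. mat m m (\<lambda>ij. Y $$ ij))"
  define bot where "bot = (\<lambda>Y :: 'a mat. mat r m (\<lambda>(i, j). Y $$ (m + i, j)))"
  define join where "join = (\<lambda>(Y :: 'a mat, Y' :: 'a mat). mat (m + r) m (\<lambda>(i, j). if i < m then Y $$ (i, j) else Y' $$ (i - m, j)))"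
  have sum_split: "(\<Sum>k<m + r. f k) = (\<Sum>k<m. f k) + (\<Sum>k<r. f (m + k))" for f :: "nat \<Rightarrow> 'a"
    by (induction r) (auto simp: add.assoc)
  have prod_index: "(adj Y * Y) $$ (i, j) = (\<Sum>k<a. cj (Y $$ (k, i)) * Y $$ (k, j))"
    if "Y \<in> carrier_mat a m" "i < m" "j < m" for Y a i j
    using that by (simp add: scalar_prod_def atLeast0LessThan)
  have gram: "adj Y * Y = adj (top Y) * top Y + adj (bot Y) * bot Y" if Y: "Y \<in> carrier_mat (m + r) m" for Y
  proof (rule eq_matI)
    fix i j assume "i < dim_row (adj (top Y) * top Y + adj (bot Y) * bot Y)"
      "j < dim_col (adj (top Y) * top Y + adj (bot Y) * bot Y)"
    then have ij: "i < m" "j < m" by (auto simp: bot_def)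
    have "(adj Y * Y) $$ (i, j) = (\<Sum>k<m. cj (Y $$ (k, i)) * Y $$ (k, j)) + (\<Sum>k<r. cj (Y $$ (m + k, i)) * Y $$ (m + k, j))"
      using prod_index[OF Y ij] by (simp add: sum_split)
    also have "(\<Sum>k<m. cj (Y $$ (k, i)) * Y $$ (k, j)) = (adj (top Y) * top Y) $$ (i, j)"
      using prod_index[of "top Y" m i j] ij by (simp add: top_def)
    also have "(\<Sum>k<r. cj (Y $$ (m + k, i)) * Y $$ (m + k, j)) = (adj (bot Y) * bot Y) $$ (i, j)"
      using prod_index[of "bot Y" r i j] ij by (simp add: bot_def)
    finally show "(adj Y * Y) $$ (i, j) = (adj (top Y) * top Y + adj (bot Y) * bot Y) $$ (i, j)"
      using ij by (simp add: bot_def del: index_mult_mat(1))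
  qed (use Y in \<open>auto simp: bot_def\<close>)
  have top_gram: "top_gram (m + r) m Y = adj (top Y) * top Y" if Y: "Y \<in> carrier_mat (m + r) m" for Y
  proof -
    have "adj (adj (unit_frame (m + r) m) * Y) = adj Y * unit_frame (m + r) m"
      using adj_mult[OF adj_carrier[OF unit_frame_carrier] Y] by simp
    also have "\<dots> = adj (top Y)"
      using Y by (subst mult_unit_frame[of _ m "m + r"]) (auto simp: top_def intro!: eq_matI)
    finally have "adj (adj (unit_frame (m + r) m) * Y) = adj (top Y)" .
    moreover from this have "adj (unit_frame (m + r) m) * Y = top Y" by (metis adj_adj)
    ultimately show ?thesis by (simp add: top_gram_def)
  qed
  have tb: "top Y \<in> carrier_mat m m" "bot Y \<in> carrier_mat r m" for Y by (auto simp: top_def bot_def)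
  have jc: "join z \<in> carrier_mat (m + r) m" for z by (simp add: join_def split: prod.splits)
  have tj: "top (join (Y, Y')) = Y" "bot (join (Y, Y')) = Y'" if "Y \<in> carrier_mat m m" "Y' \<in> carrier_mat r m" for Y Y'
    using that by (auto simp: top_def bot_def join_def intro!: eq_matI)
  have jt: "join (top Y, bot Y) = Y" if "Y \<in> carrier_mat (m + r) m" for Y
    using that by (auto simp: top_def bot_def join_def intro!: eq_matI)
  have bij: "bij_betw join (A \<times> B) {Y \<in> frames (m + r) m. top_gram (m + r) m Y = Z}"
  proof (rule bij_betwI[where g = "\<lambda>Y. (top Y, bot Y)"])
    show "join \<in> A \<times> B \<rightarrow> {Y \<in> frames (m + r) m. top_gram (m + r) m Y = Z}"
    proof
      fix z assume "z \<in> A \<times> B"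
      then obtain Y Y' where z: "z = (Y, Y')" and Y: "Y \<in> A" "Y' \<in> B" by auto
      have t: "top (join z) = Y" "bot (join z) = Y'" unfolding z using Y by (auto simp: A_def B_def tj)
      have "adj (join z) * join z = Z + (1\<^sub>m m - Z)" unfolding gram[OF jc] t using Y by (simp add: A_def B_def)
      also have "\<dots> = 1\<^sub>m m" using Zc by (intro eq_matI) auto
      finally show "join z \<in> {Y \<in> frames (m + r) m. top_gram (m + r) m Y = Z}"
        using top_gram[OF jc] t Y jc by (simp add: frames_def A_def)
    qed
    show "(\<lambda>Y. (top Y, bot Y)) \<in> {Y \<in> frames (m + r) m. top_gram (m + r) m Y = Z} \<rightarrow> A \<times> B"
    proof
      fix Y assume Y: "Y \<in> {Y \<in> frames (m + r) m. top_gram (m + r) m Y = Z}"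
      then have Yc: "Y \<in> carrier_mat (m + r) m" "adj Y * Y = 1\<^sub>m m" by (auto simp: frames_def)
      have tZ: "adj (top Y) * top Y = Z" using Y top_gram[OF Yc(1)] by simp
      have s: "1\<^sub>m m = Z + adj (bot Y) * bot Y" using gram[OF Yc(1)] Yc(2) tZ by simp
      have bc: "adj (bot Y) * bot Y \<in> carrier_mat m m" using tb(2)[of Y] by (intro mult_carrier_mat[of _ m r]) auto
      have "adj (bot Y) * bot Y = 1\<^sub>m m - Z" unfolding s using Zc bc by (intro eq_matI) (auto simp del: index_mult_mat(1))
      then show "(top Y, bot Y) \<in> A \<times> B" using tZ tb by (simp add: A_def B_def)
    qed
    show "\<And>z. z \<in> A \<times> B \<Longrightarrow> (top (join z), bot (join z)) = z" by (auto simp: A_def B_def tj)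
    show "\<And>Y. Y \<in> {Y \<in> frames (m + r) m. top_gram (m + r) m Y = Z} \<Longrightarrow> join (top Y, bot Y) = Y"
      by (auto simp: frames_def jt)
  qed
  have "adj (1\<^sub>m m - Z) = 1\<^sub>m m - Z" using Zc by (simp add: adj_minus[of _ m m])
  then have "card B = card (frames r m)"
    unfolding B_def using Zc good_hermitian_det[OF Z] by (intro card_hermitian_factors) auto
  moreover have "card A = card (unitary m)"
    unfolding A_def frames_square[symmetric] using Zc good_hermitian_det[OF Z] by (intro card_hermitian_factors) auto
  ultimately show ?thesis using bij_betw_same_card[OF bij] by (simp add: card_cartesian_product)
qed

lemma card_squarefree_frames:
  assumes n: "n = m + r" "m \<le> r" "r \<le> Suc m"
  shows "card {Y \<in> frames n m. squarefree (char_poly (base_invol n m * invol n Y))}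
    = card (good_hermitian m) * (card (unitary m) * card (frames r m))"
proof (rule card_eq_fibres[of _ _ "top_gram n m"])
  have fin: "finite (good_hermitian m)" by (simp add: good_hermitian_def)
  then show "finite (good_hermitian m)" .
  show "top_gram n m ` {Y \<in> frames n m. squarefree (char_poly (base_invol n m * invol n Y))} \<subseteq> good_hermitian m"
    using squarefree_base_invol_mult_iff[OF _ n] by auto
  fix Z assume Z: "Z \<in> good_hermitian m"
  have "{Y \<in> {Y \<in> frames n m. squarefree (char_poly (base_invol n m * invol n Y))}. top_gram n m Y = Z}
      = {Y \<in> frames n m. top_gram n m Y = Z}"
    using squarefree_base_invol_mult_iff[OF _ n] Z by auto
  then show "card {Y \<in> {Y \<in> frames n m. squarefree (char_poly (base_invol n m * invol n Y))}. top_gram n m Y = Z}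
      = card (unitary m) * card (frames r m)"
    using card_top_gram_fibre[OF Z, of r] n(1) by simp
qed simp

lemma char_poly_unitary_conj:
  assumes U: "U \<in> unitary n" and A: "A \<in> carrier_mat n n"
  shows "char_poly (U * A * adj U) = char_poly A"
proof (rule char_poly_similar)
  have Uc: "U \<in> carrier_mat n n" "adj U \<in> carrier_mat n n" using U by (auto simp: unitary_def)
  then show "similar_mat (U * A * adj U) A"
    using unitary_left[OF U] unitary_right[OF U] A by (intro similar_matI[of _ _ U "adj U" n]) auto
qed

lemma unitary_conj_mult:
  assumes U: "U \<in> unitary n" and A: "A \<in> carrier_mat n n" and B: "B \<in> carrier_mat n n"
  shows "U * A * adj U * (U * B * adj U) = U * (A * B) * adj U"
proof -
  have Uc: "U \<in> carrier_mat n n" "adj U \<in> carrier_mat n n" using U by (auto simp: unitary_def)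
  note ac = assoc_mult_mat[of _ n n _ n _ n]
  have "U * A * adj U * (U * B * adj U) = U * (A * (adj U * (U * (B * adj U))))"
    using Uc A B by (simp add: ac)
  also have "adj U * (U * (B * adj U)) = B * adj U"
    using unitary_cancel(1)[OF U mult_carrier_mat[OF B Uc(2)]] .
  also have "U * (A * (B * adj U)) = U * (A * B) * adj U" using Uc A B by (simp add: ac)
  finally show ?thesis .
qed

lemma C_U_base_conj:
  assumes n: "n > 0" and t: "t \<in> C_U n q"
  obtains U where "U \<in> unitary n" "U * t * adj U = base_invol n (n div 2)"
proof -
  obtain Y where Y: "Y \<in> frames n (n div 2)" "t = invol n Y" using t C_U_eq[OF n] by auto
  obtain U where U: "U \<in> unitary n" "U * Y = unit_frame n (n div 2)" using frames_transitiveE[OF Y(1)] by metis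
  then show ?thesis using that invol_conj[OF U(1) Y(1)] Y(2) by (simp add: base_invol_def)
qed

text \<open>All balanced involutions are conjugate, so the first one may be taken as
  \<open>base_invol n m\<close>. The factor \<open>card (unitary m)\<close> on the left counts the
  frames giving one second involution and keeps the identity in the natural numbers.\<close>

lemma card_I_U:
  assumes n: "n > 0" "n = m + r" "m \<le> r" "r \<le> Suc m"
  shows "card (I_U n q :: ('a mat \<times> 'a mat) set) * card (unitary m)
    = card (C_U n q :: 'a mat set) * (card (good_hermitian m) * (card (unitary m) * card (frames r m)))"
proof -
  have m: "n div 2 = m" using n by simp
  let ?C = "C_U n q :: 'a mat set" and ?D = "base_invol n m"
  have Cc: "t \<in> carrier_mat n n" if "t \<in> ?C" for t using that C_U_eq[OF n(1)] by auto
  define G where "G = {t' \<in> ?C. squarefree (char_poly (?D * t'))}"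
  have finG: "finite G" by (simp add: G_def)
  have I: "I_U n q = {(t, t'). t \<in> ?C \<and> t' \<in> ?C \<and> squarefree (char_poly (t * t'))}"
    by (auto simp: I_U_def regular_semisimple_def)
  have "card (I_U n q :: ('a mat \<times> 'a mat) set) = card ?C * card G"
  proof (rule card_eq_fibres[of _ _ fst])
    have "I_U n q \<subseteq> ?C \<times> ?C" by (auto simp: I_U_def)
    then show "finite (I_U n q :: ('a mat \<times> 'a mat) set)" by (rule finite_subset) simp
    show "fst ` (I_U n q :: ('a mat \<times> 'a mat) set) \<subseteq> ?C" by (auto simp: I_U_def)
    fix t assume t: "t \<in> ?C"
    obtain U where U: "U \<in> unitary n" "U * t * adj U = ?D" using C_U_base_conj[OF n(1) t] unfolding m .
    have V: "adj U \<in> unitary n" using U(1) by (rule unitary_adj)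
    have Uc: "U \<in> carrier_mat n n" "adj U \<in> carrier_mat n n" using U by (auto simp: unitary_def)
    note ac = assoc_mult_mat[of _ n n _ n _ n]
    have cancel: "adj U * (U * s * adj U) * U = s" "U * (adj U * s * U) * adj U = s" if "s \<in> carrier_mat n n" for s
    proof -
      have Us: "U * s \<in> carrier_mat n n" "adj U * s \<in> carrier_mat n n"
        using mult_carrier_mat[OF Uc(1) that] mult_carrier_mat[OF Uc(2) that] .
      have "adj U * (U * s * adj U) * U = adj U * (U * s * (adj U * U))"
        using ac[OF Uc(2) mult_carrier_mat[OF Us(1) Uc(2)] Uc(1)] ac[OF Us(1) Uc(2) Uc(1)] by simp
      also have "\<dots> = adj U * U * s"
        by (simp only: unitary_left[OF U(1)] right_mult_one_mat[OF Us(1)] left_mult_one_mat[OF that]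
            ac[OF Uc(2) Uc(1) that, symmetric])
      finally show "adj U * (U * s * adj U) * U = s" using unitary_left[OF U(1)] that by simp
      have "U * (adj U * s * U) * adj U = U * (adj U * s * (U * adj U))"
        using ac[OF Uc(1) mult_carrier_mat[OF Us(2) Uc(1)] Uc(2)] ac[OF Us(2) Uc(1) Uc(2)] by simp
      also have "\<dots> = U * adj U * s"
        by (simp only: unitary_right[OF U(1)] right_mult_one_mat[OF Us(2)] left_mult_one_mat[OF that]
            ac[OF Uc(1) Uc(2) that, symmetric])
      finally show "U * (adj U * s * U) * adj U = s" using unitary_right[OF U(1)] that by simp
    qed
    have cp: "char_poly (?D * (U * t' * adj U)) = char_poly (t * t')" if "t' \<in> ?C" for t'
      unfolding U(2)[symmetric] unitary_conj_mult[OF U(1) Cc[OF t] Cc[OF that]]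
      using mult_carrier_mat[OF Cc[OF t] Cc[OF that]] by (rule char_poly_unitary_conj[OF U(1)])
    have "bij_betw (\<lambda>z. U * snd z * adj U) {z \<in> I_U n q. fst z = t} G"
    proof (rule bij_betwI[where g = "\<lambda>s. (t, adj U * s * U)"])
      show "(\<lambda>z. U * snd z * adj U) \<in> {z \<in> I_U n q. fst z = t} \<rightarrow> G"
        using C_U_conj[OF n(1) _ U(1)] cp by (auto simp: I G_def)
      show "(\<lambda>s. (t, adj U * s * U)) \<in> G \<rightarrow> {z \<in> I_U n q. fst z = t}"
      proof
        fix s assume s: "s \<in> G"
        then have sC: "s \<in> ?C" by (simp add: G_def)
        have c: "adj U * s * U \<in> ?C" using C_U_conj[OF n(1) sC V] by simp
        then have "char_poly (t * (adj U * s * U)) = char_poly (?D * s)" using cp[OF c] cancel(2)[OF Cc[OF sC]] by simp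
        then show "(t, adj U * s * U) \<in> {z \<in> I_U n q. fst z = t}" using s c t by (simp add: I G_def)
      qed
    qed (use cancel Cc in \<open>auto simp: I G_def\<close>)
    then show "card {z \<in> I_U n q. fst z = t} = card G" by (rule bij_betw_same_card)
  qed simp
  moreover have "card {Y \<in> frames n m. squarefree (char_poly (?D * invol n Y))} = card G * card (unitary m)"
  proof (rule card_eq_fibres[of _ _ "invol n"])
    show "invol n ` {Y \<in> frames n m. squarefree (char_poly (?D * invol n Y))} \<subseteq> G"
      using C_U_eq[OF n(1)] m by (auto simp: G_def)
    fix t assume t: "t \<in> G"
    then obtain Y where Y: "Y \<in> frames n m" "t = invol n Y" using C_U_eq[OF n(1)] m by (auto simp: G_def)
    have "{Y \<in> {Y \<in> frames n m. squarefree (char_poly (?D * invol n Y))}. invol n Y = t} = {Y' \<in> frames n m. invol n Y' = invol n Y}"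
      using t Y by (auto simp: G_def)
    then show "card {Y \<in> {Y \<in> frames n m. squarefree (char_poly (?D * invol n Y))}. invol n Y = t} = card (unitary m)"
      using card_invol_fibre[OF Y(1)] by simp
  qed (use finG in auto)
  ultimately show ?thesis using card_squarefree_frames[OF n(2-4)] by (simp only: mult.assoc)
qed

text \<open>By dimension some nonzero vector in the span of \<open>P\<close> is orthogonal to
  \<open>R\<close>, hence negated by the second involution. This will exclude an unbalanced factor
  in a product without eigenvalue -1.\<close>

lemma common_anti_eigenvector:
  assumes P: "P \<in> frames n a" and R: "R \<in> frames n b" and "b < a"
  obtains v where "v \<in> carrier_vec n" "v \<noteq> 0\<^sub>v n" "invol n P *\<^sub>v v = v" "invol n R *\<^sub>v v = - v"
proof -
  have Pc: "P \<in> carrier_mat n a" "adj P * P = 1\<^sub>m a" and Rc: "R \<in> carrier_mat n b" using P R by (auto simp: frames_def)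
  have "adj R * P \<in> carrier_mat b a" using adj_carrier[OF Rc] Pc(1) by (rule mult_carrier_mat)
  then obtain z where z: "z \<in> carrier_vec a" "z \<noteq> 0\<^sub>v a" "adj R * P *\<^sub>v z = 0\<^sub>v b"
    using wide_mat_kernel assms(3) by blast
  define v where "v = P *\<^sub>v z"
  have v: "v \<in> carrier_vec n" using Pc z by (simp add: v_def)
  have Pv: "adj P *\<^sub>v v = z"
    unfolding v_def using assoc_mult_mat_vec[OF adj_carrier[OF Pc(1)] Pc(1) z(1)] Pc(2) z(1) by simp
  have Rv: "adj R *\<^sub>v v = 0\<^sub>v b"
    unfolding v_def using assoc_mult_mat_vec[OF adj_carrier[OF Rc] Pc(1) z(1)] z(3) by simp
  have "v \<noteq> 0\<^sub>v n"
  proof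
    assume "v = 0\<^sub>v n"
    then have "z = adj P *\<^sub>v 0\<^sub>v n" using Pv by simp
    moreover have "adj P *\<^sub>v 0\<^sub>v n = 0\<^sub>v a" using Pc(1) by (intro eq_vecI) auto
    ultimately show False using z(2) by simp
  qed
  moreover have "invol n P *\<^sub>v v = v"
    unfolding invol_mult_vec[OF P v] Pv using v by (auto simp: v_def)
  moreover have "R *\<^sub>v 0\<^sub>v b = 0\<^sub>v n" using Rc by (intro eq_vecI) auto
  then have "invol n R *\<^sub>v v = - v"
    unfolding invol_mult_vec[OF R v] Rv using v by auto
  ultimately show ?thesis using that v by blast
qed

lemma coprime_X2_iff:
  fixes c :: "'a poly"
  shows "coprime c ([:0, 1:]\<^sup>2 - 1) \<longleftrightarrow> poly c 1 \<noteq> 0 \<and> poly c (-1) \<noteq> 0"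
proof -
  have eq: "[:0, 1:]\<^sup>2 - 1 = [:-1, 1:] * [:- (-1), 1 :: 'a:]" by (simp add: power2_eq_square one_pCons)
  have lin: "coprime c [:- x, 1:] \<longleftrightarrow> poly c x \<noteq> 0" for x
  proof
    assume cop: "coprime c [:- x, 1:]"
    show "poly c x \<noteq> 0"
    proof
      assume "poly c x = 0"
      then have "[:- x, 1:] dvd c" by (simp add: poly_eq_0_iff_dvd)
      from coprime_common_divisor[OF cop this dvd_refl] have "is_unit [:- x, 1:]" .
      then show False using irreducible_not_unit[OF irreducible_linear_field_poly[of 1 "- x"]] by simp
    qed
  next
    assume "poly c x \<noteq> 0"
    then have "\<not> [:- x, 1:] dvd c" by (simp add: poly_eq_0_iff_dvd)
    then show "coprime c [:- x, 1:]"
      using irreducible_poly_coprime[OF irreducible_linear_field_poly[of 1 "- x"]] by (simp add: coprime_commute)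
  qed
  show ?thesis unfolding eq coprime_poly_mult_right_iff lin using lin[of 1] by auto
qed

text \<open>For a pair in Delta, absence of the eigenvalue -1 forces \<open>t * y\<close> to be
  balanced. Conversely the characteristic polynomial of a regular semisimple product is a
  homogenization with nonzero values at 1 and -1, so coprimality to X^2 - 1 is automatic.\<close>

lemma bij_betw_Delta_U:
  assumes m: "m > 0"
  shows "bij_betw (\<lambda>(t, y). (t, t * y)) (Delta_U (2 * m) q) (I_U (2 * m) q :: ('a mat \<times> 'a mat) set)"
proof (rule bij_betwI[where g = "\<lambda>(t, s). (t, t * s)"])
  define n where "n = 2 * m"
  have n: "n > 0" "n = m + m" "m \<le> m" "m \<le> Suc m" "n div 2 = m" using m by (auto simp: n_def)
  let ?C = "C_U n q :: 'a mat set"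
  have C: "t \<in> unitary n" "t * t = 1\<^sub>m n" "t \<in> carrier_mat n n" "adj t = t" if "t \<in> ?C" for t
  proof -
    obtain Y where "Y \<in> frames n m" "t = invol n Y" using \<open>t \<in> ?C\<close> C_U_eq[OF n(1)] n(5) by auto
    then show "t \<in> unitary n" "t * t = 1\<^sub>m n" "t \<in> carrier_mat n n" "adj t = t"
      using invol_unitary invol_square adj_invol by auto
  qed
  note ac = assoc_mult_mat[of _ n n _ n _ n]
  have cancel: "t * (t * s) = s" if "t \<in> ?C" "s \<in> carrier_mat n n" for t s
    using assoc_mult_mat[OF C(3)[OF that(1)] C(3)[OF that(1)] that(2)] C(2)[OF that(1)] that(2) by simp
  have D: "(t, y) \<in> Delta_U n q \<longleftrightarrow> t \<in> ?C \<and> y \<in> unitary n \<and> squarefree (char_poly y) \<and> t * y * t = adj y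
      \<and> poly (char_poly y) 1 \<noteq> 0 \<and> poly (char_poly y) (-1) \<noteq> 0" for t y
    using C(1,4) by (auto simp: Delta_U_def regular_semisimple_def carrier_GU inv_GU coprime_X2_iff)
  show "(\<lambda>(t, y). (t, t * y)) \<in> Delta_U (2 * m) q \<rightarrow> (I_U (2 * m) q :: ('a mat \<times> 'a mat) set)"
    unfolding n_def[symmetric]
  proof
    fix z :: "'a mat \<times> 'a mat" assume "z \<in> Delta_U n q"
    then obtain t y where z: "z = (t, y)" and "(t, y) \<in> Delta_U n q" by (cases z) auto
    then have t: "t \<in> ?C" and y: "y \<in> unitary n" "squarefree (char_poly y)" "t * y * t = adj y"
      and root: "poly (char_poly y) (-1) \<noteq> 0" by (auto simp: D)
    have yc: "y \<in> carrier_mat n n" using y(1) by (simp add: unitary_def)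
    define s where "s = t * y"
    have su: "s \<in> unitary n" unfolding s_def using C(1)[OF t] y(1) by (rule unitary_mult)
    have y_eq: "t * s = y" unfolding s_def using cancel[OF t yc] .
    have "s * s = t * y * t * y" unfolding s_def using C(3)[OF t] yc by (simp add: ac)
    also have "\<dots> = 1\<^sub>m n" unfolding y(3) using unitary_left[OF y(1)] .
    finally obtain k R where R: "R \<in> frames n k" "s = invol n R" using involution_eq_invol[OF su] by blast
    obtain P where P: "P \<in> frames n m" "t = invol n P" using t C_U_eq[OF n(1)] n(5) by auto
    have noeig: False if v: "v \<in> carrier_vec n" "v \<noteq> 0\<^sub>v n" "y *\<^sub>v v = - v" for v
    proof -
      have "eigenvector y v (-1)" using v yc by (auto simp: eigenvector_def)
      then have "eigenvalue y (-1)" by (auto simp: eigenvalue_def)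
      then show False using root eigenvalue_root_char_poly[OF yc] by simp
    qed
    have yv: "y *\<^sub>v v = t *\<^sub>v (s *\<^sub>v v)" if "v \<in> carrier_vec n" for v
      unfolding y_eq[symmetric] using C(3)[OF t] su that by (intro assoc_mult_mat_vec) (auto simp: unitary_def)
    have neg: "t *\<^sub>v (- v) = - (t *\<^sub>v v)" if "v \<in> carrier_vec n" for v
      using C(3)[OF t] that by (intro eq_vecI) (auto simp: scalar_prod_def sum_negf)
    \<comment> \<open>If one fixed space is larger, a vector fixed by one involution and negated by
      the other satisfies y v = -v.\<close>
    have "k = m"
    proof (rule ccontr)
      assume "k \<noteq> m"
      then consider "k < m" | "m < k" by linarith
      then show False
      proof cases
        case 1
        obtain v where v: "v \<in> carrier_vec n" "v \<noteq> 0\<^sub>v n" "t *\<^sub>v v = v" "s *\<^sub>v v = - v"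
          using common_anti_eigenvector[OF P(1) R(1) 1] P(2) R(2) by metis
        then show False using noeig[OF v(1,2)] yv[OF v(1)] neg[OF v(1)] by simp
      next
        case 2
        obtain v where v: "v \<in> carrier_vec n" "v \<noteq> 0\<^sub>v n" "s *\<^sub>v v = v" "t *\<^sub>v v = - v"
          using common_anti_eigenvector[OF R(1) P(1) 2] P(2) R(2) by metis
        then show False using noeig[OF v(1,2)] yv[OF v(1)] by simp
      qed
    qed
    then have "s \<in> ?C" using R C_U_eq[OF n(1)] n(5) by auto
    then show "(case z of (t, y) \<Rightarrow> (t, t * y)) \<in> I_U n q"
      using z t y(2) y_eq by (simp add: I_U_def regular_semisimple_def s_def)
  qed
  show "(\<lambda>(t, s). (t, t * s)) \<in> (I_U (2 * m) q :: ('a mat \<times> 'a mat) set) \<rightarrow> Delta_U (2 * m) q"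
    unfolding n_def[symmetric]
  proof
    fix z :: "'a mat \<times> 'a mat" assume "z \<in> I_U n q"
    then obtain t s where z: "z = (t, s)" and "(t, s) \<in> I_U n q" by (cases z) auto
    then have t: "t \<in> ?C" and s: "s \<in> ?C" and sf: "squarefree (char_poly (t * s))"
      by (auto simp: I_U_def regular_semisimple_def)
    have yu: "t * s \<in> unitary n" using C(1)[OF t] C(1)[OF s] by (rule unitary_mult)
    have "t * (t * s) * t = s * t" using cancel[OF t C(3)[OF s]] by simp
    also have "\<dots> = adj (t * s)" using adj_mult[OF C(3)[OF t] C(3)[OF s]] C(4)[OF t] C(4)[OF s] by simp
    finally have inv: "t * (t * s) * t = adj (t * s)" .
    obtain U where U: "U \<in> unitary n" "U * t * adj U = base_invol n m" using C_U_base_conj[OF n(1) t] unfolding n(5) .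
    have "U * s * adj U \<in> ?C" using C_U_conj[OF n(1) s U(1)] .
    then obtain Y where Y: "Y \<in> frames n m" "U * s * adj U = invol n Y" using C_U_eq[OF n(1)] n(5) by auto
    have "char_poly (t * s) = char_poly (base_invol n m * invol n Y)"
      unfolding U(2)[symmetric] Y(2)[symmetric] unitary_conj_mult[OF U(1) C(3)[OF t] C(3)[OF s]]
      using mult_carrier_mat[OF C(3)[OF t] C(3)[OF s]] by (rule char_poly_unitary_conj[OF U(1), symmetric])
    moreover have good: "top_gram n m Y \<in> good_hermitian m"
      using squarefree_base_invol_mult_iff[OF Y(1) n(2-4)] sf calculation by simp
    ultimately have cp: "char_poly (t * s) = homog ([:1, 1:]\<^sup>2) [:0, 4:] m (char_poly (top_gram n m Y))"
      using char_poly_base_invol_mult[OF Y(1) n(2,3)] by simp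
    have Zc: "top_gram n m Y \<in> carrier_mat m m" using good by (simp add: good_hermitian_def hermitian_def)
    have "poly (char_poly (t * s)) 1 \<noteq> 0" "poly (char_poly (t * s)) (-1) \<noteq> 0"
      using good four[OF two_neq_0] degree_char_poly[OF Zc]
      by (simp_all add: cp poly_homog_1[OF two_neq_0] poly_homog_m1[OF two_neq_0] good_hermitian_def poly_0_coeff_0)
    then show "(case z of (t, s) \<Rightarrow> (t, t * s)) \<in> Delta_U n q" using z t yu sf inv by (simp add: D)
  qed
  show "\<And>z :: 'a mat \<times> 'a mat. z \<in> Delta_U (2 * m) q \<Longrightarrow> (case case z of (t, y) \<Rightarrow> (t, t * y) of (t, s) \<Rightarrow> (t, t * s)) = z"
    unfolding n_def[symmetric] using cancel by (auto simp: D unitary_def)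
  show "\<And>z :: 'a mat \<times> 'a mat. z \<in> I_U (2 * m) q \<Longrightarrow> (case case z of (t, s) \<Rightarrow> (t, t * s) of (t, y) \<Rightarrow> (t, t * y)) = z"
    unfolding n_def[symmetric] using cancel C(3) by (auto simp: I_U_def)
qed

end

section \<open>The limits\<close>

lemma phi_U_tendsto:
  fixes z :: real
  assumes z: "z \<ge> 2"
  shows "(\<lambda>m. phi_U m z) \<longlonglongrightarrow> phi_U_inf z" and "phi_U_inf z > 0"
proof -
  \<comment> \<open>The index is shifted by one, so that the product from 1 to \<open>m\<close>
    becomes one over \<open>i < m\<close>. For z >= 2 all terms are at most 1/2 in absolute value,
    whence |ln(1 + x)| <= 2 |x| and the logarithms are summable; the limit is an exponential and so
    positive.\<close>
  define x where "x = (\<lambda>i. - ((-1) ^ Suc i * z powi (- int (Suc i))))"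
  have abs_x: "\<bar>x i\<bar> = (1 / z) ^ Suc i" for i
    using z by (simp add: x_def abs_mult power_abs power_int_minus power_int_def nat_add_distrib field_simps)
  have "(1 / z) ^ Suc i \<le> (1 / 2) ^ 1" for i
  proof -
    have "(1 / z) ^ Suc i \<le> (1 / 2) ^ Suc i" using z by (intro power_mono) (auto simp: field_simps)
    also have "\<dots> \<le> (1 / 2) ^ 1" by (rule power_decreasing) auto
    finally show ?thesis .
  qed
  then have small: "\<bar>x i\<bar> \<le> 1 / 2" for i unfolding abs_x by simp
  have geometric: "summable (\<lambda>i. 2 * (1 / z) ^ Suc i)"
    using z by (intro summable_mult) (simp add: summable_Suc_iff summable_geometric_iff)
  have "norm (ln (1 + x i)) \<le> 2 * (1 / z) ^ Suc i" for i
  proof -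
    have "2 * (x i)\<^sup>2 = 2 * \<bar>x i\<bar> * \<bar>x i\<bar>" by (simp add: power2_eq_square)
    also have "\<dots> \<le> 1 * \<bar>x i\<bar>" using small[of i] by (intro mult_right_mono) auto
    finally have "\<bar>ln (1 + x i) - x i\<bar> \<le> \<bar>x i\<bar>"
      using abs_ln_one_plus_x_minus_x_bound[OF small[of i]] by linarith
    then show ?thesis using abs_x[of i] by simp
  qed
  then have "summable (\<lambda>i. ln (1 + x i))" by (intro summable_comparison_test'[OF geometric]) auto
  then have "(\<lambda>m. exp (\<Sum>i<m. ln (1 + x i))) \<longlonglongrightarrow> exp (\<Sum>i. ln (1 + x i))"
    by (intro tendsto_exp summable_LIMSEQ)
  moreover have "exp (\<Sum>i<m. ln (1 + x i)) = phi_U m z" for m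
  proof -
    have "1 + x i > 0" for i using small[of i] by (simp add: abs_if split: if_splits)
    then have "exp (\<Sum>i<m. ln (1 + x i)) = (\<Prod>i<m. 1 + x i)" by (simp add: exp_sum)
    also have "\<dots> = (\<Prod>i<m. 1 - (-1) ^ Suc i * z powi (- int (Suc i)))" by (simp add: x_def)
    also have "\<dots> = phi_U m z" unfolding phi_U_def
      by (rule prod.reindex_bij_witness[of _ "\<lambda>i. i - 1" Suc]) auto
    finally show ?thesis .
  qed
  ultimately have lim: "(\<lambda>m. phi_U m z) \<longlonglongrightarrow> exp (\<Sum>i. ln (1 + x i))" by simp
  then have "phi_U_inf z = exp (\<Sum>i. ln (1 + x i))" unfolding phi_U_inf_def by (rule limI)
  then show "(\<lambda>m. phi_U m z) \<longlonglongrightarrow> phi_U_inf z" "phi_U_inf z > 0" using lim by simp_all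
qed

section \<open>Assembling the counts and passing to the limit\<close>

context quad_ext
begin

lemma card_unitary_pos: "card (unitary n) > 0"
proof -
  have "1\<^sub>m n \<in> unitary n" by (simp add: unitary_def)
  then show ?thesis by (auto simp: card_gt_0_iff)
qed

text \<open>For r = m the frames of the bottom block are all of \<open>unitary m\<close>, and the
  group orders cancel completely.\<close>

lemma r_U_even:
  assumes m: "m > 0"
  shows "r_U TYPE('a) (2 * m) q = (\<Sum>h\<in>good m. weight h)"
proof -
  let ?C = "C_U (2 * m) q :: 'a mat set" and ?I = "I_U (2 * m) q :: ('a mat \<times> 'a mat) set"
  have u: "card (unitary m) > 0" "card (unitary (2 * m)) > 0" by (rule card_unitary_pos)+
  have I: "card ?I * card (unitary m) = card ?C * (card (good_hermitian m) * (card (unitary m) * card (frames m m)))"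
    using m by (intro card_I_U) auto
  have C: "card ?C * card (unitary m) = card (frames (2 * m) m)" using card_C_U[of "2 * m"] m by simp
  have F: "card (frames (2 * m) m) * card (unitary m) = card (unitary (2 * m))"
    using card_unitary_frames[of m m] by (simp add: mult_2)
  have "real (card ?I) * card (unitary m)
      = (card ?C * card (unitary m)) * card (unitary m) * card (good_hermitian m)"
    using arg_cong[OF I, of real] by (simp add: frames_square mult_ac)
  also have "\<dots> = card (unitary (2 * m)) * card (good_hermitian m)"
    using arg_cong[OF F, of real] unfolding C by simp
  also have "\<dots> = card (unitary (2 * m)) * (\<Sum>h\<in>good m. weight h) * card (unitary m)"
    by (simp add: card_good_hermitian[OF m])
  finally have "real (card ?I) = card (unitary (2 * m)) * (\<Sum>h\<in>good m. weight h)" using u by auto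
  moreover have "card (Delta_U (2 * m) q :: ('a mat \<times> 'a mat) set) = card ?I"
    using bij_betw_Delta_U[OF m] by (rule bij_betw_same_card)
  ultimately show ?thesis using u by (auto simp: r_U_def order_GU)
qed

lemma r_U_inf_eq: "(\<lambda>m. \<Sum>h\<in>good m. weight h) \<longlonglongrightarrow> r_U_inf TYPE('a) q"
proof -
  obtain L where L: "(\<lambda>m. \<Sum>h\<in>good m. weight h) \<longlonglongrightarrow> L"
    using convergent_sum_weight by (auto simp: convergent_def)
  have "eventually (\<lambda>m. (\<Sum>h\<in>good m. weight h) = r_U TYPE('a) (2 * m) q) sequentially"
    using eventually_gt_at_top[of 0] by eventually_elim (simp add: r_U_even)
  with L have "(\<lambda>m. r_U TYPE('a) (2 * m) q) \<longlonglongrightarrow> L" by (rule Lim_transform_eventually)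
  then have "r_U_inf TYPE('a) q = L" unfolding r_U_inf_def by (rule limI)
  then show ?thesis using L by simp
qed

text \<open>With u(k) the order of the unitary group, there are u(n) / (u(m) u(r)) balanced
  involutions, and each good \<open>Z\<close> has u(m) u(r) / u(r - m) frames above it.\<close>

lemma iota_U_eq:
  assumes n: "n > 0" "n = m + r" "m \<le> r" "r \<le> Suc m" and m: "m > 0"
  shows "iota_U TYPE('a) n q
    = (\<Sum>h\<in>good m. weight h) * (card (unitary m))\<^sup>2 * (card (unitary r))\<^sup>2
      / (card (unitary (r - m)) * card (unitary n))"
proof -
  let ?C = "C_U n q :: 'a mat set" and ?I = "I_U n q :: ('a mat \<times> 'a mat) set"
  define u where "u = (\<lambda>k. real (card (unitary k)))"
  define I where "I = real (card ?I)"
  define C where "C = real (card ?C)"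
  define a where "a = (\<Sum>h\<in>good m. weight h)"
  define f where "f = real (card (frames r m))"
  define F where "F = real (card (frames n m))"
  have u: "u k > 0" for k unfolding u_def using card_unitary_pos by simp
  have div: "n div 2 = m" using n by linarith
  have "I * u m = C * ((u m * a) * (u m * f))"
    using arg_cong[OF card_I_U[OF n], of real] card_good_hermitian[OF m]
    by (simp add: I_def u_def C_def f_def a_def)
  then have I: "I = C * u m * a * f" using u[of m] by (simp add: field_simps)
  have C: "F = C * u m" using arg_cong[OF card_C_U[OF n(1)], of real] by (simp add: div F_def C_def u_def)
  have F: "u n = F * u r"
    using arg_cong[OF card_unitary_frames[of m r], of real] n(2) by (simp add: u_def F_def)
  have f: "u r = f * u (r - m)"
    using arg_cong[OF card_unitary_frames[of m "r - m"], of real] n(3) by (simp add: u_def f_def)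
  have Cpos: "C > 0"
  proof -
    have "F > 0" using F u[of n] u[of r] by (simp add: zero_less_mult_iff)
    then show ?thesis using C u[of m] by (simp add: zero_less_mult_iff)
  qed
  have "iota_U TYPE('a) n q = I / C\<^sup>2" by (simp add: iota_U_def I_def C_def)
  also have "\<dots> = u m * a * f / C" unfolding I using Cpos by (simp add: power2_eq_square)
  also have "\<dots> = a * (u m)\<^sup>2 * f * u r / u n"
    unfolding F C using u Cpos by (simp add: power2_eq_square field_simps less_imp_neq[THEN not_sym])
  also have "\<dots> = a * (u m)\<^sup>2 * (u r)\<^sup>2 / (u (r - m) * u n)"
    unfolding f using u by (simp add: power2_eq_square less_imp_neq[THEN not_sym])
  finally show ?thesis by (simp add: a_def u_def)
qed

lemma iota_U_even:
  assumes m: "m > 0"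
  shows "iota_U TYPE('a) (2 * m) q
    = (\<Sum>h\<in>good m. weight h) * phi_U m (real q) ^ 4 / phi_U (2 * m) (real q)"
proof -
  have q: "real q \<noteq> 0" using q_ge_3 by simp
  define Q where "Q = real q ^ (m\<^sup>2)"
  have Q: "Q \<noteq> 0" "real q ^ ((2 * m)\<^sup>2) = Q ^ 4"
    using q by (simp_all add: Q_def flip: power_mult) (simp add: power2_eq_square algebra_simps)
  have "iota_U TYPE('a) (2 * m) q = (\<Sum>h\<in>good m. weight h) * (Q * phi_U m (real q))\<^sup>2 * (Q * phi_U m (real q))\<^sup>2
      / (1 * (Q ^ 4 * phi_U (2 * m) (real q)))"
    using iota_U_eq[of "2 * m" m m] m Q by (simp add: card_unitary Q_def phi_U_def)
  then show ?thesis using Q(1) by (simp add: power_mult_distrib eval_nat_numeral)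
qed

text \<open>The powers of q balance up to one factor: 2 m^2 + 2 (m + 1)^2 = (2 m + 1)^2 + 1. The
  surplus q turns the order q + 1 of \<open>unitary 1\<close> into 1 + 1/q.\<close>

lemma iota_U_odd:
  assumes m: "m > 0"
  shows "iota_U TYPE('a) (2 * m + 1) q
    = (\<Sum>h\<in>good m. weight h) * (phi_U m (real q))\<^sup>2 * (phi_U (Suc m) (real q))\<^sup>2
      / ((1 + real q powi (-1)) * phi_U (2 * m + 1) (real q))"
proof -
  have q: "real q \<noteq> 0" using q_ge_3 by simp
  define Q where "Q = real q ^ (m\<^sup>2)"
  define R where "R = real q ^ ((Suc m)\<^sup>2)"
  have nz: "Q \<noteq> 0" "R \<noteq> 0" using q by (simp_all add: Q_def R_def)
  have "2 * m\<^sup>2 + 2 * (Suc m)\<^sup>2 = 1 + (2 * m + 1)\<^sup>2" by (simp add: power2_eq_square algebra_simps)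
  then have "real q ^ (2 * m\<^sup>2) * real q ^ (2 * (Suc m)\<^sup>2) = real q ^ 1 * real q ^ ((2 * m + 1)\<^sup>2)"
    by (simp only: flip: power_add)
  then have QR: "Q\<^sup>2 * R\<^sup>2 = real q * real q ^ ((2 * m + 1)\<^sup>2)"
    unfolding Q_def R_def by (simp only: power_one_right mult.commute[of 2] flip: power_mult)
  have "iota_U TYPE('a) (2 * m + 1) q
      = (\<Sum>h\<in>good m. weight h) * (Q * phi_U m (real q))\<^sup>2 * (R * phi_U (Suc m) (real q))\<^sup>2
      / ((real q * (1 + real q powi (-1))) * (real q ^ ((2 * m + 1)\<^sup>2) * phi_U (2 * m + 1) (real q)))"
    using iota_U_eq[of "2 * m + 1" m "Suc m"] m
    by (simp add: card_unitary Q_def R_def phi_U_def[of 1] phi_U_def[of "Suc 0"])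
  also have "\<dots> = (Q\<^sup>2 * R\<^sup>2) * ((\<Sum>h\<in>good m. weight h) * (phi_U m (real q))\<^sup>2 * (phi_U (Suc m) (real q))\<^sup>2)
      / ((real q * real q ^ ((2 * m + 1)\<^sup>2)) * ((1 + real q powi (-1)) * phi_U (2 * m + 1) (real q)))"
    by (simp only: power_mult_distrib mult_ac)
  also have "\<dots> = (\<Sum>h\<in>good m. weight h) * (phi_U m (real q))\<^sup>2 * (phi_U (Suc m) (real q))\<^sup>2
      / ((1 + real q powi (-1)) * phi_U (2 * m + 1) (real q))"
    unfolding QR[symmetric] using nz by simp
  finally show ?thesis .
qed

theorem iota_U_limits:
  shows "(\<lambda>m. iota_U TYPE('a) (2 * m) q) \<longlonglongrightarrow> r_U_inf TYPE('a) q * phi_U_inf (real q) ^ 3"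
    and "(\<lambda>m. iota_U TYPE('a) (2 * m + 1) q)
      \<longlonglongrightarrow> r_U_inf TYPE('a) q * phi_U_inf (real q) ^ 3 / (1 + real q powi (-1))"
proof -
  define \<phi> where "\<phi> = phi_U_inf (real q)"
  define r where "r = r_U_inf TYPE('a) q"
  define c where "c = 1 + real q powi (-1)"
  have c: "c > 0" unfolding c_def using q_ge_3 by (simp add: add_pos_nonneg)
  have \<phi>: "(\<lambda>m. phi_U m (real q)) \<longlonglongrightarrow> \<phi>" "\<phi> > 0"
    unfolding \<phi>_def using q_ge_3 phi_U_tendsto[of "real q"] by simp_all
  have sub: "(\<lambda>m. phi_U (g m) (real q)) \<longlonglongrightarrow> \<phi>" if "strict_mono g" for g
    using LIMSEQ_subseq_LIMSEQ[OF \<phi>(1) that] by (simp add: o_def)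
  have e: "(\<lambda>m. phi_U (2 * m) (real q)) \<longlonglongrightarrow> \<phi>" and o: "(\<lambda>m. phi_U (2 * m + 1) (real q)) \<longlonglongrightarrow> \<phi>"
    and S: "(\<lambda>m. phi_U (Suc m) (real q)) \<longlonglongrightarrow> \<phi>"
    by (rule sub, simp add: strict_mono_def)+
  have ev: "eventually (\<lambda>m. m > (0::nat)) sequentially" by (rule eventually_gt_at_top)
  have "(\<lambda>m. (\<Sum>h\<in>good m. weight h) * phi_U m (real q) ^ 4 / phi_U (2 * m) (real q)) \<longlonglongrightarrow> r * \<phi> ^ 4 / \<phi>"
    using \<phi>(2) by (intro tendsto_intros r_U_inf_eq[folded r_def] \<phi>(1) e) auto
  moreover have "r * \<phi> ^ 4 / \<phi> = r * \<phi> ^ 3" using \<phi>(2) by (simp add: eval_nat_numeral)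
  ultimately show "(\<lambda>m. iota_U TYPE('a) (2 * m) q) \<longlonglongrightarrow> r * \<phi> ^ 3"
    using eventually_mono[OF ev iota_U_even[symmetric]] by (auto intro: Lim_transform_eventually)
  have "(\<lambda>m. (\<Sum>h\<in>good m. weight h) * (phi_U m (real q))\<^sup>2 * (phi_U (Suc m) (real q))\<^sup>2
      / (c * phi_U (2 * m + 1) (real q))) \<longlonglongrightarrow> r * \<phi>\<^sup>2 * \<phi>\<^sup>2 / (c * \<phi>)"
    using \<phi>(2) c by (intro tendsto_intros r_U_inf_eq[folded r_def] \<phi>(1) o S) auto
  moreover have "r * \<phi>\<^sup>2 * \<phi>\<^sup>2 / (c * \<phi>) = r * \<phi> ^ 3 / c" using \<phi>(2) by (simp add: eval_nat_numeral)
  ultimately show "(\<lambda>m. iota_U TYPE('a) (2 * m + 1) q) \<longlonglongrightarrow> r * \<phi> ^ 3 / c"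
    using eventually_mono[OF ev iota_U_odd[symmetric]] unfolding c_def by (auto intro: Lim_transform_eventually)
qed

end

section \<open>The subfield of index two\<close>

text \<open>A type can depend on \<open>'a\<close> but not on the number q, so q has to be recovered
  from the field; the cardinality determines it uniquely.\<close>

definition quad_exp :: "'a::{field,finite} itself \<Rightarrow> nat \<Rightarrow> bool" where
  "quad_exp _ q \<longleftrightarrow> CARD('a) = q\<^sup>2 \<and> (\<forall>x y :: 'a. (x + y) ^ q = x ^ q + y ^ q)"

text \<open>The exponent \<open>1\<close> only makes the type below a field when \<open>'a\<close> is not a quadratic extension.\<close>

definition half_exp :: "'a::{field,finite} itself \<Rightarrow> nat" where
  "half_exp F = (if \<exists>q. quad_exp F q then SOME q. quad_exp F q else 1)"

lemma half_exp_eq: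
  assumes "quad_exp TYPE('a::{field,finite}) q"
  shows "half_exp TYPE('a) = q"
proof -
  have "q' = q" if "quad_exp TYPE('a) q'" for q'
    using that assms power2_eq_imp_eq[of q' q] by (simp add: quad_exp_def)
  then show ?thesis unfolding half_exp_def using assms by (metis someI)
qed

lemma half_exp_pos: "half_exp TYPE('a::{field,finite}) > 0"
proof (cases "\<exists>q. quad_exp TYPE('a) q")
  case True
  then obtain q where q: "quad_exp TYPE('a) q" by blast
  have "q\<^sup>2 > 0"
    using q zero_less_card_finite[where 'a = 'a] unfolding quad_exp_def by simp
  then show ?thesis using half_exp_eq[OF q] by simp
qed (simp add: half_exp_def)

lemma add_power_half_exp:
  "(x + y :: 'a::{field,finite}) ^ half_exp TYPE('a) = x ^ half_exp TYPE('a) + y ^ half_exp TYPE('a)"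
proof (cases "\<exists>q. quad_exp TYPE('a) q")
  case True
  then obtain q where q: "quad_exp TYPE('a) q" by blast
  then show ?thesis unfolding half_exp_eq[OF q] by (simp add: quad_exp_def)
qed (simp add: half_exp_def)

lemma minus_power_half_exp: "(- x :: 'a::{field,finite}) ^ half_exp TYPE('a) = - (x ^ half_exp TYPE('a))"
proof -
  have "(- x) ^ half_exp TYPE('a) + x ^ half_exp TYPE('a) = 0"
    unfolding add_power_half_exp[symmetric] using half_exp_pos[where 'a = 'a] by simp
  then show ?thesis by (simp add: eq_neg_iff_add_eq_0)
qed

typedef (overloaded) ('a::"{field,finite}") half_field = "{x :: 'a. x ^ half_exp TYPE('a) = x}"
  by (rule exI[of _ 1]) simp

lemma Rep_half_field_power: "Rep_half_field x ^ half_exp TYPE('a) = (Rep_half_field x :: 'a::{field,finite})"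
  using Rep_half_field[of x] by simp

instantiation half_field :: ("{field,finite}") field
begin

definition "0 = Abs_half_field 0"
definition "1 = Abs_half_field 1"
definition "x + y = Abs_half_field (Rep_half_field x + Rep_half_field y)"
definition "x - y = Abs_half_field (Rep_half_field x - Rep_half_field y)"
definition "- x = Abs_half_field (- Rep_half_field x)"
definition "x * y = Abs_half_field (Rep_half_field x * Rep_half_field y)"
definition "inverse x = Abs_half_field (inverse (Rep_half_field x))"
definition "x div y = Abs_half_field (Rep_half_field x / Rep_half_field y)"

lemma Rep_half_field_hom:
  fixes x y :: "'a half_field"
  shows "Rep_half_field (0 :: 'a half_field) = 0"
    and "Rep_half_field (1 :: 'a half_field) = 1"
    and "Rep_half_field (x + y) = Rep_half_field x + Rep_half_field y"
    and "Rep_half_field (x - y) = Rep_half_field x - Rep_half_field y"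
    and "Rep_half_field (- x) = - Rep_half_field x"
    and "Rep_half_field (x * y) = Rep_half_field x * Rep_half_field y"
    and "Rep_half_field (inverse x) = inverse (Rep_half_field x)"
    and "Rep_half_field (x div y) = Rep_half_field x / Rep_half_field y"
proof -
  have "(a - b) ^ half_exp TYPE('a) = a ^ half_exp TYPE('a) - b ^ half_exp TYPE('a)" for a b :: 'a
    using add_power_half_exp[of a "- b"] by (simp add: minus_power_half_exp)
  then show "Rep_half_field (0 :: 'a half_field) = 0"
    and "Rep_half_field (1 :: 'a half_field) = 1"
    and "Rep_half_field (x + y) = Rep_half_field x + Rep_half_field y"
    and "Rep_half_field (x - y) = Rep_half_field x - Rep_half_field y"
    and "Rep_half_field (- x) = - Rep_half_field x"
    and "Rep_half_field (x * y) = Rep_half_field x * Rep_half_field y"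
    and "Rep_half_field (inverse x) = inverse (Rep_half_field x)"
    and "Rep_half_field (x div y) = Rep_half_field x / Rep_half_field y"
    using half_exp_pos[where 'a = 'a]
    by (simp_all add: zero_half_field_def one_half_field_def plus_half_field_def minus_half_field_def
        uminus_half_field_def times_half_field_def inverse_half_field_def divide_half_field_def
        Abs_half_field_inverse add_power_half_exp minus_power_half_exp power_mult_distrib
        power_inverse power_divide Rep_half_field_power)
qed

instance
  by standard
    (simp_all add: Rep_half_field_inject[symmetric] Rep_half_field_hom algebra_simps divide_inverse)

end

instance half_field :: ("{field,finite}") finite
proof
  have "inj_on Rep_half_field (UNIV :: 'a half_field set)" by (simp add: inj_on_def Rep_half_field_inject)
  then show "finite (UNIV :: 'a half_field set)" by (rule finite_imageD[rotated]) simp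
qed

text \<open>The lower bound: \<open>x \<mapsto> x\<^bsup>q + 1\<^esup>\<close> maps the \<open>q\<^sup>2 - 1\<close> units to fixed units, with at most \<open>q + 1\<close>
  preimages each.\<close>

lemma card_fixed_power:
  assumes "CARD('a::{field,finite}) = q\<^sup>2"
  shows "card {x :: 'a. x ^ q = x} = q"
proof (rule antisym)
  have "card {0, 1 :: 'a} \<le> CARD('a)" by (intro card_mono) auto
  then have q: "q \<ge> 2" using assms by (cases "q \<in> {0, 1}") auto
  \<comment> \<open>One bound for both uses: \<open>y = 0\<close>, \<open>z = 1\<close> counts the
    fixed elements, \<open>z = 0\<close> the fibres of the power map.\<close>
  have roots: "card {x :: 'a. x ^ Suc k = y + z * x} \<le> Suc k" if "k > 0" for k y z
  proof -
    define p where "p = monom 1 (Suc k) + - [:y, z:]"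
    have "degree (- [:y, z:]) < degree (monom (1::'a) (Suc k))" using that by (simp add: degree_monom_eq)
    then have "degree p = Suc k" unfolding p_def by (subst degree_add_eq_left) (auto simp: degree_monom_eq)
    moreover have "card {x. poly p x = 0} \<le> degree p" using calculation by (intro card_poly_roots_bound) auto
    moreover have "{x. poly p x = 0} = {x :: 'a. x ^ Suc k = y + z * x}"
    proof -
      have "poly p x = x ^ Suc k - (y + z * x)" for x by (simp add: p_def poly_monom mult.commute)
      then show ?thesis by simp
    qed
    ultimately show ?thesis by simp
  qed
  show "card {x :: 'a. x ^ q = x} \<le> q" using roots[of "q - 1" 0 1] q by simp
  define K where "K = {x :: 'a. x ^ q = x} - {0}"
  have norm: "(\<lambda>x. x ^ Suc q) ` (UNIV - {0}) \<subseteq> K"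
  proof -
    have "(x ^ Suc q) ^ q = x ^ Suc q" for x :: 'a
      using finite_field_power_CARD[of x] unfolding assms
      by (simp add: power_mult_distrib power2_eq_square mult.commute flip: power_mult)
    then show ?thesis by (auto simp: K_def)
  qed
  have "q\<^sup>2 - 1 = card (UNIV - {0 :: 'a})" by (simp add: assms card_Diff_singleton)
  also have "\<dots> = (\<Sum>y\<in>(\<lambda>x. x ^ Suc q) ` (UNIV - {0}). card {x \<in> UNIV - {0 :: 'a}. x ^ Suc q = y})"
    using sum.image_gen[of "UNIV - {0 :: 'a}" "\<lambda>_. 1 :: nat" "\<lambda>x. x ^ Suc q"] by simp
  also have "\<dots> \<le> (\<Sum>y\<in>(\<lambda>x. x ^ Suc q) ` (UNIV - {0 :: 'a}). Suc q)"
  proof (rule sum_mono)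
    fix y :: 'a
    have "card {x \<in> UNIV - {0 :: 'a}. x ^ Suc q = y} \<le> card {x. x ^ Suc q = y + 0 * x}"
      by (intro card_mono) auto
    also have "\<dots> \<le> Suc q" using q by (intro roots) simp
    finally show "card {x \<in> UNIV - {0 :: 'a}. x ^ Suc q = y} \<le> Suc q" .
  qed
  also have "\<dots> \<le> card K * Suc q" 
    unfolding sum_constant of_nat_id by (intro mult_le_mono card_mono norm) auto
  finally have "(q - 1) * Suc q \<le> card K * Suc q" using q by (simp add: power2_eq_square algebra_simps)
  then have "q - 1 \<le> card K" by (simp only: mult_le_cancel2)
  moreover have "card K = card {x :: 'a. x ^ q = x} - 1" unfolding K_def using q by (intro card_Diff_singleton) auto
  moreover have "card {x :: 'a. x ^ q = x} > 0" by (auto simp: card_gt_0_iff intro: exI[of _ 1])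
  ultimately show "q \<le> card {x :: 'a. x ^ q = x}" by linarith
qed

text \<open>A prime power q with q^2 elements in the field is a power of the characteristic, so the
  q-th power map is additive and the type really is the fixed field, of order q.\<close>

lemma quad_ext_half_field:
  assumes q: "primepow q" "odd q" and card: "CARD('a::{field,finite}) = q\<^sup>2"
  shows "quad_ext (Rep_half_field :: 'a half_field \<Rightarrow> 'a) q"
proof -
  obtain p k where p: "prime p" "k > 0" "q = p ^ k" using q(1) by (auto simp: primepow_def)
  have "CHAR('a) dvd p ^ (k * 2)" using CHAR_dvd_CARD[where 'a = 'a] card p(3) by (simp add: power_mult)
  with prime_CHAR_finite_field[where 'a = 'a] have "CHAR('a) dvd p" by (rule prime_dvd_power)
  then have char: "CHAR('a) = p" using prime_CHAR_finite_field[where 'a = 'a] p(1) by (simp add: primes_dvd_imp_eq)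
  have frob: "(x + y :: 'a) ^ q = x ^ q + y ^ q" for x y
    using freshmans_dream'[of q k x y] p char by simp
  then have exp: "half_exp TYPE('a) = q" using card by (intro half_exp_eq) (simp add: quad_exp_def)
  have range: "range (Rep_half_field :: 'a half_field \<Rightarrow> 'a) = {x. x ^ q = x}"
    using type_definition.Rep_range[OF type_definition_half_field[where 'a = 'a]] by (simp add: exp)
  have "card (range (Rep_half_field :: 'a half_field \<Rightarrow> 'a)) = CARD('a half_field)"
    by (intro card_image) (simp add: inj_on_def Rep_half_field_inject)
  then have "CARD('a half_field) = q" using card_fixed_power[OF card] range by simp
  then show ?thesis
    using frob range card q(2) by unfold_locales (simp_all add: Rep_half_field_hom)
qed

theorem corollary11p4:
  fixes q :: nat
  assumes "primepow q" and "odd q"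
    and "CARD('a::{field,finite}) = q ^ 2"
  shows "(\<lambda>m. iota_U TYPE('a) (2 * m) q) \<longlonglongrightarrow> r_U_inf TYPE('a) q * phi_U_inf (real q) ^ 3
    \<and> (\<lambda>m. iota_U TYPE('a) (2 * m + 1) q)
        \<longlonglongrightarrow> r_U_inf TYPE('a) q * phi_U_inf (real q) ^ 3 / (1 + real q powi (-1))"
proof -
  interpret quad_ext "Rep_half_field :: 'a half_field \<Rightarrow> 'a" q
    using assms by (rule quad_ext_half_field)
  show ?thesis using iota_U_limits by blast
qed

end
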